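(* Let $0<\beta<\alpha<1$, let $h\ge0$ be measurable with $\mathbb{E}[h(T_\beta)]=1$, and suppose $\tilde V\sim\mathrm{PK}_\alpha(\tilde h_{\beta/\alpha}\cdot f_\alpha)$, where $\tilde h_{\beta/\alpha}(v):=\mathbb{E}_{\beta/\alpha}[h(vT_{\beta/\alpha}^{1/\alpha})]$. Then the EPPF of the associated Gibbs partition of $[n]$ can be expressed, for positive integers $n_1,\dots,n_k$ with sum $n$, as $$\left[\sum_{j=1}^k\mathbb{P}^{(k)}_{\frac{\beta}{\alpha},0}(j)\,\Psi^{[\beta]}_{n,j}\right]p_\alpha(n_1,\ldots,n_k),$$ and, for $T_\beta:=T_\alpha(T_{\beta/\alpha}(1))$, there is the identity $$\mathbb{E}_\alpha\big[\tilde h_{\beta/\alpha}(T_\alpha)\,\big|\,K^{[\alpha]}_n=k\big]=\mathbb{E}\big[h(T_\beta)\,\big|\,K^{[\alpha]}_n=k\big]=\sum_{j=1}^k\mathbb{P}^{(k)}_{\frac{\beta}{\alpha},0}(j)\,\Psi^{[\beta]}_{n,j}.$$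
   Context: $\mathcal P_\infty=\{(s_1,s_2,\ldots): s_1\ge s_2\ge\cdots\ge 0,\ \sum_k s_k=1\}$. For $\gamma\in(0,1)$ let $J_1>J_2>\cdots$ be the ranked points of a Poisson process on $(0,\infty)$ with intensity $\frac{\gamma}{\Gamma(1-\gamma)}x^{-\gamma-1}dx$ and $T_\gamma=\sum_i J_i$, a positive $\gamma$-stable variable with $\mathbb{E}[e^{-\lambda T_\gamma}]=e^{-\lambda^\gamma}$ and density $f_\gamma$. $\mathbb{E}_\gamma$ denotes expectation in the $\mathrm{PD}(\gamma,0)$ model (with respect to $T_\gamma$ and the associated partition). $\mathrm{PD}(\gamma,0)$ is the law of $(J_i/T_\gamma)_i$, $\mathrm{PD}(\gamma|t)$ is its regular conditional law given $T_\gamma=t$, and $T_\gamma$ is called the inverse local time at $1$ of $(J_i/T_\gamma)_i$. For measurable $h\ge0$ with $\mathbb{E}[h(T_\gamma)]=1$, $\mathrm{PK}_\gamma(h\cdot f_\gamma)=\int_0^\infty \mathrm{PD}(\gamma|t)h(t)f_\gamma(t)\,dt$. Partitions: a random $P\in\mathcal P_\infty$ generates an exchangeable partition of $[n]=\{1,\dots,n\}$ by sampling, given $P$, iid indices $I_1,\dots,I_n$ with $\mathbb{P}(I_m=i|P)=P_i$, and putting $m,m'$ in the same block iff $I_m=I_{m'}$. Its EPPF $p(n_1,\dots,n_k)$ is the probability that it equals a given partition $\{A_1,\dots,A_k\}$ of $[n]$ with $|A_i|=n_i$. The EPPF for $\mathrm{PD}(\alpha,0)$ is $p_\alpha(n_1,\dots,n_k)=\frac{\alpha^{k-1}\Gamma(k)}{\Gamma(n)}\prod_{j=1}^k(1-\alpha)_{n_j-1}$,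 $(x)_m=\Gamma(x+m)/\Gamma(x)$. $K_n^{[\gamma]}$ is the number of blocks of the $\mathrm{PD}(\gamma,0)$ partition of $[n]$ (generated by $(J_i/T_\gamma)_i$), $\mathbb{P}^{(k)}_{\gamma,0}(j)=\mathbb{P}(K_k^{[\gamma]}=j)$, and $\Psi^{[\beta]}_{n,j}=\mathbb{E}_\beta[h(T_\beta)|K_n^{[\beta]}=j]$. In $\mathbb{E}[h(T_\beta)|K_n^{[\alpha]}=k]$: $V_\alpha\sim\mathrm{PD}(\alpha,0)$ has inverse local time $T_\alpha$ and generates a partition with $K_n^{[\alpha]}$ blocks; $T_{\beta/\alpha}$ is independent of $V_\alpha$ and of this partition; and $T_\beta=T_\alpha(T_{\beta/\alpha}(1))$ is represented as $T_\alpha T_{\beta/\alpha}^{1/\alpha}$. *)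

theory Defs
  imports "HOL-Probability.Probability"
begin

text \<open>
  Sequences \<open>(s\<^sub>1, s\<^sub>2, \<dots>)\<close> are functions on \<^typ>\<open>nat\<close> (so indices start at 0), while the sample
  indices \<open>I\<^sub>1, \<dots>, I\<^sub>n\<close> and the ground set of the partitions are indexed by \<open>{1..n}\<close>.
  Laws on \<open>P_inf\<close> are laws on the product space \<open>seq_space\<close> that are concentrated on \<open>P_inf\<close>.
\<close>

abbreviation seq_space :: "(nat \<Rightarrow> real) measure" where
  "seq_space \<equiv> PiM UNIV (\<lambda>_. borel)"

definition P_inf :: "(nat \<Rightarrow> real) set" where
  "P_inf = {s. decseq s \<and> (\<forall>i. 0 \<le> s i) \<and> s sums 1}"

subsection \<open>The ranked points of the stable Poisson process\<close>

definition stable_intensity :: "real \<Rightarrow> real measure" where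
  "stable_intensity \<gamma> =
     density lborel (\<lambda>x. ennreal (\<gamma> / Gamma (1 - \<gamma>) * x powr (- \<gamma> - 1)) * indicator {0<..} x)"

definition num_points :: "(nat \<Rightarrow> 'w \<Rightarrow> real) \<Rightarrow> real set \<Rightarrow> 'w \<Rightarrow> ennreal" where
  "num_points J B \<omega> = emeasure (count_space UNIV) {i. J i \<omega> \<in> B}"

text \<open>
  \<open>J\<close> lists, in decreasing order, the points of a Poisson process with intensity
  \<open>stable_intensity \<gamma>\<close>. The Poisson law with infinite mean is the point mass at infinity.
\<close>

definition ranked_stable_ppp :: "real \<Rightarrow> 'w measure \<Rightarrow> (nat \<Rightarrow> 'w \<Rightarrow> real) \<Rightarrow> bool" where
  "ranked_stable_ppp \<gamma> M J \<longleftrightarrow>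
     prob_space M \<and>
     (\<forall>i. J i \<in> borel_measurable M) \<and>
     (AE \<omega> in M. \<forall>i. 0 < J (Suc i) \<omega> \<and> J (Suc i) \<omega> < J i \<omega>) \<and>
     (\<forall>B. B \<in> sets borel \<and> B \<subseteq> {0<..} \<and> emeasure (stable_intensity \<gamma>) B < \<infinity> \<longrightarrow>
        (\<forall>c::nat. emeasure M {\<omega> \<in> space M. num_points J B \<omega> = of_nat c} =
           ennreal (exp (- measure (stable_intensity \<gamma>) B) *
                    measure (stable_intensity \<gamma>) B ^ c / fact c))) \<and>
     (\<forall>B. B \<in> sets borel \<and> B \<subseteq> {0<..} \<and> emeasure (stable_intensity \<gamma>) B = \<infinity> \<longrightarrow>
        (AE \<omega> in M. num_points J B \<omega> = \<infinity>)) \<and>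
     (\<forall>(L::nat set) B. finite L \<and> (\<forall>l\<in>L. B l \<in> sets borel \<and> B l \<subseteq> {0<..}) \<and>
        disjoint_family_on B L \<longrightarrow>
        prob_space.indep_vars M (\<lambda>_. borel) (\<lambda>l. num_points J (B l)) L)"

definition total_mass :: "(nat \<Rightarrow> 'w \<Rightarrow> real) \<Rightarrow> 'w \<Rightarrow> real" where
  "total_mass J \<omega> = (\<Sum>i. J i \<omega>)"

definition pd_seq :: "(nat \<Rightarrow> 'w \<Rightarrow> real) \<Rightarrow> 'w \<Rightarrow> (nat \<Rightarrow> real)" where
  "pd_seq J \<omega> = (\<lambda>i. J i \<omega> / total_mass J \<omega>)"

subsection \<open>Partitions generated by a random element of \<open>P_inf\<close>\<close>

text \<open>
  Given \<open>V\<close>, the indices \<open>I 1, \<dots>, I n\<close> are iid with \<open>P(I m = i | V) = V i\<close>. For discrete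
  variables this says that their joint conditional probability mass function, given the
  sigma-algebra generated by \<open>V\<close>, is the product of the masses \<open>V (i m)\<close>.
\<close>

definition iid_sample ::
    "'w measure \<Rightarrow> ('w \<Rightarrow> nat \<Rightarrow> real) \<Rightarrow> nat \<Rightarrow> (nat \<Rightarrow> 'w \<Rightarrow> nat) \<Rightarrow> bool" where
  "iid_sample M V n I \<longleftrightarrow>
     prob_space M \<and>
     V \<in> measurable M seq_space \<and>
     (AE \<omega> in M. V \<omega> \<in> P_inf) \<and>
     (\<forall>m\<in>{1..n}. I m \<in> measurable M (count_space UNIV)) \<and>
     (\<forall>i::nat \<Rightarrow> nat. AE \<omega> in M.
        real_cond_exp M (vimage_algebra (space M) V seq_space)
          (indicator {\<omega> \<in> space M. \<forall>m\<in>{1..n}. I m \<omega> = i m}) \<omega>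
        = (\<Prod>m\<in>{1..n}. V \<omega> (i m)))"

definition sample_partition :: "nat \<Rightarrow> (nat \<Rightarrow> 'w \<Rightarrow> nat) \<Rightarrow> 'w \<Rightarrow> nat set set" where
  "sample_partition n I \<omega> =
     {1..n} // {(m, m'). m \<in> {1..n} \<and> m' \<in> {1..n} \<and> I m \<omega> = I m' \<omega>}"

definition num_blocks :: "nat \<Rightarrow> (nat \<Rightarrow> 'w \<Rightarrow> nat) \<Rightarrow> 'w \<Rightarrow> nat" where
  "num_blocks n I \<omega> = card (sample_partition n I \<omega>)"

text \<open>The \<open>PD(\<gamma>,0)\<close> model together with the partition of \<open>{1..n}\<close> it generates.\<close>

definition pd_model ::
    "real \<Rightarrow> 'w measure \<Rightarrow> (nat \<Rightarrow> 'w \<Rightarrow> real) \<Rightarrow> nat \<Rightarrow> (nat \<Rightarrow> 'w \<Rightarrow> nat) \<Rightarrow> bool" where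
  "pd_model \<gamma> M J n I \<longleftrightarrow> ranked_stable_ppp \<gamma> M J \<and> iid_sample M (pd_seq J) n I"

definition pd_eppf :: "real \<Rightarrow> nat list \<Rightarrow> real" where
  "pd_eppf \<alpha> ns =
     \<alpha> ^ (length ns - 1) * Gamma (real (length ns)) / Gamma (real (sum_list ns)) *
     (\<Prod>j<length ns. pochhammer (1 - \<alpha>) (ns ! j - 1))"

subsection \<open>Conditioning and Poisson--Kingman laws\<close>

text \<open>Conditional expectation of a nonnegative variable given an event of positive probability.\<close>

definition cond_expect :: "'w measure \<Rightarrow> ('w \<Rightarrow> ennreal) \<Rightarrow> ('w \<Rightarrow> bool) \<Rightarrow> ennreal" where
  "cond_expect M X Q = (\<integral>\<^sup>+\<omega>. X \<omega> \<partial>uniform_measure M {\<omega> \<in> space M. Q \<omega>})"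

text \<open>\<open>\<kappa>\<close> is a version of \<open>t \<mapsto> PD(\<gamma>|t)\<close> when \<open>J\<close> is the ranked \<open>\<gamma>\<close>-stable Poisson process.\<close>

definition regular_cond_law ::
    "'w measure \<Rightarrow> (nat \<Rightarrow> 'w \<Rightarrow> real) \<Rightarrow> (real \<Rightarrow> (nat \<Rightarrow> real) measure) \<Rightarrow> bool" where
  "regular_cond_law M J \<kappa> \<longleftrightarrow>
     \<kappa> \<in> measurable borel (prob_algebra seq_space) \<and>
     (\<forall>B\<in>sets seq_space. \<forall>C\<in>sets borel.
        emeasure M {\<omega> \<in> space M. pd_seq J \<omega> \<in> B \<and> total_mass J \<omega> \<in> C} =
        (\<integral>\<^sup>+t. emeasure (\<kappa> t) B * indicator C t \<partial>distr M borel (total_mass J)))"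

definition PK ::
    "(real \<Rightarrow> (nat \<Rightarrow> real) measure) \<Rightarrow> (real \<Rightarrow> ennreal) \<Rightarrow> (real \<Rightarrow> ennreal) \<Rightarrow>
     (nat \<Rightarrow> real) measure" where
  "PK \<kappa> h f = bind (density lborel (\<lambda>t. h t * f t * indicator {0<..} t)) \<kappa>"

text \<open>
  \<open>h\<close> averaged over a stable variable of index \<open>\<beta>/\<alpha>\<close>, the total mass of the points \<open>J\<close>.
  It may be infinite at some \<open>v\<close>, hence the type \<^typ>\<open>ennreal\<close>.
\<close>

definition h_tilde ::
    "real \<Rightarrow> (real \<Rightarrow> real) \<Rightarrow> 'w measure \<Rightarrow> (nat \<Rightarrow> 'w \<Rightarrow> real) \<Rightarrow> real \<Rightarrow> ennreal" where
  "h_tilde \<alpha> h M J v = (\<integral>\<^sup>+\<omega>. ennreal (h (v * total_mass J \<omega> powr (1 / \<alpha>))) \<partial>M)"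

definition Psi ::
    "(real \<Rightarrow> real) \<Rightarrow> 'w measure \<Rightarrow> (nat \<Rightarrow> 'w \<Rightarrow> real) \<Rightarrow> nat \<Rightarrow> (nat \<Rightarrow> 'w \<Rightarrow> nat) \<Rightarrow> nat \<Rightarrow> ennreal"
  where
  "Psi h M J n I j =
     cond_expect M (\<lambda>\<omega>. ennreal (h (total_mass J \<omega>))) (\<lambda>\<omega>. num_blocks n I \<omega> = j)"

definition block_prob :: "'w measure \<Rightarrow> nat \<Rightarrow> (nat \<Rightarrow> 'w \<Rightarrow> nat) \<Rightarrow> nat \<Rightarrow> ennreal" where
  "block_prob M k I j = emeasure M {\<omega> \<in> space M. num_blocks k I \<omega> = j}"

end

theory Submission
  imports Defs
begin

text \<open>
  For a stable Poisson process with ranked points \<open>J\<close> and sum \<open>T\<close>, the expectation of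
  \<open>\<Sum> \<Prod>\<^sub>j J\<^bsub>i\<^sub>j\<^esub>\<^bsup>n\<^sub>j\<^esup> exp (- y T)\<close> over distinct indices factorizes. Since \<open>T\<close> is almost surely
  a function of \<open>J / T\<close>, this says that \<open>E[T\<^sup>n exp (- y T); \<Pi> = A] = P(\<Pi> = A) \<gamma> \<Gamma>(n) / \<Gamma>(k) y\<^bsup>k\<gamma> - n\<^esup> exp (- y\<^sup>\<gamma>)\<close>
  for every partition \<open>A\<close> of \<open>{1..n}\<close> into \<open>k\<close> blocks. Hence, given \<open>\<Pi>\<close>, the law of \<open>T\<close> depends on \<open>k\<close> only,
  which gives the Gibbs form of the EPPF.

  For \<open>R = T\<^sub>\<alpha> S\<^bsup>1/\<alpha>\<^esup>\<close> with \<open>S\<close> independent and stable of index \<open>\<delta> = \<beta>/\<alpha>\<close>, the same formula in the \<open>\<alpha>\<close> model gives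
  \<open>E[R\<^sup>n exp (- y R); K\<^sub>n = k] = P(K\<^sub>n = k) \<alpha> \<Gamma>(n) / \<Gamma>(k) y\<^bsup>k\<alpha> - n\<^esup> E[S\<^sup>k exp (- y\<^sup>\<alpha> S)]\<close>. Expanding the last
  expectation over the number of blocks of the \<open>\<delta>\<close> partition of \<open>{1..k}\<close>, and comparing with the formula
  in the \<open>\<beta>\<close> model, identifies the law of \<open>R\<close> given \<open>K\<^sub>n = k\<close> as the stated mixture.
\<close>

section \<open>Integrals against the stable intensity\<close>

text \<open>\<open>iid_sample\<close> describes the sampling given the normalized sequence only, so
  \<open>T\<close> and the partition cannot be treated jointly until \<open>T\<close> is recovered
  from \<open>J / T\<close>. The information sits in the small points: sums of powers with exponent
  slightly above \<gamma> grow at a deterministic rate for the raw points, and comparing this with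
  their growth for the normalized points reveals the scale. The Poisson process is given by the law
  of its counts. Its Laplace functional is built from them, and moments over distinct indices come
  from differentiating that functional in a perturbation of the exponent. The factor
  \<open>T ^ n\<close> is there because a sum over distinct indices with exponents adding up to n is
  homogeneous of degree n: it trades normalized points for raw ones, so that no formula for the
  density of \<open>T\<close> enters. \<open>h_tilde\<close> may be infinite at some points.
  Identities therefore live in \<open>ennreal\<close>, in additive or cross-multiplied form, and
  reach \<open>h\<close> from exponentials through uniqueness of Laplace transforms, with no
  approximation of \<open>h\<close>.\<close>

lemma nn_integral_powr_substitution:
  fixes a :: real and g :: "real \<Rightarrow> ennreal"
  assumes a: "0 < a" and g[measurable]: "g \<in> borel_measurable borel"
  shows "(\<integral>\<^sup>+u. g u * indicator {0<..} u \<partial>lborel) =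
    (\<integral>\<^sup>+x. g (x powr a) * (ennreal (a * x powr (a - 1)) * indicator {0<..} x) \<partial>lborel)"
proof -
  let ?d = "\<lambda>x. ennreal (a * x powr (a - 1)) * indicator {0<..} x"
  have eq: "density lborel (indicator {0<..}) = distr (density lborel ?d) borel (\<lambda>x. x powr a)"
  proof (rule measure_eqI)
    fix B :: "real set" assume "B \<in> sets (density lborel (indicator {0<..}))"
    then have B[measurable]: "B \<in> sets borel" by simp
    \<comment> \<open>For a < 1 the derivative \<open>a * x powr (a - 1)\<close> is unbounded at 0.
      On the compact intervals from 1/(m+1) to m+1 it is continuous, and these exhaust the
      half-line, so monotone convergence finishes on both sides.\<close>
    let ?l = "\<lambda>m::nat. 1 / real (Suc m)" and ?u = "\<lambda>m::nat. real (Suc m)"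
    let ?L = "\<lambda>m x. ennreal (indicator B x * indicator {?l m powr a .. ?u m powr a} x)"
    let ?R = "\<lambda>m x. ennreal (indicator B (x powr a) * (a * x powr (a - 1)) * indicator {?l m .. ?u m} x)"
    have eqm: "integral\<^sup>N lborel (?L m) = integral\<^sup>N lborel (?R m)" for m
    proof -
      have lpos: "0 < ?l m" by simp
      show ?thesis
      proof (rule nn_integral_substitution[where g="\<lambda>x. x powr a" and g'="\<lambda>x. a * x powr (a - 1)"
            and a="?l m" and b="?u m" and f="indicator B"])
        show "?l m \<le> ?u m" by (simp add: field_simps)
        show "((\<lambda>x. x powr a) has_real_derivative a * x powr (a - 1)) (at x)"
          if "x \<in> {?l m..?u m}" for x
          using that lpos by (intro has_real_derivative_powr) (smt (verit) atLeastAtMost_iff)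
        show "continuous_on {?l m..?u m} (\<lambda>x. a * x powr (a - 1))"
          using lpos by (intro continuous_intros) (smt (verit) atLeastAtMost_iff)
        show "0 \<le> a * x powr (a - 1)" for x using a by simp
        show "set_borel_measurable borel {?l m powr a .. ?u m powr a} (indicat_real B)"
          unfolding set_borel_measurable_def by measurable
      qed
    qed
    have mono: "?l (Suc m) \<le> ?l m" "?u m \<le> ?u (Suc m)" for m by (auto simp: field_simps)
    have sub: "{?l m .. ?u m} \<subseteq> {?l (Suc m) .. ?u (Suc m)}" for m using mono[of m] by auto
    have sub': "{?l m powr a .. ?u m powr a} \<subseteq> {?l (Suc m) powr a .. ?u (Suc m) powr a}" for m
    proof -
      have "?l (Suc m) powr a \<le> ?l m powr a" "?u m powr a \<le> ?u (Suc m) powr a"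
        using mono[of m] a by (intro powr_mono2; simp)+
      then show ?thesis by auto
    qed
    have ev: "eventually (\<lambda>m. x \<in> {?l m .. ?u m}) sequentially" if "x > 0" for x :: real
    proof -
      obtain N :: nat where N: "x \<le> real N" using real_arch_simple by blast
      obtain K :: nat where K: "inverse (real (Suc K)) < x" using reals_Archimedean[OF \<open>x > 0\<close>] by auto
      have "x \<in> {?l m .. ?u m}" if m: "N + K \<le> m" for m
      proof -
        have "real N \<le> real m" "real K \<le> real m" using m by auto
        moreover have "1 / real (Suc m) \<le> 1 / real (Suc K)"
          using m by (intro divide_left_mono) auto
        ultimately show ?thesis using N K by (auto simp: inverse_eq_divide)
      qed
      then show ?thesis unfolding eventually_sequentially by blast
    qed
    have evn: "eventually (\<lambda>m. x \<notin> {?l m .. ?u m}) sequentially" if "\<not> x > 0" for x :: real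
    proof (rule always_eventually, rule allI)
      fix m have "0 < ?l m" by simp
      then show "x \<notin> {?l m .. ?u m}" using that by (smt (verit) atLeastAtMost_iff)
    qed
    have in_powr: "x powr (1/a) \<in> {?l m .. ?u m} \<Longrightarrow> x \<in> {?l m powr a .. ?u m powr a}" if "x > 0" for x m
    proof -
      assume *: "x powr (1/a) \<in> {?l m .. ?u m}"
      have "?l m powr a \<le> (x powr (1/a)) powr a" "(x powr (1/a)) powr a \<le> ?u m powr a"
        using * a by (intro powr_mono2; simp)+
      then show ?thesis using that a by (simp add: powr_powr)
    qed
    have limL: "(\<lambda>m. ?L m x) \<longlonglongrightarrow> indicator {0<..} x * indicator B x" for x
    proof (cases "x > 0")
      case True
      then have "eventually (\<lambda>m. x powr (1/a) \<in> {?l m .. ?u m}) sequentially" by (intro ev) simp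
      then have "eventually (\<lambda>m. ?L m x = indicator {0<..} x * indicator B x) sequentially"
        using in_powr[OF True] by (auto elim!: eventually_mono simp: indicator_def True)
      then show ?thesis by (rule tendsto_eventually)
    next
      case False
      have "?L m x = indicator {0<..} x * indicator B x" for m
      proof -
        have "0 < ?l m powr a" by simp
        then have "x \<notin> {?l m powr a .. ?u m powr a}" using False by (smt (verit) atLeastAtMost_iff)
        then show ?thesis using False by simp
      qed
      then show ?thesis by simp
    qed
    have limR: "(\<lambda>m. ?R m x) \<longlonglongrightarrow> ?d x * indicator B (x powr a)" for x
    proof (cases "x > 0")
      case True
      show ?thesis
        using ev[OF True] by (intro tendsto_eventually, elim eventually_mono) (auto simp: indicator_def True)
    next
      case False
      show ?thesis
        using evn[OF False] by (intro tendsto_eventually, elim eventually_mono) (auto simp: indicator_def False)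
    qed
    have incL: "incseq ?L" 
    proof (rule incseq_SucI, rule le_funI, rule ennreal_leI)
      fix m x show "indicator B x * indicator {?l m powr a .. ?u m powr a} x \<le>
          indicat_real B x * indicator {?l (Suc m) powr a .. ?u (Suc m) powr a} x"
        by (intro mult_left_mono indicator_leI subsetD[OF sub'[of m]]) auto
    qed
    have incR: "incseq ?R" 
    proof (rule incseq_SucI, rule le_funI, rule ennreal_leI)
      fix m x show "indicator B (x powr a) * (a * x powr (a - 1)) * indicator {?l m .. ?u m} x \<le>
          indicat_real B (x powr a) * (a * x powr (a - 1)) * indicator {?l (Suc m) .. ?u (Suc m)} x"
        using a by (intro mult_left_mono indicator_leI subsetD[OF sub[of m]]) auto
    qed
    have "(\<lambda>m. integral\<^sup>N lborel (?L m)) \<longlonglongrightarrow> (\<integral>\<^sup>+x. indicator {0<..} x * indicator B x \<partial>lborel)"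
      by (rule nn_integral_LIMSEQ[OF incL _ limL]) measurable
    moreover have "(\<lambda>m. integral\<^sup>N lborel (?R m)) \<longlonglongrightarrow> (\<integral>\<^sup>+x. ?d x * indicator B (x powr a) \<partial>lborel)"
      by (rule nn_integral_LIMSEQ[OF incR _ limR]) measurable
    ultimately have "(\<integral>\<^sup>+x. indicator {0<..} x * indicator B x \<partial>lborel) = (\<integral>\<^sup>+x. ?d x * indicator B (x powr a) \<partial>lborel)"
      unfolding eqm by (rule LIMSEQ_unique)
    moreover have "emeasure (distr (density lborel ?d) borel (\<lambda>x. x powr a)) B =
        (\<integral>\<^sup>+x. indicator B x \<partial>distr (density lborel ?d) borel (\<lambda>x. x powr a))"
      by simp
    moreover have "\<dots> = (\<integral>\<^sup>+x. ?d x * indicator B (x powr a) \<partial>lborel)"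
      by (subst nn_integral_distr; (subst nn_integral_density)?; simp)
    ultimately show "emeasure (density lborel (indicator {0<..})) B =
      emeasure (distr (density lborel ?d) borel (\<lambda>x. x powr a)) B"
      by (simp add: emeasure_density)
  qed simp
  have "(\<integral>\<^sup>+u. g u * indicator {0<..} u \<partial>lborel) = integral\<^sup>N (density lborel (indicator {0<..})) g"
    by (subst nn_integral_density) (auto simp: mult.commute)
  also have "\<dots> = (\<integral>\<^sup>+x. g (x powr a) * ?d x \<partial>lborel)"
    unfolding eq by (subst nn_integral_distr; (subst nn_integral_density)?; simp add: mult.commute)
  finally show ?thesis .
qed

lemma nn_integral_Gamma_scaled:
  fixes s y :: real
  assumes s: "0 < s" and y: "0 < y"
  shows "(\<integral>\<^sup>+x. ennreal (x powr (s - 1) * exp (- (y * x))) * indicator {0<..} x \<partial>lborel) =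
    ennreal (Gamma s * y powr (- s))"
proof -
  let ?f = "\<lambda>t::real. ennreal (indicator {0..} t * t powr (s - 1) / exp t)"
  have "ennreal (Gamma s) = (\<integral>\<^sup>+t. ?f t \<partial>lborel)" by (rule Gamma_conv_nn_integral_real[OF s])
  also have "\<dots> = \<bar>y\<bar> * (\<integral>\<^sup>+x. ?f (0 + y * x) \<partial>lborel)"
    using y by (intro nn_integral_real_affine) auto
  also have "(\<integral>\<^sup>+x. ?f (0 + y * x) \<partial>lborel) =
      (\<integral>\<^sup>+x. ennreal (y powr (s - 1)) * (ennreal (x powr (s - 1) * exp (- (y * x))) * indicator {0<..} x) \<partial>lborel)"
    by (intro nn_integral_cong_AE AE_I[where N="{0}"])
       (use y in \<open>auto simp: indicator_def powr_mult exp_minus divide_simps zero_le_mult_iff simp flip: ennreal_mult\<close>)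
  also have "\<dots> = ennreal (y powr (s - 1)) *
      (\<integral>\<^sup>+x. ennreal (x powr (s - 1) * exp (- (y * x))) * indicator {0<..} x \<partial>lborel)"
    by (rule nn_integral_cmult) measurable
  finally have "ennreal (Gamma s) = ennreal (y powr s) *
      (\<integral>\<^sup>+x. ennreal (x powr (s - 1) * exp (- (y * x))) * indicator {0<..} x \<partial>lborel)"
    using y by (simp add: powr_diff mult.assoc[symmetric] flip: ennreal_mult)
  then have "ennreal (y powr (- s)) * ennreal (Gamma s) = ennreal (y powr (- s)) * ennreal (y powr s) *
      (\<integral>\<^sup>+x. ennreal (x powr (s - 1) * exp (- (y * x))) * indicator {0<..} x \<partial>lborel)"
    by (simp add: mult.assoc)
  also have "ennreal (y powr (- s)) * ennreal (y powr s) = 1"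
    using y by (simp flip: ennreal_mult powr_add)
  finally show ?thesis using s by (simp add: ennreal_mult' mult.commute)
qed

lemma nn_integral_stable_intensity:
  assumes [measurable]: "g \<in> borel_measurable borel"
  shows "(\<integral>\<^sup>+x. g x \<partial>stable_intensity \<gamma>) =
    (\<integral>\<^sup>+x. ennreal (\<gamma> / Gamma (1 - \<gamma>) * x powr (- \<gamma> - 1)) * g x * indicator {0<..} x \<partial>lborel)"
  unfolding stable_intensity_def
  by (subst nn_integral_density) (auto intro!: nn_integral_cong simp: indicator_def)

lemma sets_stable_intensity[simp, measurable_cong]: "sets (stable_intensity \<gamma>) = sets borel"
  by (simp add: stable_intensity_def)

lemma space_stable_intensity[simp]: "space (stable_intensity \<gamma>) = UNIV"
  by (simp add: stable_intensity_def)

lemma AE_stable_intensity_pos: "AE x in stable_intensity \<gamma>. 0 < x"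
  unfolding stable_intensity_def by (subst AE_density) (auto simp: indicator_def)

text \<open>This is the factor that one block of size n will contribute. The quotient of Gamma(n -
  \<gamma>) by the normalization Gamma(1 - \<gamma>) is the source of the Pochhammer symbols in the
  EPPF.\<close>

lemma stable_intensity_power_exp:
  assumes \<gamma>: "0 < \<gamma>" "\<gamma> < 1" and y: "0 < y" and n: "1 \<le> n"
  shows "(\<integral>\<^sup>+x. ennreal (x ^ n * exp (- (y * x))) \<partial>stable_intensity \<gamma>) =
    ennreal (\<gamma> * pochhammer (1 - \<gamma>) (n - 1) * y powr (\<gamma> - n))"
proof -
  have pw: "x powr (- \<gamma> - 1) * x ^ n = x powr (n - \<gamma> - 1)" if "x > 0" for x
    using that by (simp add: powr_realpow[symmetric] powr_add[symmetric]) (simp add: algebra_simps)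
  have G: "Gamma (1 - \<gamma>) > 0" using \<gamma> by (auto intro: Gamma_real_pos)
  have "(\<integral>\<^sup>+x. ennreal (x ^ n * exp (- (y * x))) \<partial>stable_intensity \<gamma>) =
     (\<integral>\<^sup>+x. ennreal (\<gamma> / Gamma (1 - \<gamma>)) *
        (ennreal (x powr (n - \<gamma> - 1) * exp (- (y * x))) * indicator {0<..} x) \<partial>lborel)"
    using \<gamma> G by (subst nn_integral_stable_intensity)
       (auto intro!: nn_integral_cong simp: indicator_def pw[symmetric] mult.assoc simp flip: ennreal_mult)
  also have "\<dots> = ennreal (\<gamma> / Gamma (1 - \<gamma>)) * ennreal (Gamma (n - \<gamma>) * y powr (- (n - \<gamma>)))"
    using nn_integral_Gamma_scaled[of "n - \<gamma>" y] \<gamma> y n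
    by (subst nn_integral_cmult) (auto simp: algebra_simps)
  also have "Gamma (n - \<gamma>) = Gamma (1 - \<gamma>) * pochhammer (1 - \<gamma>) (n - 1)"
    using \<gamma> n by (subst pochhammer_Gamma) (auto simp: Gamma_eq_zero_iff of_nat_diff elim!: nonpos_Ints_cases)
  finally show ?thesis
    using \<gamma> n G 
    by (simp add: pochhammer_nonneg ennreal_mult[symmetric])
qed

text \<open>The integrand is the integral of x exp(-sx) over s from 0 to y; after exchanging the
  integrals, the inner one is \<open>stable_intensity_power_exp\<close> with n = 1.\<close>

lemma stable_intensity_one_minus_exp:
  assumes \<gamma>: "0 < \<gamma>" "\<gamma> < 1" and y: "0 < y"
  shows "(\<integral>\<^sup>+x. ennreal (1 - exp (- (y * x))) \<partial>stable_intensity \<gamma>) = ennreal (y powr \<gamma>)"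
proof -
  let ?d = "\<lambda>x::real. ennreal (\<gamma> / Gamma (1 - \<gamma>) * x powr (- \<gamma> - 1)) * indicator {0<..} x"
  have FTC: "ennreal (1 - exp (- (y * x))) = (\<integral>\<^sup>+s. ennreal (x * exp (- (s * x))) * indicator {0..y} s \<partial>lborel)"
    if "x > 0" for x :: real
  proof -
    have "(\<integral>\<^sup>+s. ennreal (x * exp (- (s * x))) * indicator {0..y} s \<partial>lborel) =
      ennreal (- exp (- (y * x)) - (- exp (- (0 * x))))"
      using that y by (intro nn_integral_FTC_Icc) (auto intro!: derivative_eq_intros)
    then show ?thesis by simp
  qed
  have "(\<integral>\<^sup>+x. ennreal (1 - exp (- (y * x))) \<partial>stable_intensity \<gamma>) =
    (\<integral>\<^sup>+x. \<integral>\<^sup>+s. ?d x * (ennreal (x * exp (- (s * x))) * indicator {0..y} s) \<partial>lborel \<partial>lborel)"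
    by (subst nn_integral_stable_intensity)
       (auto intro!: nn_integral_cong simp: indicator_def FTC nn_integral_cmult)
  also have "\<dots> = (\<integral>\<^sup>+s. \<integral>\<^sup>+x. ?d x * (ennreal (x * exp (- (s * x))) * indicator {0..y} s) \<partial>lborel \<partial>lborel)"
    by (rule lborel_pair.Fubini') measurable
  also have "\<dots> = (\<integral>\<^sup>+s. ennreal (\<gamma> * s powr (\<gamma> - 1)) * indicator {0..y} s \<partial>lborel)"
  \<comment> \<open>At s = 0 the inner integral is infinite while
    \<open>0 powr (\<gamma> - 1)\<close> is 0, so the two sides agree only off the null set
    {0}.\<close>
  proof (intro nn_integral_cong_AE AE_I[where N="{0}"])
    have "(\<integral>\<^sup>+x. ?d x * (ennreal (x * exp (- (s * x))) * indicator {0..y} s) \<partial>lborel)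
       = ennreal (\<gamma> * s powr (\<gamma> - 1)) * indicator {0..y} s" if "s \<noteq> 0" for s
    proof (cases "s \<in> {0..y}")
      case True
      then show ?thesis using stable_intensity_power_exp[OF \<gamma>, of s 1] that
        by (simp add: nn_integral_stable_intensity) (simp add: mult_ac)
    qed simp
    then show "{x \<in> space lborel. (\<integral>\<^sup>+xa. ?d xa * (ennreal (xa * exp (- (x * xa))) * indicator {0..y} x) \<partial>lborel)
         \<noteq> ennreal (\<gamma> * x powr (\<gamma> - 1)) * indicator {0..y} x} \<subseteq> {0}" by auto
  qed auto
  also have "\<dots> = (\<integral>\<^sup>+s. ennreal (\<gamma> * s powr (\<gamma> - 1) * indicator {0..y} s) \<partial>lborel)"
    by (intro nn_integral_cong) (auto simp: indicator_def)
  also have "\<dots> = ennreal (\<gamma> * (y powr (\<gamma> - 1 + 1) / (\<gamma> - 1 + 1)))"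
  proof (rule nn_integral_has_integral_lborel)
    have "((\<lambda>s. \<gamma> * s powr (\<gamma> - 1)) has_integral (\<gamma> * (y powr (\<gamma> - 1 + 1) / (\<gamma> - 1 + 1)))) {0..y}"
      using \<gamma> y by (intro has_integral_mult_right has_integral_powr_from_0) auto
    then have "((\<lambda>s. if s \<in> {0..y} then \<gamma> * s powr (\<gamma> - 1) else 0) has_integral (\<gamma> * (y powr (\<gamma> - 1 + 1) / (\<gamma> - 1 + 1)))) UNIV"
      by (subst has_integral_restrict_UNIV)
    then show "((\<lambda>s. \<gamma> * s powr (\<gamma> - 1) * indicator {0..y} s) has_integral (\<gamma> * (y powr (\<gamma> - 1 + 1) / (\<gamma> - 1 + 1)))) UNIV"
      by (rule has_integral_eq[rotated]) (auto simp: indicator_def)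
  qed (use \<gamma> in auto)
  finally show ?thesis using \<gamma> by simp
qed

text \<open>Under x to x powr (\<gamma> / \<rho>) the intensity of index \<gamma> becomes that of
  index \<rho> times Gamma(1 - \<rho>) / Gamma(1 - \<gamma>). Power sums of the points are thus
  stable sums of another index; \<open>Z_Laplace\<close> rests on this.\<close>

lemma stable_intensity_one_minus_exp_powr:
  assumes \<gamma>: "0 < \<gamma>" "\<gamma> < 1" and \<rho>: "0 < \<rho>" "\<rho> < 1" and w: "0 < w"
  shows "(\<integral>\<^sup>+x. ennreal (1 - exp (- (w * x powr (\<gamma> / \<rho>)))) \<partial>stable_intensity \<gamma>) =
    ennreal (Gamma (1 - \<rho>) / Gamma (1 - \<gamma>) * w powr \<rho>)"
proof -
  define a where "a = \<gamma> / \<rho>"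
  have a: "a > 0" using \<gamma> \<rho> by (simp add: a_def)
  have G: "Gamma (1 - \<gamma>) > 0" "Gamma (1 - \<rho>) > 0" using \<gamma> \<rho> by (auto intro: Gamma_real_pos)
  then have G0: "Gamma (1 - \<gamma>) \<noteq> 0" "Gamma (1 - \<rho>) \<noteq> 0" by auto
  have ex: "a * (- \<rho> - 1) + (a - 1) = - \<gamma> - 1" using \<rho> by (simp add: a_def field_simps)
  have aux: "ennreal u * (ennreal v * e * (ennreal d * 1)) = ennreal (u * (v * d)) * e"
    if "0 \<le> u" "0 \<le> v" for u v d and e :: ennreal
    using that by (simp only: ennreal_mult' mult_nonneg_nonneg mult_1_right) (simp only: mult_ac)
  let ?g = "\<lambda>u::real. ennreal (\<rho> / Gamma (1 - \<rho>) * u powr (- \<rho> - 1)) * ennreal (1 - exp (- (w * u)))"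
  have "ennreal (Gamma (1 - \<rho>) / Gamma (1 - \<gamma>)) * ennreal (w powr \<rho>) =
      ennreal (Gamma (1 - \<rho>) / Gamma (1 - \<gamma>)) * (\<integral>\<^sup>+u. ?g u * indicator {0<..} u \<partial>lborel)"
    by (subst stable_intensity_one_minus_exp[OF \<rho> w, symmetric], subst nn_integral_stable_intensity) auto
  also have "\<dots> = ennreal (Gamma (1 - \<rho>) / Gamma (1 - \<gamma>)) *
      (\<integral>\<^sup>+x. ?g (x powr a) * (ennreal (a * x powr (a - 1)) * indicator {0<..} x) \<partial>lborel)"
    by (subst nn_integral_powr_substitution[OF a]) auto
  also have "\<dots> = (\<integral>\<^sup>+x. ennreal (Gamma (1 - \<rho>) / Gamma (1 - \<gamma>)) *
      (?g (x powr a) * (ennreal (a * x powr (a - 1)) * indicator {0<..} x)) \<partial>lborel)"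
    by (subst nn_integral_cmult) auto
  also have "\<dots> = (\<integral>\<^sup>+x. ennreal (1 - exp (- (w * x powr (\<gamma> / \<rho>)))) \<partial>stable_intensity \<gamma>)"
  proof (subst nn_integral_stable_intensity, measurable, intro nn_integral_cong)
    fix x :: real
    show "ennreal (Gamma (1 - \<rho>) / Gamma (1 - \<gamma>)) * (?g (x powr a) * (ennreal (a * x powr (a - 1)) * indicator {0<..} x))
      = ennreal (\<gamma> / Gamma (1 - \<gamma>) * x powr (- \<gamma> - 1)) * ennreal (1 - exp (- (w * x powr (\<gamma> / \<rho>)))) * indicator {0<..} x"
    proof (cases "x > 0")
      case True
      have "Gamma (1 - \<rho>) / Gamma (1 - \<gamma>) * (\<rho> / Gamma (1 - \<rho>) * (x powr a) powr (- \<rho> - 1) * (a * x powr (a - 1)))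
          = \<gamma> / Gamma (1 - \<gamma>) * ((x powr a) powr (- \<rho> - 1) * x powr (a - 1))"
        using G0 \<rho> by (simp add: a_def)
      also have "(x powr a) powr (- \<rho> - 1) * x powr (a - 1) = x powr (- \<gamma> - 1)"
        by (simp add: powr_powr powr_add[symmetric] ex)
      finally have e: "Gamma (1 - \<rho>) / Gamma (1 - \<gamma>) * (\<rho> / Gamma (1 - \<rho>) * (x powr a) powr (- \<rho> - 1) * (a * x powr (a - 1)))
          = \<gamma> / Gamma (1 - \<gamma>) * x powr (- \<gamma> - 1)" .
      have "ennreal (Gamma (1 - \<rho>) / Gamma (1 - \<gamma>)) * (?g (x powr a) * (ennreal (a * x powr (a - 1)) * 1)) =
        ennreal (Gamma (1 - \<rho>) / Gamma (1 - \<gamma>) * (\<rho> / Gamma (1 - \<rho>) * (x powr a) powr (- \<rho> - 1) * (a * x powr (a - 1))))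
         * ennreal (1 - exp (- (w * x powr a)))"
        using G \<rho> a by (intro aux) auto
      then show ?thesis unfolding e using True by (simp add: a_def)
    qed simp
  qed
  finally show ?thesis using G by (simp add: ennreal_mult[symmetric])
qed

text \<open>The substitution u = y powr \<gamma> reduces it to the Gamma integral. It serves to
  integrate out the Laplace variable when the probability of a partition is extracted from its
  Laplace formula.\<close>

lemma nn_integral_stable_Gamma:
  assumes \<gamma>: "0 < \<gamma>" and k: "1 \<le> k"
  shows "(\<integral>\<^sup>+y. ennreal (y powr (real k * \<gamma> - 1) * exp (- (y powr \<gamma>))) * indicator {0<..} y \<partial>lborel) =
    ennreal (Gamma (real k) / \<gamma>)"
proof -
  let ?I = "\<integral>\<^sup>+y. ennreal (y powr (real k * \<gamma> - 1) * exp (- (y powr \<gamma>))) * indicator {0<..} y \<partial>lborel"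
  have "ennreal (Gamma (real k)) = (\<integral>\<^sup>+u. ennreal (u powr (real k - 1) * exp (- u)) * indicator {0<..} u \<partial>lborel)"
    using nn_integral_Gamma_scaled[of "real k" 1] k by simp
  also have "\<dots> = (\<integral>\<^sup>+y. ennreal ((y powr \<gamma>) powr (real k - 1) * exp (- (y powr \<gamma>))) *
      (ennreal (\<gamma> * y powr (\<gamma> - 1)) * indicator {0<..} y) \<partial>lborel)"
    by (rule nn_integral_powr_substitution[OF \<gamma>]) measurable
  also have "\<dots> = (\<integral>\<^sup>+y. ennreal \<gamma> * (ennreal (y powr (real k * \<gamma> - 1) * exp (- (y powr \<gamma>))) * indicator {0<..} y) \<partial>lborel)"
    using \<gamma> by (intro nn_integral_cong)
       (auto simp: indicator_def powr_powr algebra_simps simp flip: ennreal_mult powr_add)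
  also have "\<dots> = ennreal \<gamma> * ?I" by (rule nn_integral_cmult) measurable
  finally have "ennreal (1/\<gamma>) * ennreal (Gamma (real k)) = ennreal (1 / \<gamma>) * ennreal \<gamma> * ?I"
    by (simp add: mult.assoc)
  also have "ennreal (1 / \<gamma>) * ennreal \<gamma> = 1" using \<gamma> by (simp flip: ennreal_mult)
  finally show ?thesis using \<gamma> by (simp add: ennreal_mult'[symmetric])
qed

section \<open>Uniqueness of Laplace transforms\<close>

text \<open>On [0,1] the Taylor polynomials of exp(itx) are bounded by exp |t|, so dominated
  convergence writes the characteristic function as a series in the moments, and Levy uniqueness
  applies. The factor \<open>b\<close> scales both measures to probabilities first.\<close>

lemma measure_eqI_moments:
  fixes \<mu> \<nu> :: "real measure"
  assumes sets: "sets \<mu> = sets borel" "sets \<nu> = sets borel"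
    and AE: "AE x in \<mu>. x \<in> {0..1}" "AE x in \<nu>. x \<in> {0..1}"
    and fin: "emeasure \<mu> UNIV < \<infinity>"
    and moments: "\<And>m::nat. (\<integral>\<^sup>+x. ennreal (x ^ m) \<partial>\<mu>) = (\<integral>\<^sup>+x. ennreal (x ^ m) \<partial>\<nu>)"
  shows "\<mu> = \<nu>"
proof -
  have sp: "space \<mu> = UNIV" "space \<nu> = UNIV" using sets[THEN sets_eq_imp_space_eq] by auto
  define c where "c = emeasure \<mu> UNIV"
  have c': "emeasure \<nu> UNIV = c" using moments[of 0] by (simp add: sp c_def)
  show ?thesis
  proof (cases "c = 0")
    case True
    have "emeasure \<mu> A = emeasure \<nu> A" for A
      using emeasure_mono[of A UNIV \<mu>] emeasure_mono[of A UNIV \<nu>] sets c' True c_def by auto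
    then show ?thesis using sets by (intro measure_eqI) auto
  next
    case False
    have cinf: "c \<noteq> \<infinity>" using fin by (auto simp: c_def)
    define b where "b = inverse c"
    have bc: "b * c = 1" "c * b = 1"
      using False cinf ennreal_divide_self[of c]
      by (auto simp: b_def mult.commute divide_ennreal_def less_top)
    let ?P = "scale_measure b \<mu>" and ?Q = "scale_measure b \<nu>"
    have rdP: "real_distribution ?P"
      unfolding real_distribution_def real_distribution_axioms_def
      using sets sp bc by (auto intro!: prob_spaceI simp: space_scale_measure c_def[symmetric])
    have rdQ: "real_distribution ?Q"
      unfolding real_distribution_def real_distribution_axioms_def
      using sets sp bc c' by (auto intro!: prob_spaceI simp: space_scale_measure)
    have charlim: "(\<lambda>N. \<Sum>k<N. (\<i> * complex_of_real t) ^ k / fact k *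
        complex_of_real (enn2real (b * (\<integral>\<^sup>+x. ennreal (x ^ k) \<partial>R))))
        \<longlonglongrightarrow> char (scale_measure b R) t"
      if R: "real_distribution (scale_measure b R)" "AE x in R. x \<in> {0..1}" "sets R = sets borel"
      for R :: "real measure" and t :: real
    proof -
      interpret R: real_distribution "scale_measure b R" by (rule R(1))
      have ae: "AE x in scale_measure b R. x \<in> {0..1}"
      proof -
        obtain Z where Z: "{x \<in> space R. x \<notin> {0..1}} \<subseteq> Z" "emeasure R Z = 0" "Z \<in> sets R"
          using R(2) by (rule AE_E)
        then show ?thesis by (intro AE_I[of _ _ Z]) (auto simp: space_scale_measure)
      qed
      have meas[measurable_cong]: "sets (scale_measure b R) = sets borel" using R(3) by simp
      have [measurable_cong]: "sets R = sets borel" by (rule R(3))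
      let ?s = "\<lambda>N x. \<Sum>k<N. (\<i> * complex_of_real t) ^ k / fact k * complex_of_real (x ^ k)"
      have int: "integrable (scale_measure b R) (\<lambda>x. x ^ k)" for k :: nat
        by (rule R.integrable_const_bound[of _ 1]) (use ae in \<open>auto elim!: eventually_mono simp: power_le_one simp del: atLeastAtMost_iff dest!: atLeastAtMost_iff[THEN iffD1]\<close>)
      have mom: "(\<integral>x. x ^ k \<partial>scale_measure b R) = enn2real (b * (\<integral>\<^sup>+x. ennreal (x ^ k) \<partial>R))" for k :: nat
        by (subst integral_eq_nn_integral) (use ae in \<open>auto elim!: eventually_mono simp: nn_integral_scale_measure\<close>)
      have "(\<lambda>N. \<integral>x. ?s N x \<partial>scale_measure b R) \<longlonglongrightarrow> (\<integral>x. iexp (t * x) \<partial>scale_measure b R)"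
      proof (rule integral_dominated_convergence[where w="\<lambda>_. exp \<bar>t\<bar>"])
        show "AE x in scale_measure b R. (\<lambda>N. ?s N x) \<longlonglongrightarrow> iexp (t * x)"
        proof (rule AE_I2)
          fix x
          have "(\<lambda>k. (\<i> * complex_of_real (t * x)) ^ k /\<^sub>R fact k) sums exp (\<i> * complex_of_real (t * x))"
            by (rule exp_converges)
          then show "(\<lambda>N. ?s N x) \<longlonglongrightarrow> iexp (t * x)"
            unfolding sums_def by (simp add: scaleR_conv_of_real power_mult_distrib field_simps)
        qed
        show "AE x in scale_measure b R. norm (?s N x) \<le> exp \<bar>t\<bar>" for N
          using ae
        proof eventually_elim
          case (elim x)
          have "norm (?s N x) \<le> (\<Sum>k<N. norm ((\<i> * complex_of_real t) ^ k / fact k * complex_of_real (x ^ k)))"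
            by (rule norm_sum)
          also have "\<dots> \<le> (\<Sum>k<N. \<bar>t\<bar> ^ k /\<^sub>R fact k)"
          proof (rule sum_mono)
            fix k
            have "\<bar>t\<bar> ^ k * (\<bar>x\<bar> ^ k) \<le> \<bar>t\<bar> ^ k * 1"
              using elim by (intro mult_left_mono power_le_one) auto
            then show "norm ((\<i> * complex_of_real t) ^ k / fact k * complex_of_real (x ^ k)) \<le> \<bar>t\<bar> ^ k /\<^sub>R fact k"
              by (simp add: norm_mult norm_divide norm_power field_simps)
          qed
          also have "\<dots> \<le> exp \<bar>t\<bar>"
            using exp_converges[of "\<bar>t\<bar>"] by (intro sum_le_suminf[THEN order_trans]) (auto simp: sums_iff)
          finally show ?case .
        qed
      qed (auto intro!: borel_measurable_sum)
      also have "(\<lambda>N. \<integral>x. ?s N x \<partial>scale_measure b R) =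
        (\<lambda>N. \<Sum>k<N. (\<i> * complex_of_real t) ^ k / fact k * complex_of_real (enn2real (b * (\<integral>\<^sup>+x. ennreal (x ^ k) \<partial>R))))"
        using int mom by (subst Bochner_Integration.integral_sum) (auto simp flip: of_real_power)
      finally show ?thesis unfolding char_def by simp
    qed
    have "char ?P = char ?Q"
    proof
      fix t show "char ?P t = char ?Q t"
        using charlim[OF rdP AE(1) sets(1), of t] charlim[OF rdQ AE(2) sets(2), of t]
        unfolding moments by (rule LIMSEQ_unique)
    qed
    then have PQ: "?P = ?Q" using Levy_uniqueness rdP rdQ by blast
    have "emeasure \<mu> A = emeasure \<nu> A" for A
    proof -
      have "c * (b * emeasure \<mu> A) = c * (b * emeasure \<nu> A)"
        using arg_cong[OF PQ, of "\<lambda>M. emeasure M A"] by simp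
      then show ?thesis by (simp add: mult.assoc[symmetric] bc)
    qed
    then show ?thesis using sets by (intro measure_eqI) auto
  qed
qed

text \<open>The variable exp(-X) under the weight w exp(-X) has a finite law on [0,1] whose m-th
  moment is the transform at 1 + m, so moments decide. The extra exponential in the weight admits
  weights \<open>w\<close> of infinite mass; the test function \<open>inverse u * g (- ln u)\<close>
  removes it again.\<close>

lemma nn_integral_eqI_Laplace:
  fixes X :: "'a \<Rightarrow> real" and Y :: "'b \<Rightarrow> real" and w :: "'a \<Rightarrow> ennreal" and v :: "'b \<Rightarrow> ennreal"
  assumes [measurable]: "X \<in> borel_measurable M" "w \<in> borel_measurable M"
      "Y \<in> borel_measurable N" "v \<in> borel_measurable N" "g \<in> borel_measurable borel"
    and pos: "AE \<omega> in M. 0 \<le> X \<omega>" "AE \<omega> in N. 0 \<le> Y \<omega>"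
    and fin: "(\<integral>\<^sup>+\<omega>. w \<omega> * ennreal (exp (- X \<omega>)) \<partial>M) < \<infinity>"
    and eq: "\<And>y. 0 < y \<Longrightarrow> (\<integral>\<^sup>+\<omega>. w \<omega> * ennreal (exp (- (y * X \<omega>))) \<partial>M) =
        (\<integral>\<^sup>+\<omega>. v \<omega> * ennreal (exp (- (y * Y \<omega>))) \<partial>N)"
  shows "(\<integral>\<^sup>+\<omega>. w \<omega> * g (X \<omega>) \<partial>M) = (\<integral>\<^sup>+\<omega>. v \<omega> * g (Y \<omega>) \<partial>N)"
proof -
  let ?\<mu> = "distr (density M (\<lambda>\<omega>. w \<omega> * ennreal (exp (- X \<omega>)))) borel (\<lambda>\<omega>. exp (- X \<omega>))"
  let ?\<nu> = "distr (density N (\<lambda>\<omega>. v \<omega> * ennreal (exp (- Y \<omega>)))) borel (\<lambda>\<omega>. exp (- Y \<omega>))"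
  have nnM: "integral\<^sup>N ?\<mu> f = (\<integral>\<^sup>+\<omega>. w \<omega> * ennreal (exp (- X \<omega>)) * f (exp (- X \<omega>)) \<partial>M)"
    if [measurable]: "f \<in> borel_measurable borel" for f
    by (subst nn_integral_distr; (subst nn_integral_density)?; simp)
  have nnN: "integral\<^sup>N ?\<nu> f = (\<integral>\<^sup>+\<omega>. v \<omega> * ennreal (exp (- Y \<omega>)) * f (exp (- Y \<omega>)) \<partial>N)"
    if [measurable]: "f \<in> borel_measurable borel" for f
    by (subst nn_integral_distr; (subst nn_integral_density)?; simp)
  have ex: "exp (- z) * exp (- z) ^ m = exp (- ((1 + real m) * z))" for z :: real and m :: nat
    by (simp add: exp_of_nat_mult[symmetric] exp_add[symmetric] algebra_simps)
  have "?\<mu> = ?\<nu>"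
  proof (rule measure_eqI_moments)
    show "AE x in ?\<mu>. x \<in> {0..1}"
      using pos(1) by (subst AE_distr_iff; (subst AE_density)?; simp) (auto elim!: eventually_mono)
    show "AE x in ?\<nu>. x \<in> {0..1}"
      using pos(2) by (subst AE_distr_iff; (subst AE_density)?; simp) (auto elim!: eventually_mono)
    show "emeasure ?\<mu> UNIV < \<infinity>"
      using fin by (subst emeasure_distr; (subst emeasure_density)?; simp cong: nn_integral_cong)
    fix m :: nat
    have "(\<integral>\<^sup>+x. ennreal (x ^ m) \<partial>?\<mu>) = (\<integral>\<^sup>+\<omega>. w \<omega> * ennreal (exp (- ((1 + real m) * X \<omega>))) \<partial>M)"
      by (subst nnM) (auto intro!: nn_integral_cong simp: mult.assoc ex[symmetric] ennreal_mult')
    also have "\<dots> = (\<integral>\<^sup>+\<omega>. v \<omega> * ennreal (exp (- ((1 + real m) * Y \<omega>))) \<partial>N)"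
      by (rule eq) simp
    also have "\<dots> = (\<integral>\<^sup>+x. ennreal (x ^ m) \<partial>?\<nu>)"
      by (subst nnN) (auto intro!: nn_integral_cong simp: mult.assoc ex[symmetric] ennreal_mult')
    finally show "(\<integral>\<^sup>+x. ennreal (x ^ m) \<partial>?\<mu>) = (\<integral>\<^sup>+x. ennreal (x ^ m) \<partial>?\<nu>)" .
  qed simp_all
  moreover have ee: "ennreal (exp (- z)) * (ennreal (inverse (exp (- z))) * g (- ln (exp (- z)))) = g z" for z
    by (simp add: mult.assoc[symmetric] exp_minus[symmetric] flip: ennreal_mult exp_add)
  moreover have "(\<integral>\<^sup>+\<omega>. w \<omega> * g (X \<omega>) \<partial>M) = (\<integral>\<^sup>+u. ennreal (inverse u) * g (- ln u) \<partial>?\<mu>)"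
    by (subst nnM) (simp_all only: mult.assoc ee, measurable)
  moreover have "(\<integral>\<^sup>+\<omega>. v \<omega> * g (Y \<omega>) \<partial>N) = (\<integral>\<^sup>+u. ennreal (inverse u) * g (- ln u) \<partial>?\<nu>)"
    by (subst nnN) (simp_all only: mult.assoc ee, measurable)
  ultimately show ?thesis by simp
qed

section \<open>Sums over distinct indices\<close>

definition nexp :: "ennreal \<Rightarrow> real" where
  "nexp x = (if x = \<infinity> then 0 else exp (- enn2real x))"

lemma nexp_ennreal[simp]: "0 \<le> r \<Longrightarrow> nexp (ennreal r) = exp (- r)"
  by (simp add: nexp_def)

lemma nexp_top[simp]: "nexp \<top> = 0" and nexp_zero[simp]: "nexp 0 = 1"
  by (simp_all add: nexp_def)

lemma nexp_nonneg[simp]: "0 \<le> nexp x" and nexp_le_1[simp]: "nexp x \<le> 1"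
  by (simp_all add: nexp_def)

lemma nexp_mult_le[simp]: "nexp x * nexp y \<le> nexp x"
  by (simp add: mult_left_le)

lemma nexp_eq_ennreal: "x \<noteq> \<infinity> \<Longrightarrow> nexp x = exp (- enn2real x)"
  by (simp add: nexp_def)

lemma nexp_add: "nexp (x + y) = nexp x * nexp y"
  by (cases x; cases y) (auto simp: exp_add[symmetric] simp flip: ennreal_plus)

lemma nexp_sum: "nexp (sum f A) = (\<Prod>a\<in>A. nexp (f a))"
  by (induction A rule: infinite_finite_induct) (auto simp: nexp_add)

lemma nexp_antimono: "a \<le> b \<Longrightarrow> nexp b \<le> nexp a"
  by (auto simp: le_iff_add nexp_add)

lemma measurable_nexp[measurable]: "nexp \<in> borel_measurable borel"
  unfolding nexp_def by measurable

text \<open>Continuity includes the point infinity, so limits pass through exponentials of sums and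
  integrals not yet known to be finite.\<close>

lemma tendsto_nexp:
  assumes "(X \<longlongrightarrow> x) F"
  shows "((\<lambda>i. nexp (X i)) \<longlongrightarrow> nexp x) F"
proof (cases "x = \<infinity>")
  case False
  then have "eventually (\<lambda>i. X i < \<infinity>) F"
    using order_tendstoD(2)[OF assms, of \<infinity>] by (simp add: less_top)
  then have "eventually (\<lambda>i. exp (- enn2real (X i)) = nexp (X i)) F"
    by eventually_elim (auto simp: nexp_def)
  moreover have "((\<lambda>i. exp (- enn2real (X i))) \<longlongrightarrow> exp (- enn2real x)) F"
  proof -
    obtain r where r: "x = ennreal r" "0 \<le> r" using False by (cases x) auto
    show ?thesis using assms r by (intro tendsto_intros) (auto simp: tendsto_enn2real)
  qed
  ultimately show ?thesis using False by (simp add: nexp_def Lim_transform_eventually)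
next
  case True
  show ?thesis unfolding True
  proof (rule order_tendstoI)
    fix a assume "a < nexp \<infinity>"
    then show "eventually (\<lambda>i. a < nexp (X i)) F" by (auto intro!: always_eventually less_le_trans[OF _ nexp_nonneg])
  next
    fix a assume "nexp \<infinity> < a"
    then have a: "a > 0" by simp
    \<comment> \<open>A value r above 1 - ln a has exp(-r) < a; the maximum with 1 keeps the bound
      nonnegative, as the comparison in \<open>ennreal\<close> requires.\<close>
    define K where "K = max 1 (1 - ln a)"
    have "eventually (\<lambda>i. X i > ennreal K) F" by (rule order_tendstoD(1)[OF assms]) (simp add: True)
    then show "eventually (\<lambda>i. nexp (X i) < a) F"
    proof eventually_elim
      case (elim i)
      show ?case
      proof (cases "X i")
        case (real r)
        then have "r > K" using elim by (simp add: K_def ennreal_less_iff)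
        then have "- r < ln a" by (simp add: K_def)
        then have "exp (- r) < exp (ln a)" by (simp only: exp_less_mono)
        then show ?thesis using real a by simp
      qed (use a in simp)
    qed
  qed
qed

section \<open>Dyadic difference quotients of the exponential at 0\<close>

definition diff_quot :: "ennreal \<Rightarrow> nat \<Rightarrow> real" where
  "diff_quot x m = 2 ^ m * (1 - nexp (ennreal ((1/2) ^ m) * x))"

lemma diff_quot_nonneg[simp]: "0 \<le> diff_quot x m"
  by (simp add: diff_quot_def)

lemma measurable_diff_quot[measurable]: "(\<lambda>x. diff_quot x m) \<in> borel_measurable borel"
  unfolding diff_quot_def by measurable

text \<open>Halving the step is a squaring: with q the exponential at the smaller step, 1 - q^2 = (1
  - q)(1 + q) is at most 2 (1 - q). Dyadic steps are chosen for this.\<close>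

lemma diff_quot_mono: "diff_quot x m \<le> diff_quot x (Suc m)"
proof -
  let ?y = "ennreal ((1/2) ^ Suc m) * x"
  have "ennreal ((1/2) ^ m) * x = ennreal ((1/2) ^ Suc m + (1/2) ^ Suc m) * x" by simp
  also have "\<dots> = ?y + ?y" by (subst ennreal_plus) (auto simp: distrib_right)
  finally have e: "nexp (ennreal ((1/2) ^ m) * x) = nexp ?y * nexp ?y" by (simp only: nexp_add)
  have "(1 - nexp ?y) * (1 + nexp ?y) \<le> (1 - nexp ?y) * 2" by (intro mult_left_mono) auto
  then have "1 - nexp ?y * nexp ?y \<le> 2 * (1 - nexp ?y)" by (simp add: algebra_simps)
  then have "2 ^ m * (1 - nexp ?y * nexp ?y) \<le> 2 ^ m * (2 * (1 - nexp ?y))" by (rule mult_left_mono) simp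
  then show ?thesis unfolding diff_quot_def e by (simp only: power_Suc mult_ac)
qed

lemma filterlim_two_power: "filterlim (\<lambda>m. 2 ^ m :: real) at_top sequentially"
  by (rule filterlim_at_infinity_imp_filterlim_at_top[OF filterlim_realpow_sequentially_gt1]) auto

lemma one_minus_nexp_le: "ennreal (1 - nexp x) \<le> x"
proof (cases x)
  case (real r)
  then show ?thesis using exp_ge_add_one_self[of "- r"] by (auto intro: ennreal_leI)
qed simp

lemma diff_quot_tendsto: "(\<lambda>m. ennreal (diff_quot x m)) \<longlonglongrightarrow> x"
proof (cases x)
  case (real r)
  have "((\<lambda>h. exp (- r * h)) has_real_derivative - r) (at 0)"
    by (auto intro!: derivative_eq_intros)
  then have "((\<lambda>h. (exp (- r * h) - 1) / h) \<longlongrightarrow> - r) (at 0)"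
    by (simp add: DERIV_def)
  moreover have "filterlim (\<lambda>m. (1/2::real) ^ m) (at 0) sequentially"
    by (auto simp: filterlim_at intro!: LIMSEQ_realpow_zero)
  ultimately have "(\<lambda>m. (exp (- r * (1/2) ^ m) - 1) / (1/2) ^ m) \<longlonglongrightarrow> - r"
    by (rule filterlim_compose)
  then have "(\<lambda>m. - ((exp (- r * (1/2) ^ m) - 1) / (1/2) ^ m)) \<longlonglongrightarrow> - (- r)" by (rule tendsto_minus)
  also have "(\<lambda>m. - ((exp (- r * (1/2) ^ m) - 1) / (1/2) ^ m)) = diff_quot x"
    using real by (auto simp: fun_eq_iff diff_quot_def power_divide field_simps simp flip: ennreal_mult)
  finally show ?thesis using real by (simp add: tendsto_ennrealI)
next
  case top
  then show ?thesis using filterlim_two_power by (simp add: diff_quot_def ennreal_mult_top ennreal_tendsto_top_eq_at_top)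
qed

lemma nn_integral_diff_quot:
  assumes [measurable]: "f \<in> borel_measurable M" "w \<in> borel_measurable M"
  shows "(\<lambda>m. \<integral>\<^sup>+x. w x * ennreal (diff_quot (f x) m) \<partial>M) \<longlonglongrightarrow> (\<integral>\<^sup>+x. w x * f x \<partial>M)"
proof -
  let ?W = "density M w"
  have "(\<lambda>m. \<integral>\<^sup>+x. ennreal (diff_quot (f x) m) \<partial>?W) \<longlonglongrightarrow> (\<integral>\<^sup>+x. f x \<partial>?W)"
    by (rule nn_integral_LIMSEQ)
       (auto intro!: incseq_SucI le_funI ennreal_leI diff_quot_mono diff_quot_tendsto)
  then show ?thesis by (subst (asm) (1 2) nn_integral_density) auto
qed

lemma nn_integral_diff_quot_eq:
  assumes [measurable]: "f \<in> borel_measurable M" "w \<in> borel_measurable M"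
  shows "(\<integral>\<^sup>+x. w x * ennreal (diff_quot (f x) m) \<partial>M) =
    ennreal (2 ^ m) * (\<integral>\<^sup>+x. w x * ennreal (1 - nexp (ennreal ((1/2) ^ m) * f x)) \<partial>M)"
  unfolding diff_quot_def by (subst nn_integral_cmult[symmetric]) (auto simp: ennreal_mult' mult_ac)

text \<open>For a mass sequence p this is the conditional probability, given p, of one fixed
  partition with block sizes \<open>ns\<close>: the entries of \<open>xs\<close> are the distinct
  sampled indices of the successive blocks.\<close>

definition distinct_sum :: "(nat \<Rightarrow> ennreal) \<Rightarrow> nat list \<Rightarrow> ennreal" where
  "distinct_sum p ns =
     (\<integral>\<^sup>+xs. (\<Prod>j<length ns. p (xs ! j) ^ (ns ! j)) \<partial>count_space {xs. length xs = length ns \<and> distinct xs})"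

lemma distinct_sum_Nil[simp]: "distinct_sum p [] = 1"
proof -
  have "{xs::nat list. length xs = 0 \<and> distinct xs} = {[]}" by auto
  then show ?thesis by (simp add: distinct_sum_def nn_integral_count_space_finite)
qed

lemma borel_measurable_nn_integral_count_space:
  assumes "countable A" and "\<And>x. x \<in> A \<Longrightarrow> f x \<in> borel_measurable M"
  shows "(\<lambda>\<omega>. \<integral>\<^sup>+x. f x \<omega> \<partial>count_space A) \<in> borel_measurable M"
proof -
  interpret sigma_finite_measure "count_space A" by (rule sigma_finite_measure_count_space_countable[OF assms(1)])
  have "(\<lambda>(x, \<omega>). f x \<omega>) \<in> borel_measurable (count_space A \<Otimes>\<^sub>M M)"
    using assms by (intro measurable_pair_measure_countable1) auto
  then have "(\<lambda>(\<omega>, x). f x \<omega>) \<in> borel_measurable (M \<Otimes>\<^sub>M count_space A)"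
    by (subst measurable_pair_swap_iff) (simp add: case_prod_unfold)
  then show ?thesis by (rule borel_measurable_nn_integral)
qed

lemma measurable_distinct_sum[measurable]:
  assumes [measurable]: "\<And>i. (\<lambda>\<omega>. p \<omega> i) \<in> borel_measurable M"
  shows "(\<lambda>\<omega>. distinct_sum (p \<omega>) ns) \<in> borel_measurable M"
  unfolding distinct_sum_def by (rule borel_measurable_nn_integral_count_space) auto

lemma prod_power_sum_list: "(\<Prod>j<length ns. c ^ (ns ! j)) = (c :: 'a :: comm_monoid_mult) ^ sum_list ns"
  by (simp add: power_sum sum_list_sum_nth atLeast0LessThan)

lemma distinct_sum_cmult: "distinct_sum (\<lambda>i. c * p i) ns = c ^ sum_list ns * distinct_sum p ns"
  unfolding distinct_sum_def
  by (simp add: power_mult_distrib prod.distrib prod_power_sum_list nn_integral_cmult)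

text \<open>On the right a further index runs freely. Either it avoids the indices in use, which
  gives the longer list, or it equals the j-th of them, which raises that exponent by n. The
  additive form avoids a subtraction of possibly infinite terms.\<close>

lemma distinct_sum_Cons:
  "distinct_sum p (n # ns) + (\<Sum>j<length ns. distinct_sum p (ns[j := ns ! j + n])) =
   (\<Sum>i. p i ^ n) * distinct_sum p ns"
proof -
  define k where "k = length ns"
  define A where "A = {xs::nat list. length xs = k \<and> distinct xs}"
  define B where "B = {xs::nat list. length xs = Suc k \<and> distinct xs}"
  define P where "P xs = (\<Prod>j<k. p (xs ! j) ^ (ns ! j))" for xs
  have bij: "bij_betw (\<lambda>(xs, x). x # xs) (SIGMA xs:A. - set xs) B"
    unfolding bij_betw_def
  proof
    show "(\<lambda>(xs, x). x # xs) ` (SIGMA xs:A. - set xs) = B"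
      unfolding A_def B_def by (force simp: image_iff length_Suc_conv)
  qed (auto simp: inj_on_def)
  have upd: "p (xs ! j) ^ n * P xs = (\<Prod>i<k. p (xs ! i) ^ (ns[j := ns ! j + n] ! i))" if "j < k" for xs j
  proof -
    have "(\<Prod>i<k. p (xs ! i) ^ (ns[j := ns ! j + n] ! i)) =
        p (xs ! j) ^ (ns ! j + n) * (\<Prod>i\<in>{..<k}-{j}. p (xs ! i) ^ (ns[j := ns ! j + n] ! i))"
      using that by (subst prod.remove[of _ j]) (auto simp: k_def)
    also have "(\<Prod>i\<in>{..<k}-{j}. p (xs ! i) ^ (ns[j := ns ! j + n] ! i)) = (\<Prod>i\<in>{..<k}-{j}. p (xs ! i) ^ (ns ! i))"
      by (rule prod.cong) auto
    also have "p (xs ! j) ^ (ns ! j + n) * \<dots> = p (xs ! j) ^ n * P xs"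
      unfolding P_def using that by (subst (2) prod.remove[of _ j]) (auto simp: power_add mult_ac)
    finally show ?thesis by simp
  qed
  have D: "distinct_sum p (ns[j := ns ! j + n]) = (\<integral>\<^sup>+xs. p (xs ! j) ^ n * P xs \<partial>count_space A)" if "j < k" for j
    using that unfolding distinct_sum_def A_def
    by (auto simp: k_def[symmetric] upd intro!: nn_integral_cong)
  have split: "(\<Sum>x. p x ^ n) = (\<integral>\<^sup>+x. p x ^ n * indicator (- set xs) x \<partial>count_space UNIV) + (\<Sum>j<k. p (xs ! j) ^ n)"
    if "xs \<in> A" for xs
  proof -
    have "(\<Sum>x. p x ^ n) = (\<integral>\<^sup>+x. p x ^ n \<partial>count_space UNIV)" by (simp add: nn_integral_count_space_nat)
    also have "\<dots> = (\<integral>\<^sup>+x. p x ^ n * indicator (- set xs) x + p x ^ n * indicator (set xs) x \<partial>count_space UNIV)"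
      by (rule nn_integral_cong) (auto simp: indicator_def)
    also have "\<dots> = (\<integral>\<^sup>+x. p x ^ n * indicator (- set xs) x \<partial>count_space UNIV) +
        (\<integral>\<^sup>+x. p x ^ n \<partial>count_space (set xs))"
      by (subst nn_integral_add) (auto simp: nn_integral_count_space_indicator)
    also have "(\<integral>\<^sup>+x. p x ^ n \<partial>count_space (set xs)) = (\<Sum>x\<in>set xs. p x ^ n)"
      by (rule nn_integral_count_space_finite) simp
    also have "\<dots> = (\<Sum>j<k. p (xs ! j) ^ n)"
      using that bij_betw_nth[of xs "{..<k}" "set xs"]
      by (intro sum.reindex_bij_betw[symmetric]) (auto simp: A_def)
    finally show ?thesis .
  qed
  have "distinct_sum p (n # ns) = (\<integral>\<^sup>+ys. p (ys ! 0) ^ n * P (tl ys) \<partial>count_space B)"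
    unfolding distinct_sum_def B_def P_def
    by (auto simp: k_def prod.lessThan_Suc_shift nth_tl simp del: prod.lessThan_Suc
        intro!: nn_integral_cong prod.cong)
  also have "\<dots> = (\<integral>\<^sup>+z. (case z of (xs, x) \<Rightarrow> p x ^ n * P xs) \<partial>count_space (SIGMA xs:A. - set xs))"
    by (subst nn_integral_bij_count_space[OF bij, symmetric]) (auto intro!: nn_integral_cong)
  also have "\<dots> = (\<integral>\<^sup>+z. (case z of (xs, x) \<Rightarrow> indicator A xs * (p x ^ n * indicator (- set xs) x * P xs)) \<partial>count_space UNIV)"
    by (subst nn_integral_count_space_indicator) (auto intro!: nn_integral_cong simp: indicator_def)
  also have "\<dots> = (\<integral>\<^sup>+xs. \<integral>\<^sup>+x. indicator A xs * (p x ^ n * indicator (- set xs) x * P xs) \<partial>count_space UNIV \<partial>count_space UNIV)"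
    by (subst nn_integral_fst_count_space[symmetric]) simp
  also have "\<dots> = (\<integral>\<^sup>+xs. (\<integral>\<^sup>+x. p x ^ n * indicator (- set xs) x \<partial>count_space UNIV) * P xs \<partial>count_space A)"
    by (subst (2) nn_integral_count_space_indicator)
       (auto intro!: nn_integral_cong simp: nn_integral_cmult nn_integral_multc mult_ac)
  finally have D0: "distinct_sum p (n # ns) = \<dots>" .
  have "(\<Sum>i. p i ^ n) * distinct_sum p ns = (\<integral>\<^sup>+xs. (\<Sum>x. p x ^ n) * P xs \<partial>count_space A)"
    unfolding distinct_sum_def A_def P_def k_def by (subst nn_integral_cmult) auto
  also have "\<dots> = (\<integral>\<^sup>+xs. (\<integral>\<^sup>+x. p x ^ n * indicator (- set xs) x \<partial>count_space UNIV) * P xs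
      + (\<Sum>j<k. p (xs ! j) ^ n * P xs) \<partial>count_space A)"
    by (intro nn_integral_cong) (auto simp: split sum_distrib_right distrib_right)
  also have "\<dots> = distinct_sum p (n # ns) + (\<Sum>j<k. distinct_sum p (ns[j := ns ! j + n]))"
    by (subst nn_integral_add) (auto simp: nn_integral_sum D0 D)
  finally show ?thesis by (simp add: k_def)
qed

section \<open>Product and chain rules for difference quotients along a sequence\<close>

lemma tendsto_quot_mult:
  fixes u v :: real
  assumes c: "filterlim c at_top sequentially"
    and u: "(\<lambda>m. c m * (u - U m)) \<longlonglongrightarrow> u'" and v: "(\<lambda>m. c m * (v - V m)) \<longlonglongrightarrow> v'"
  shows "(\<lambda>m. c m * (u * v - U m * V m)) \<longlonglongrightarrow> u' * v + u * v'"
proof -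
  \<comment> \<open>As c m tends to infinity, convergence of the quotient already forces U m to tend
    to u.\<close>
  have "(\<lambda>m. (c m * (u - U m)) / c m) \<longlonglongrightarrow> 0"
    by (rule tendsto_divide_0[OF u filterlim_at_top_imp_at_infinity[OF c]])
  moreover have "eventually (\<lambda>m. (c m * (u - U m)) / c m = u - U m) sequentially"
    using filterlim_at_top_dense[THEN iffD1, OF c, rule_format, of 0] by eventually_elim auto
  ultimately have "(\<lambda>m. u - U m) \<longlonglongrightarrow> 0" by (rule Lim_transform_eventually)
  then have "(\<lambda>m. u - (u - U m)) \<longlonglongrightarrow> u - 0" by (intro tendsto_intros)
  then have U: "U \<longlonglongrightarrow> u" by simp
  have "(\<lambda>m. (c m * (u - U m)) * v + U m * (c m * (v - V m))) \<longlonglongrightarrow> u' * v + u * v'"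
    by (intro tendsto_intros u v U)
  then show ?thesis by (simp add: algebra_simps)
qed

text \<open>The Leibniz rule for functions whose derivative raises the index by n. The updated lists
  in the limit are the ones that occur in \<open>distinct_sum_Cons\<close>, which lets them cancel
  later.\<close>

lemma tendsto_quot_prod:
  fixes a :: "nat \<Rightarrow> real" and A :: "nat \<Rightarrow> nat \<Rightarrow> real"
  assumes c: "filterlim c at_top sequentially"
    and a: "\<And>i. i \<in> set ns \<Longrightarrow> (\<lambda>m. c m * (a i - A m i)) \<longlonglongrightarrow> a (i + n)"
  shows "(\<lambda>m. c m * ((\<Prod>j<length ns. a (ns ! j)) - (\<Prod>j<length ns. A m (ns ! j)))) \<longlonglongrightarrow>
    (\<Sum>j<length ns. \<Prod>i<length ns. a (ns[j := ns ! j + n] ! i))"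
  using a
proof (induction ns)
  case (Cons x ns)
  have "(\<lambda>m. c m * (a x * (\<Prod>j<length ns. a (ns ! j)) - A m x * (\<Prod>j<length ns. A m (ns ! j)))) \<longlonglongrightarrow>
    a (x + n) * (\<Prod>j<length ns. a (ns ! j)) + a x * (\<Sum>j<length ns. \<Prod>i<length ns. a (ns[j := ns ! j + n] ! i))"
    using Cons by (intro tendsto_quot_mult c) auto
  then show ?case
    by (simp add: prod.lessThan_Suc_shift sum.lessThan_Suc_shift sum_distrib_left del: prod.lessThan_Suc sum.lessThan_Suc)
qed simp

lemma tendsto_quot_exp:
  fixes b :: real
  assumes c: "filterlim c at_top sequentially"
    and b: "(\<lambda>m. c m * (B m - b)) \<longlonglongrightarrow> b'"
  shows "(\<lambda>m. c m * (exp (- b) - exp (- B m))) \<longlonglongrightarrow> exp (- b) * b'"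
proof -
  have "(\<lambda>m. (c m * (B m - b)) / c m) \<longlonglongrightarrow> 0"
    by (rule tendsto_divide_0[OF b filterlim_at_top_imp_at_infinity[OF c]])
  moreover have "eventually (\<lambda>m. (c m * (B m - b)) / c m = B m - b) sequentially"
    using filterlim_at_top_dense[THEN iffD1, OF c, rule_format, of 0] by eventually_elim auto
  ultimately have d: "(\<lambda>m. B m - b) \<longlonglongrightarrow> 0" by (rule Lim_transform_eventually)
  \<comment> \<open>The difference B m - b may vanish for some m, so the quotient is extended
    continuously by its limit 1 at 0.\<close>
  define q where "q h = (if h = 0 then 1 else (1 - exp (- h)) / h)" for h :: real
  have "((\<lambda>h. - exp (- h)) has_real_derivative 1) (at 0)"
    by (auto intro!: derivative_eq_intros)
  then have "(\<lambda>h. (1 - exp (- h)) / h) \<midarrow>0\<rightarrow> (1::real)" by (simp add: DERIV_def)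
  then have "q \<midarrow>0\<rightarrow> q 0"
    by (subst LIM_equal[where g="\<lambda>h. (1 - exp (- h)) / h"]) (auto simp: q_def)
  then have "isCont q 0" by (simp add: isCont_def)
  then have "(\<lambda>m. q (B m - b)) \<longlonglongrightarrow> q 0" by (rule isCont_tendsto_compose[OF _ d])
  then have "(\<lambda>m. exp (- b) * ((c m * (B m - b)) * q (B m - b))) \<longlonglongrightarrow> exp (- b) * (b' * q 0)"
    by (intro tendsto_intros b)
  moreover have "exp (- b) * ((c m * (B m - b)) * q (B m - b)) = c m * (exp (- b) - exp (- B m))" for m
  proof -
    have "(B m - b) * q (B m - b) = 1 - exp (b - B m)" by (auto simp: q_def)
    then have "exp (- b) * ((c m * (B m - b)) * q (B m - b)) = c m * (exp (- b) * (1 - exp (b - B m)))"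
      by (simp only: mult_ac)
    also have "exp (- b) * (1 - exp (b - B m)) = exp (- b) - exp (- B m)"
      by (simp add: right_diff_distrib flip: exp_add)
    finally show ?thesis .
  qed
  moreover have "q 0 = 1" by (simp add: q_def)
  ultimately show ?thesis by (simp only: mult_1_right)
qed

section \<open>Moment formulas for the stable Poisson process\<close>

locale stable_ppp =
  fixes \<gamma> :: real and M :: "'w measure" and J :: "nat \<Rightarrow> 'w \<Rightarrow> real"
  assumes \<gamma>: "0 < \<gamma>" "\<gamma> < 1" and ppp: "ranked_stable_ppp \<gamma> M J"
begin

abbreviation \<nu> :: "real measure" where "\<nu> \<equiv> stable_intensity \<gamma>"

sublocale prob_space M
  using ppp unfolding ranked_stable_ppp_def by auto

lemma measurable_J[measurable]: "J i \<in> borel_measurable M"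
  using ppp unfolding ranked_stable_ppp_def by auto

lemma AE_J_pos: "AE \<omega> in M. \<forall>i. 0 < J i \<omega>"
proof -
  have "AE \<omega> in M. \<forall>i. 0 < J (Suc i) \<omega> \<and> J (Suc i) \<omega> < J i \<omega>"
    using ppp unfolding ranked_stable_ppp_def by auto
  then show ?thesis by eventually_elim (metis less_trans)
qed

section \<open>The Laplace functional of the point process\<close>

lemma num_points_eq: "num_points J B \<omega> = (\<Sum>i. indicator B (J i \<omega>))"
proof -
  have "num_points J B \<omega> = (\<integral>\<^sup>+i. indicator {i. J i \<omega> \<in> B} i \<partial>count_space UNIV)"
    by (simp add: num_points_def)
  also have "\<dots> = (\<Sum>i. indicator {i. J i \<omega> \<in> B} i)" by (rule nn_integral_count_space_nat)
  finally show ?thesis by (simp add: indicator_def)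
qed

lemma measurable_num_points[measurable]:
  assumes [measurable]: "B \<in> sets borel" shows "num_points J B \<in> borel_measurable M"
  unfolding num_points_eq[abs_def] by measurable

text \<open>Markov's inequality for 1 - exp(-x), which is integrable for the intensity and at least
  1 - exp(-e) on the tail.\<close>

lemma emeasure_intensity_tail: "0 < e \<Longrightarrow> emeasure \<nu> {e<..} < \<infinity>"
proof -
  assume e: "0 < e"
  define d where "d = 1 - exp (- e)"
  have d: "d > 0" using e by (simp add: d_def)
  have "ennreal d * emeasure \<nu> {e<..} = (\<integral>\<^sup>+x. ennreal d * indicator {e<..} x \<partial>\<nu>)"
    by (simp add: nn_integral_cmult)
  also have "\<dots> \<le> (\<integral>\<^sup>+x. ennreal (1 - exp (- (1 * x))) \<partial>\<nu>)"
    by (intro nn_integral_mono) (auto simp: indicator_def d_def intro!: ennreal_leI)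
  also have "\<dots> < \<infinity>" using stable_intensity_one_minus_exp[OF \<gamma>, of 1] by simp
  finally show ?thesis using d by (auto simp: ennreal_mult_less_top)
qed

lemma nn_integral_nexp_num_points:
  assumes B: "B \<in> sets borel" "B \<subseteq> {0<..}" "emeasure \<nu> B < \<infinity>" and a: "0 \<le> a"
  shows "(\<integral>\<^sup>+\<omega>. ennreal (nexp (ennreal a * num_points J B \<omega>)) \<partial>M) =
    ennreal (nexp (ennreal (1 - exp (- a)) * emeasure \<nu> B))"
proof -
  note [measurable] = B(1)
  define l where "l = measure \<nu> B"
  have l: "l \<ge> 0" "emeasure \<nu> B = ennreal l"
    using B(3) by (auto simp: l_def emeasure_eq_ennreal_measure less_top)
  let ?E = "\<lambda>c::nat. {\<omega> \<in> space M. num_points J B \<omega> = of_nat c}"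
  have E[measurable]: "?E c \<in> sets M" for c by measurable
  have pE: "emeasure M (?E c) = ennreal (exp (- l) * l ^ c / fact c)" for c
    using ppp B unfolding ranked_stable_ppp_def l_def by blast
  have expsum: "(\<Sum>c. ennreal (exp (- l) * (u * l) ^ c / fact c)) = ennreal (exp (- l) * exp (u * l))" if "u \<ge> 0" for u
  proof (rule suminf_ennreal_eq)
    show "0 \<le> exp (- l) * (u * l) ^ c / fact c" for c using l that by simp
    show "(\<lambda>c. exp (- l) * (u * l) ^ c / fact c) sums (exp (- l) * exp (u * l))"
      using sums_mult[OF exp_converges[of "u * l"], of "exp (- l)"] by (simp add: scaleR_conv_of_real field_simps)
  qed
  have disj: "disjoint_family ?E"
    by (auto simp: disjoint_family_on_def)
  \<comment> \<open>The Poisson masses add up to 1, so almost surely the count is a natural number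
    and infinity adds nothing to the expansion over c.\<close>
  have "emeasure M (\<Union>c. ?E c) = (\<Sum>c. emeasure M (?E c))"
    using disj by (intro suminf_emeasure[symmetric]) auto
  also have "\<dots> = 1" using expsum[of 1] by (simp add: pE exp_minus field_simps)
  finally have "AE \<omega> in M. \<omega> \<in> (\<Union>c. ?E c)"
    by (intro AE_prob_1) (auto simp: measure_def)
  then have "AE \<omega> in M. ennreal (nexp (ennreal a * num_points J B \<omega>)) =
      (\<Sum>c. ennreal (exp (- a * real c)) * indicator (?E c) \<omega>)"
  proof eventually_elim
    case (elim \<omega>)
    then obtain c where c: "\<omega> \<in> ?E c" by auto
    have "(\<Sum>c. ennreal (exp (- a * real c)) * indicator (?E c) \<omega>) =
       (\<Sum>c'\<in>{c}. ennreal (exp (- a * real c')) * indicator (?E c') \<omega>)"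
      using c by (intro suminf_finite) auto
    also have "\<dots> = ennreal (nexp (ennreal a * num_points J B \<omega>))"
      using c a by (simp add: ennreal_of_nat_eq_real_of_nat flip: ennreal_mult)
    finally show ?case by simp
  qed
  then have "(\<integral>\<^sup>+\<omega>. ennreal (nexp (ennreal a * num_points J B \<omega>)) \<partial>M) =
      (\<integral>\<^sup>+\<omega>. (\<Sum>c. ennreal (exp (- a * real c)) * indicator (?E c) \<omega>) \<partial>M)"
    by (rule nn_integral_cong_AE)
  also have "\<dots> = (\<Sum>c. ennreal (exp (- a * real c)) * emeasure M (?E c))"
    by (subst nn_integral_suminf) (auto simp: nn_integral_cmult)
  also have "\<dots> = (\<Sum>c. ennreal (exp (- l) * (exp (- a) * l) ^ c / fact c))"
  proof (intro suminf_cong)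
    fix c
    have "exp (- a * real c) * (exp (- l) * l ^ c / fact c) = exp (- l) * (exp (- a) * l) ^ c / fact c"
      by (simp add: power_mult_distrib exp_of_nat_mult[symmetric] mult_ac)
    then show "ennreal (exp (- a * real c)) * emeasure M (?E c) = ennreal (exp (- l) * (exp (- a) * l) ^ c / fact c)"
      using l by (simp only: pE) (simp add: ennreal_mult'[symmetric])
  qed
  also have "\<dots> = ennreal (exp (- l) * exp (exp (- a) * l))" by (rule expsum) simp
  also have "exp (- l) * exp (exp (- a) * l) = nexp (ennreal (1 - exp (- a)) * emeasure \<nu> B)"
  proof -
    have "0 \<le> (1 - exp (- a)) * l" using a l by simp
    then have "nexp (ennreal (1 - exp (- a)) * emeasure \<nu> B) = exp (- ((1 - exp (- a)) * l))"
      using a l by (simp add: ennreal_mult'[symmetric])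
    then show ?thesis by (simp add: algebra_simps flip: exp_add)
  qed
  finally show ?thesis .
qed

text \<open>The sum over the points is a combination of their counts in the level sets. These are
  disjoint and of finite intensity, so the counts are independent Poisson variables and the
  expectation factorizes.\<close>

lemma Laplace_functional_simple:
  fixes \<phi> :: "real \<Rightarrow> ennreal"
  assumes \<phi>[measurable]: "\<phi> \<in> borel_measurable borel" and fin: "finite (range \<phi>)" "\<infinity> \<notin> range \<phi>"
    and e: "0 < e" "\<And>x. x \<le> e \<Longrightarrow> \<phi> x = 0"
  shows "(\<integral>\<^sup>+\<omega>. ennreal (nexp (\<Sum>i. \<phi> (J i \<omega>))) \<partial>M) =
    ennreal (nexp (\<integral>\<^sup>+x. ennreal (1 - nexp (\<phi> x)) \<partial>\<nu>))"
proof -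
  \<comment> \<open>The value 0 is left out: its level set contains a neighbourhood of 0, where the
    intensity is infinite, and adds nothing to the sum. All other levels lie beyond
    \<open>e\<close>.\<close>
  define L where "L = range \<phi> - {0}"
  define B where "B a = {x. \<phi> x = a}" for a
  have finL: "finite L" using fin by (simp add: L_def)
  have B[measurable]: "B a \<in> sets borel" for a unfolding B_def by measurable
  have Bsub: "B a \<subseteq> {e<..}" if "a \<in> L" for a
    using that e(2) by (force simp: B_def L_def not_less[symmetric])
  have Bpos: "B a \<subseteq> {0<..}" if "a \<in> L" for a
    using Bsub[OF that] e(1) by auto
  have Bfin: "emeasure \<nu> (B a) < \<infinity>" if "a \<in> L" for a
    using emeasure_mono[OF Bsub[OF that], of \<nu>] emeasure_intensity_tail[OF e(1)] by simp
  \<comment> \<open>Independence in \<open>ranked_stable_ppp\<close> is stated for families indexed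
    by natural numbers, so the levels are enumerated.\<close>
  obtain as where as: "set as = L" "distinct as" using finite_distinct_list[OF finL] by blast
  have reidx: "(\<Sum>a\<in>L. g a) = (\<Sum>i<length as. g (as ! i))" for g :: "ennreal \<Rightarrow> ennreal"
    using as by (intro sum.reindex_bij_betw[symmetric] bij_betw_nth) auto
  have asL: "as ! i \<in> L" if "i < length as" for i using as that by auto
  have dec: "g (\<phi> x) = (\<Sum>i<length as. g (as ! i) * indicator (B (as ! i)) x)"
    if "g 0 = 0" for g :: "ennreal \<Rightarrow> ennreal" and x
  proof (cases "\<phi> x = 0")
    case True
    then show ?thesis using that asL by (auto simp: B_def L_def indicator_def intro!: sum.neutral[symmetric])
  next
    case False
    have "(\<Sum>a\<in>L. g a * indicator (B a) x) = (\<Sum>a\<in>{\<phi> x}. g a * indicator (B a) x)"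
      using False finL by (intro sum.mono_neutral_right) (auto simp: L_def B_def indicator_def)
    then show ?thesis by (simp add: B_def reidx[symmetric, of "\<lambda>a. g a * indicator (B a) x", unfolded B_def])
  qed
  have X: "(\<Sum>i. \<phi> (J i \<omega>)) = (\<Sum>l<length as. as ! l * num_points J (B (as ! l)) \<omega>)" for \<omega>
  proof -
    have "(\<Sum>i. \<phi> (J i \<omega>)) = (\<Sum>i. \<Sum>l<length as. as ! l * indicator (B (as ! l)) (J i \<omega>))"
      using dec[of "\<lambda>a. a"] by (intro suminf_cong) blast
    also have "\<dots> = (\<Sum>l<length as. \<Sum>i. as ! l * indicator (B (as ! l)) (J i \<omega>))"
      by (rule suminf_sum) simp
    finally show ?thesis unfolding num_points_eq ennreal_suminf_cmult .
  qed
  have "disjoint_family_on (\<lambda>l. B (as ! l)) {..<length as}"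
    using as(2) by (auto simp: disjoint_family_on_def B_def nth_eq_iff_index_eq)
  then have "indep_vars (\<lambda>_. borel) (\<lambda>l. num_points J (B (as ! l))) {..<length as}"
    using ppp asL Bpos unfolding ranked_stable_ppp_def by auto
  then have ind: "indep_vars (\<lambda>_. borel) (\<lambda>l \<omega>. ennreal (nexp (as ! l * num_points J (B (as ! l)) \<omega>))) {..<length as}"
    by (rule indep_vars_compose2) measurable
  have E1: "(\<integral>\<^sup>+\<omega>. ennreal (nexp (as ! l * num_points J (B (as ! l)) \<omega>)) \<partial>M) =
      ennreal (nexp (ennreal (1 - nexp (as ! l)) * emeasure \<nu> (B (as ! l))))" if "l < length as" for l
  proof -
    have "as ! l \<noteq> \<infinity>" using asL[OF that] fin(2) by (auto simp: L_def)
    then obtain r where r: "as ! l = ennreal r" "r \<ge> 0" by (cases "as ! l") auto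
    show ?thesis
      using nn_integral_nexp_num_points[OF B Bpos Bfin, OF asL asL r(2), OF that that] r by simp
  qed
  have "(\<integral>\<^sup>+\<omega>. ennreal (nexp (\<Sum>i. \<phi> (J i \<omega>))) \<partial>M) =
      (\<integral>\<^sup>+\<omega>. (\<Prod>l<length as. ennreal (nexp (as ! l * num_points J (B (as ! l)) \<omega>))) \<partial>M)"
    unfolding X nexp_sum by (simp add: prod_ennreal)
  also have "\<dots> = (\<Prod>l<length as. \<integral>\<^sup>+\<omega>. ennreal (nexp (as ! l * num_points J (B (as ! l)) \<omega>)) \<partial>M)"
    by (rule indep_vars_nn_integral[OF _ ind]) auto
  also have "\<dots> = (\<Prod>l<length as. ennreal (nexp (ennreal (1 - nexp (as ! l)) * emeasure \<nu> (B (as ! l)))))"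
    by (rule prod.cong) (auto simp: E1)
  also have "\<dots> = ennreal (nexp (\<Sum>l<length as. ennreal (1 - nexp (as ! l)) * emeasure \<nu> (B (as ! l))))"
    unfolding nexp_sum by (simp add: prod_ennreal)
  also have "(\<Sum>l<length as. ennreal (1 - nexp (as ! l)) * emeasure \<nu> (B (as ! l))) =
      (\<integral>\<^sup>+x. ennreal (1 - nexp (\<phi> x)) \<partial>\<nu>)"
  proof -
    have "(\<integral>\<^sup>+x. ennreal (1 - nexp (\<phi> x)) \<partial>\<nu>) =
        (\<integral>\<^sup>+x. (\<Sum>l<length as. ennreal (1 - nexp (as ! l)) * indicator (B (as ! l)) x) \<partial>\<nu>)"
      using dec[of "\<lambda>a. ennreal (1 - nexp a)"] by (intro nn_integral_cong) auto
    also have "\<dots> = (\<Sum>l<length as. \<integral>\<^sup>+x. ennreal (1 - nexp (as ! l)) * indicator (B (as ! l)) x \<partial>\<nu>)"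
      by (rule nn_integral_sum) measurable
    finally show ?thesis by (simp add: nn_integral_cmult)
  qed
  finally show ?thesis .
qed

lemma AE_cong_J_pos:
  assumes "\<And>x. 0 < x \<Longrightarrow> \<phi> x = \<psi> x"
  shows "AE \<omega> in M. (\<Sum>i. \<phi> (J i \<omega>)) = (\<Sum>i. \<psi> (J i \<omega>) :: ennreal)"
  using AE_J_pos by eventually_elim (simp add: assms)

theorem Laplace_functional:
  fixes \<phi> :: "real \<Rightarrow> ennreal"
  assumes \<phi>[measurable]: "\<phi> \<in> borel_measurable borel"
  shows "(\<integral>\<^sup>+\<omega>. ennreal (nexp (\<Sum>i. \<phi> (J i \<omega>))) \<partial>M) =
    ennreal (nexp (\<integral>\<^sup>+x. ennreal (1 - nexp (\<phi> x)) \<partial>\<nu>))"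
proof -
  obtain f where f: "\<And>m. simple_function borel (f m)" "incseq f" "\<And>m x. f m x < \<top>"
      "\<And>x. (SUP m. f m x) = \<phi> x"
    using borel_measurable_implies_simple_function_sequence'[OF \<phi>] by blast
  have [measurable]: "f m \<in> borel_measurable borel" for m by (rule borel_measurable_simple_function[OF f(1)])
  \<comment> \<open>The cut-off at 1/(m+1) keeps every level set of finite intensity. As m grows,
    the expectations converge by domination (\<open>nexp\<close> is at most 1) and the exponents
    monotonically.\<close>
  define g where "g m x = f m x * indicator {1 / real (Suc m) <..} x" for m x
  define \<psi> where "\<psi> x = \<phi> x * indicator {0<..} x" for x
  have [measurable]: "g m \<in> borel_measurable borel" for m unfolding g_def by measurable
  have [measurable]: "\<psi> \<in> borel_measurable borel" unfolding \<psi>_def by measurable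
  have finr: "finite (range (g m))" for m
  proof -
    have "range (g m) \<subseteq> (\<lambda>(a, b). a * b) ` (range (f m) \<times> {0, 1})"
      by (force simp: g_def indicator_def)
    moreover have "finite (range (f m))" using f(1)[of m] by (auto dest: simple_functionD(1))
    ultimately show ?thesis by (meson finite.intros finite_SigmaI finite_imageI finite_subset)
  qed
  have simple: "(\<integral>\<^sup>+\<omega>. ennreal (nexp (\<Sum>i. g m (J i \<omega>))) \<partial>M) =
      ennreal (nexp (\<integral>\<^sup>+x. ennreal (1 - nexp (g m x)) \<partial>\<nu>))" for m
  proof (rule Laplace_functional_simple)
    have "g m x < \<top>" for x using f(3)[of m x] by (simp add: g_def indicator_def)
    then show "\<infinity> \<notin> range (g m)" by (metis infinity_ennreal_def less_irrefl rangeE)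
    show "0 < 1 / real (Suc m)" by simp
    show "finite (range (g m))" by (rule finr)
  qed (auto simp: g_def)
  have inc: "incseq g"
  proof (rule incseq_SucI, rule le_funI)
    fix m x
    have "1 / real (Suc (Suc m)) \<le> 1 / real (Suc m)" by (simp add: field_simps)
    then show "g m x \<le> g (Suc m) x"
      using incseq_SucD[OF f(2), of m] by (auto simp: g_def indicator_def le_fun_def)
  qed
  have lim: "(\<lambda>m. g m x) \<longlonglongrightarrow> \<psi> x" for x
  proof (cases "x > 0")
    case True
    have "(\<lambda>m. f m x) \<longlonglongrightarrow> \<phi> x"
      unfolding f(4)[symmetric] using f(2) by (intro LIMSEQ_SUP) (auto simp: incseq_def le_fun_def)
    moreover have "eventually (\<lambda>m. f m x = g m x) sequentially"
    proof -
      have "(\<lambda>m. 1 / real (Suc m)) \<longlonglongrightarrow> 0" using LIMSEQ_inverse_real_of_nat by (simp add: inverse_eq_divide)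
      from order_tendstoD(2)[OF this True] show ?thesis by eventually_elim (auto simp: g_def)
    qed
    ultimately show ?thesis using True by (auto simp: \<psi>_def intro: Lim_transform_eventually)
  next
    case False
    have "g m x = 0" for m
    proof -
      have "0 < 1 / real (Suc m)" by simp
      then have "\<not> 1 / real (Suc m) < x" using False by linarith
      then show ?thesis by (simp add: g_def indicator_def del: of_nat_Suc)
    qed
    then show ?thesis using False by (simp add: \<psi>_def)
  qed
  have limX: "(\<lambda>m. \<Sum>i. g m (J i \<omega>)) \<longlonglongrightarrow> (\<Sum>i. \<psi> (J i \<omega>))" for \<omega>
    unfolding nn_integral_count_space_nat[symmetric] using inc lim
    by (intro nn_integral_LIMSEQ) (auto simp: incseq_def le_fun_def)
  have L: "(\<lambda>m. \<integral>\<^sup>+\<omega>. ennreal (nexp (\<Sum>i. g m (J i \<omega>))) \<partial>M) \<longlonglongrightarrow>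
      (\<integral>\<^sup>+\<omega>. ennreal (nexp (\<Sum>i. \<psi> (J i \<omega>))) \<partial>M)"
    by (rule nn_integral_dominated_convergence[where w="\<lambda>_. 1"])
       (auto intro!: tendsto_ennrealI tendsto_nexp limX simp: emeasure_space_1 ennreal_le_1)
  have "(\<lambda>m. \<integral>\<^sup>+x. ennreal (1 - nexp (g m x)) \<partial>\<nu>) \<longlonglongrightarrow> (\<integral>\<^sup>+x. ennreal (1 - nexp (\<psi> x)) \<partial>\<nu>)"
    using inc by (intro nn_integral_LIMSEQ)
      (auto intro!: tendsto_ennrealI tendsto_diff tendsto_nexp lim ennreal_leI nexp_antimono
        simp: incseq_def le_fun_def)
  then have "(\<lambda>m. ennreal (nexp (\<integral>\<^sup>+x. ennreal (1 - nexp (g m x)) \<partial>\<nu>))) \<longlonglongrightarrow>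
      ennreal (nexp (\<integral>\<^sup>+x. ennreal (1 - nexp (\<psi> x)) \<partial>\<nu>))"
    by (intro tendsto_ennrealI tendsto_nexp)
  with L have "(\<integral>\<^sup>+\<omega>. ennreal (nexp (\<Sum>i. \<psi> (J i \<omega>))) \<partial>M) =
      ennreal (nexp (\<integral>\<^sup>+x. ennreal (1 - nexp (\<psi> x)) \<partial>\<nu>))"
    unfolding simple by (rule LIMSEQ_unique)
  also have "(\<integral>\<^sup>+\<omega>. ennreal (nexp (\<Sum>i. \<psi> (J i \<omega>))) \<partial>M) = (\<integral>\<^sup>+\<omega>. ennreal (nexp (\<Sum>i. \<phi> (J i \<omega>))) \<partial>M)"
    using AE_cong_J_pos[of \<psi> \<phi>] by (intro nn_integral_cong_AE) (auto simp: \<psi>_def elim!: eventually_mono)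
  also have "(\<integral>\<^sup>+x. ennreal (1 - nexp (\<psi> x)) \<partial>\<nu>) = (\<integral>\<^sup>+x. ennreal (1 - nexp (\<phi> x)) \<partial>\<nu>)"
    using AE_stable_intensity_pos[of \<gamma>]
    by (intro nn_integral_cong_AE) (auto simp: \<psi>_def elim!: eventually_mono)
  finally show ?thesis .
qed

section \<open>Moments of the points under an exponential tilt\<close>

definition admissible :: "(real \<Rightarrow> ennreal) \<Rightarrow> bool" where
  "admissible \<phi> \<longleftrightarrow> \<phi> \<in> borel_measurable borel \<and> (\<exists>y>0. \<forall>x>0. ennreal (y * x) \<le> \<phi> x) \<and>
     (\<integral>\<^sup>+x. ennreal (1 - nexp (\<phi> x)) \<partial>\<nu>) < \<infinity>"

definition tilted_moment :: "(real \<Rightarrow> ennreal) \<Rightarrow> nat \<Rightarrow> ennreal" where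
  "tilted_moment \<phi> n = (\<integral>\<^sup>+x. ennreal x ^ n * ennreal (nexp (\<phi> x)) \<partial>\<nu>)"

definition Laplace_exponent :: "(real \<Rightarrow> ennreal) \<Rightarrow> ennreal" where
  "Laplace_exponent \<phi> = (\<integral>\<^sup>+x. ennreal (1 - nexp (\<phi> x)) \<partial>\<nu>)"

text \<open>The linear lower bound in \<open>admissible\<close> gives a comparison with
  \<open>stable_intensity_power_exp\<close>; a power of order at least 1 makes up for the infinite
  intensity near 0.\<close>

lemma tilted_moment_finite:
  assumes "admissible \<phi>" "1 \<le> n" shows "tilted_moment \<phi> n < \<infinity>"
proof -
  obtain y where y: "y > 0" "\<And>x. x > 0 \<Longrightarrow> ennreal (y * x) \<le> \<phi> x" using assms(1) unfolding admissible_def by blast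
  have "tilted_moment \<phi> n \<le> (\<integral>\<^sup>+x. ennreal (x ^ n * exp (- (y * x))) \<partial>\<nu>)"
    unfolding tilted_moment_def
  proof (rule nn_integral_mono_AE)
    show "AE x in \<nu>. ennreal x ^ n * ennreal (nexp (\<phi> x)) \<le> ennreal (x ^ n * exp (- (y * x)))"
      using AE_stable_intensity_pos
    proof eventually_elim
      case (elim x)
      have "nexp (\<phi> x) \<le> exp (- (y * x))" using nexp_antimono[OF y(2)[OF elim]] y(1) elim by simp
      then have "x ^ n * nexp (\<phi> x) \<le> x ^ n * exp (- (y * x))" using elim by (intro mult_left_mono) auto
      then show ?case using elim by (auto simp: ennreal_power ennreal_mult'[symmetric] intro: ennreal_leI)
    qed
  qed
  also have "\<dots> < \<infinity>" using stable_intensity_power_exp[OF \<gamma> y(1) assms(2)] by simp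
  finally show ?thesis .
qed

text \<open>The class is shaped to be stable under this perturbation: the linear lower bound
  survives, and the increase of the exponent is at most z times a tilted moment, since 1 - exp(-q)
  is at most q.\<close>

lemma admissible_add_power:
  assumes "admissible \<phi>" "1 \<le> n" "0 \<le> z"
  shows "admissible (\<lambda>x. \<phi> x + ennreal z * ennreal x ^ n)"
    and "Laplace_exponent (\<lambda>x. \<phi> x + ennreal z * ennreal x ^ n) =
      Laplace_exponent \<phi> + (\<integral>\<^sup>+x. ennreal (nexp (\<phi> x)) * ennreal (1 - nexp (ennreal z * ennreal x ^ n)) \<partial>\<nu>)"
proof -
  have [measurable]: "\<phi> \<in> borel_measurable borel" using assms(1) by (simp add: admissible_def)
  have "ennreal (1 - nexp (a + b)) = ennreal (1 - nexp a) + ennreal (nexp a) * ennreal (1 - nexp b)" for a b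
    by (subst ennreal_mult'[symmetric]; (subst ennreal_plus[symmetric])?; simp add: nexp_add algebra_simps)
  then show e: "Laplace_exponent (\<lambda>x. \<phi> x + ennreal z * ennreal x ^ n) =
      Laplace_exponent \<phi> + (\<integral>\<^sup>+x. ennreal (nexp (\<phi> x)) * ennreal (1 - nexp (ennreal z * ennreal x ^ n)) \<partial>\<nu>)"
    unfolding Laplace_exponent_def by (simp add: nn_integral_add)
  have "(\<integral>\<^sup>+x. ennreal (nexp (\<phi> x)) * ennreal (1 - nexp (ennreal z * ennreal x ^ n)) \<partial>\<nu>) \<le>
      (\<integral>\<^sup>+x. ennreal z * (ennreal x ^ n * ennreal (nexp (\<phi> x))) \<partial>\<nu>)"
  proof (rule nn_integral_mono)
    fix x
    have "ennreal (nexp (\<phi> x)) * ennreal (1 - nexp (ennreal z * ennreal x ^ n)) \<le>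
        ennreal (nexp (\<phi> x)) * (ennreal z * ennreal x ^ n)"
      by (rule mult_left_mono[OF one_minus_nexp_le]) simp
    then show "ennreal (nexp (\<phi> x)) * ennreal (1 - nexp (ennreal z * ennreal x ^ n)) \<le>
        ennreal z * (ennreal x ^ n * ennreal (nexp (\<phi> x)))"
      by (simp only: mult_ac)
  qed
  also have "\<dots> = ennreal z * tilted_moment \<phi> n" unfolding tilted_moment_def by (rule nn_integral_cmult) measurable
  also have "\<dots> < \<infinity>" using tilted_moment_finite[OF assms(1,2)] by (simp add: ennreal_mult_less_top)
  finally have "Laplace_exponent (\<lambda>x. \<phi> x + ennreal z * ennreal x ^ n) < \<infinity>"
    unfolding e using assms(1) by (simp add: admissible_def Laplace_exponent_def)
  moreover obtain y where y: "y > 0" "\<And>x. x > 0 \<Longrightarrow> ennreal (y * x) \<le> \<phi> x" using assms(1) unfolding admissible_def by blast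
  ultimately show "admissible (\<lambda>x. \<phi> x + ennreal z * ennreal x ^ n)"
    unfolding admissible_def Laplace_exponent_def using y by (auto intro!: exI[of _ y] add_increasing2)
qed

text \<open>The assumption on \<open>U m\<close> is the additive form of a difference u - U m. The
  limit stays in [0, infinity], because it will be applied to an expectation whose finiteness is not
  known beforehand.\<close>

lemma enn2real_quot:
  assumes lim: "(\<lambda>m. \<integral>\<^sup>+x. W x * ennreal (diff_quot (f x) m) \<partial>N) \<longlonglongrightarrow> L"
    and W: "\<And>m. (\<integral>\<^sup>+x. W x * ennreal (1 - nexp (ennreal ((1/2) ^ m) * f x)) \<partial>N) + U m = u"
    and meas[measurable]: "W \<in> borel_measurable N" "f \<in> borel_measurable N"
    and fin: "u < \<infinity>"
  shows "(\<lambda>m. ennreal (2 ^ m * (enn2real u - enn2real (U m)))) \<longlonglongrightarrow> L"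
    "\<And>m. 0 \<le> 2 ^ m * (enn2real u - enn2real (U m))"
proof -
  let ?I = "\<lambda>m. \<integral>\<^sup>+x. W x * ennreal (1 - nexp (ennreal ((1/2) ^ m) * f x)) \<partial>N"
  have fm: "?I m < \<infinity>" "U m < \<infinity>" for m
    using W[of m] fin by (metis ennreal_add_eq_top infinity_ennreal_def less_top)+
  have d: "enn2real (?I m) = enn2real u - enn2real (U m)" for m
    using fm[of m] unfolding W[of m, symmetric] by (subst enn2real_plus) auto
  have "(\<integral>\<^sup>+x. W x * ennreal (diff_quot (f x) m) \<partial>N) = ennreal (2 ^ m) * ?I m" for m
    by (rule nn_integral_diff_quot_eq) measurable
  also have "\<And>m. ennreal (2 ^ m) * ?I m = ennreal (2 ^ m * enn2real (?I m))"
    using fm by (simp add: ennreal_mult')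
  finally show "(\<lambda>m. ennreal (2 ^ m * (enn2real u - enn2real (U m)))) \<longlonglongrightarrow> L"
    using lim by (simp add: d)
  show "0 \<le> 2 ^ m * (enn2real u - enn2real (U m))" for m
    using enn2real_nonneg[of "?I m"] unfolding d by simp
qed

lemma enn2real_quot_real:
  assumes lim: "(\<lambda>m. \<integral>\<^sup>+x. W x * ennreal (diff_quot (f x) m) \<partial>N) \<longlonglongrightarrow> L"
    and W: "\<And>m. (\<integral>\<^sup>+x. W x * ennreal (1 - nexp (ennreal ((1/2) ^ m) * f x)) \<partial>N) + U m = u"
    and meas: "W \<in> borel_measurable N" "f \<in> borel_measurable N"
    and fin: "u < \<infinity>" "L < \<infinity>"
  shows "(\<lambda>m. 2 ^ m * (enn2real u - enn2real (U m))) \<longlonglongrightarrow> enn2real L"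
proof -
  note q = enn2real_quot[OF lim W meas fin(1)]
  have "(\<lambda>m. ennreal (2 ^ m * (enn2real u - enn2real (U m)))) \<longlonglongrightarrow> ennreal (enn2real L)"
    using q(1) fin(2) by simp
  then show ?thesis by (subst (asm) tendsto_ennreal_iff) (auto intro!: always_eventually q(2))
qed

text \<open>By induction on the length of the list: replacing \<open>\<phi>\<close> by \<open>\<phi> + z x\<^sup>n\<close> and differentiating at
  \<open>z = 0\<close> multiplies the integrand by \<open>\<Sum>i. J i ^ n\<close>, and \<open>distinct_sum_Cons\<close> splits this product.
  Along \<open>z = 2\<^sup>-\<^sup>m\<close> the difference quotients increase, so that monotone convergence suffices.\<close>

theorem moment_formula:
  assumes "admissible \<phi>" "\<And>n. n \<in> set ns \<Longrightarrow> 1 \<le> n"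
  shows "(\<integral>\<^sup>+\<omega>. distinct_sum (\<lambda>i. ennreal (J i \<omega>)) ns * ennreal (nexp (\<Sum>i. \<phi> (J i \<omega>))) \<partial>M) =
    ennreal ((\<Prod>j<length ns. enn2real (tilted_moment \<phi> (ns ! j))) * exp (- enn2real (Laplace_exponent \<phi>)))"
  using assms
proof (induction "length ns" arbitrary: ns \<phi>)
  case 0
  have [measurable]: "\<phi> \<in> borel_measurable borel" and f: "Laplace_exponent \<phi> < \<infinity>" using 0 by (auto simp: admissible_def Laplace_exponent_def)
  show ?case using 0 f by (simp add: Laplace_functional Laplace_exponent_def[symmetric] nexp_eq_ennreal)
next
  case (Suc k)
  then obtain n ns' where ns: "ns = n # ns'" "k = length ns'" by (cases ns) auto
  have n: "1 \<le> n" and ns': "\<And>i. i \<in> set ns' \<Longrightarrow> 1 \<le> i" using Suc.prems(2) ns by auto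
  note good = Suc.prems(1)
  have [measurable]: "\<phi> \<in> borel_measurable borel" and exponent_fin: "Laplace_exponent \<phi> < \<infinity>" using good by (auto simp: admissible_def Laplace_exponent_def)
  define \<psi> where "\<psi> m x = \<phi> x + ennreal ((1/2) ^ m) * ennreal x ^ n" for m x
  have good\<psi>: "admissible (\<psi> m)" for m unfolding \<psi>_def by (rule admissible_add_power[OF good n]) simp
  have [measurable]: "\<psi> m \<in> borel_measurable borel" for m unfolding \<psi>_def by measurable
  let ?a = "\<lambda>i. enn2real (tilted_moment \<phi> i)" and ?A = "\<lambda>m i. enn2real (tilted_moment (\<psi> m) i)"
  let ?b = "enn2real (Laplace_exponent \<phi>)" and ?B = "\<lambda>m. enn2real (Laplace_exponent (\<psi> m))"
  let ?D = "\<lambda>ns \<omega>. distinct_sum (\<lambda>i. ennreal (J i \<omega>)) ns"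
  let ?e = "\<lambda>\<phi> \<omega>. ennreal (nexp (\<Sum>i. \<phi> (J i \<omega>)))"
  let ?P = "\<lambda>ns \<phi>. (\<Prod>j<length ns. enn2real (tilted_moment \<phi> (ns ! j))) * exp (- enn2real (Laplace_exponent \<phi>))"
  let ?F = "\<lambda>\<phi>. \<integral>\<^sup>+\<omega>. ?D ns' \<omega> * ?e \<phi> \<omega> \<partial>M"
  define upd where "upd j = ns'[j := ns' ! j + n]" for j
  \<comment> \<open>The induction hypothesis is needed for other weights and other lists of length
    k: for the perturbed \<open>\<psi> m\<close> and for the lists \<open>upd j\<close>.\<close>
  have IH: "(\<integral>\<^sup>+\<omega>. ?D ns'' \<omega> * ?e \<phi>' \<omega> \<partial>M) = ennreal (?P ns'' \<phi>')"
    if "length ns'' = k" "admissible \<phi>'" "\<And>i. i \<in> set ns'' \<Longrightarrow> 1 \<le> i" for ns'' \<phi>'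
    using Suc.hyps(1)[OF that(1)[symmetric] that(2,3)] by simp
  have split1: "w * ennreal (nexp p) * ennreal (1 - nexp q) + w * ennreal (nexp (p + q)) = w * ennreal (nexp p)" for w p q
  proof -
    have "ennreal (nexp p) * ennreal (1 - nexp q) + ennreal (nexp (p + q)) = ennreal (nexp p)"
      by (subst ennreal_mult'[symmetric]; (subst ennreal_plus[symmetric])?; simp add: nexp_add algebra_simps)
    then show ?thesis by (simp only: mult.assoc distrib_left[symmetric])
  qed
  have lima: "(\<lambda>m. 2 ^ m * (?a i - ?A m i)) \<longlonglongrightarrow> ?a (i + n)" if i: "1 \<le> i" for i
  proof (rule enn2real_quot_real)
    show "(\<lambda>m. \<integral>\<^sup>+x. (ennreal x ^ i * ennreal (nexp (\<phi> x))) * ennreal (diff_quot (ennreal x ^ n) m) \<partial>\<nu>) \<longlonglongrightarrow> tilted_moment \<phi> (i + n)"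
      using nn_integral_diff_quot[of "\<lambda>x. ennreal x ^ n" \<nu> "\<lambda>x. ennreal x ^ i * ennreal (nexp (\<phi> x))"]
      by (simp add: tilted_moment_def power_add mult_ac)
    show "(\<integral>\<^sup>+x. (ennreal x ^ i * ennreal (nexp (\<phi> x))) * ennreal (1 - nexp (ennreal ((1/2) ^ m) * ennreal x ^ n)) \<partial>\<nu>) + tilted_moment (\<psi> m) i = tilted_moment \<phi> i" for m
      unfolding tilted_moment_def \<psi>_def by (subst nn_integral_add[symmetric]) (auto simp: split1)
    show "tilted_moment \<phi> i < \<infinity>" "tilted_moment \<phi> (i + n) < \<infinity>" using tilted_moment_finite[OF good] i by auto
  qed measurable
  have limb: "(\<lambda>m. 2 ^ m * (?B m - ?b)) \<longlonglongrightarrow> ?a n"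
  proof -
    let ?I = "\<lambda>m. \<integral>\<^sup>+x. ennreal (nexp (\<phi> x)) * ennreal (1 - nexp (ennreal ((1/2) ^ m) * ennreal x ^ n)) \<partial>\<nu>"
    let ?c = "\<lambda>m. Laplace_exponent \<phi> + ?I m"
    have ex\<psi>: "Laplace_exponent (\<psi> m) = ?c m" for m
      unfolding \<psi>_def using admissible_add_power(2)[OF good n] by simp
    have I: "?I m < \<infinity>" for m
      using good\<psi>[of m] ex\<psi>[of m] unfolding admissible_def Laplace_exponent_def[symmetric] by (metis add.commute ennreal_add_eq_top infinity_ennreal_def less_top)
    have "?B m - ?b = enn2real (?I m)" for m
      unfolding ex\<psi> using I[of m] exponent_fin by (subst enn2real_plus) auto
    moreover have "(\<integral>\<^sup>+x. ennreal (nexp (\<phi> x)) * ennreal (diff_quot (ennreal x ^ n) m) \<partial>\<nu>) = ennreal (2 ^ m) * ?I m" for m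
      by (rule nn_integral_diff_quot_eq) measurable
    ultimately have "2 ^ m * (?B m - ?b) = enn2real (\<integral>\<^sup>+x. ennreal (nexp (\<phi> x)) * ennreal (diff_quot (ennreal x ^ n) m) \<partial>\<nu>)" for m
      by (simp only: enn2real_mult) simp
    moreover have "(\<lambda>m. enn2real (\<integral>\<^sup>+x. ennreal (nexp (\<phi> x)) * ennreal (diff_quot (ennreal x ^ n) m) \<partial>\<nu>)) \<longlonglongrightarrow> ?a n"
    proof (rule tendsto_enn2real)
      show "(\<lambda>m. \<integral>\<^sup>+x. ennreal (nexp (\<phi> x)) * ennreal (diff_quot (ennreal x ^ n) m) \<partial>\<nu>) \<longlonglongrightarrow> ennreal (?a n)"
        using nn_integral_diff_quot[of "\<lambda>x. ennreal x ^ n" \<nu> "\<lambda>x. ennreal (nexp (\<phi> x))"] tilted_moment_finite[OF good n]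
        by (simp add: tilted_moment_def mult.commute)
    qed simp
    ultimately show ?thesis by simp
  qed
  \<comment> \<open>The derivative of the closed form for \<open>ns'\<close>: the first summand
    differentiates the tilted moments, the second the exponential factor.\<close>
  let ?lim = "(\<Sum>j<k. \<Prod>i<k. ?a (upd j ! i)) * exp (- ?b) + (\<Prod>j<k. ?a (ns' ! j)) * (exp (- ?b) * ?a n)"
  have limP: "(\<lambda>m. 2 ^ m * (?P ns' \<phi> - ?P ns' (\<psi> m))) \<longlonglongrightarrow> ?lim"
    unfolding upd_def ns(2)
    by (intro tendsto_quot_mult tendsto_quot_prod tendsto_quot_exp filterlim_two_power lima limb ns')
  have F: "?F \<phi> = ennreal (?P ns' \<phi>)" "?F (\<psi> m) = ennreal (?P ns' (\<psi> m))" for m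
    using good good\<psi> ns' by (auto intro!: IH simp: ns(2))
  have nnP: "0 \<le> ?P ns' \<phi>'" for \<phi>' by (intro mult_nonneg_nonneg prod_nonneg) auto
  have limF: "(\<lambda>m. ennreal (2 ^ m * (enn2real (?F \<phi>) - enn2real (?F (\<psi> m))))) \<longlonglongrightarrow>
      (\<integral>\<^sup>+\<omega>. (?D ns' \<omega> * ?e \<phi> \<omega>) * (\<Sum>i. ennreal (J i \<omega>) ^ n) \<partial>M)"
  proof (rule enn2real_quot(1))
    show "(\<lambda>m. \<integral>\<^sup>+\<omega>. (?D ns' \<omega> * ?e \<phi> \<omega>) * ennreal (diff_quot (\<Sum>i. ennreal (J i \<omega>) ^ n) m) \<partial>M) \<longlonglongrightarrow>
      (\<integral>\<^sup>+\<omega>. (?D ns' \<omega> * ?e \<phi> \<omega>) * (\<Sum>i. ennreal (J i \<omega>) ^ n) \<partial>M)"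
      by (rule nn_integral_diff_quot) measurable
    show "(\<integral>\<^sup>+\<omega>. ?D ns' \<omega> * ?e \<phi> \<omega> * ennreal (1 - nexp (ennreal ((1/2) ^ m) * (\<Sum>i. ennreal (J i \<omega>) ^ n))) \<partial>M) + ?F (\<psi> m) = ?F \<phi>" for m
    proof -
      have "(\<Sum>i. \<psi> m (J i \<omega>)) = (\<Sum>i. \<phi> (J i \<omega>)) + ennreal ((1/2) ^ m) * (\<Sum>i. ennreal (J i \<omega>) ^ n)" for \<omega>
        by (simp add: \<psi>_def suminf_add[symmetric] ennreal_suminf_cmult)
      then show ?thesis by (subst nn_integral_add[symmetric]) (auto simp: split1)
    qed
    show "?F \<phi> < \<infinity>" unfolding F by simp
  qed measurable
  then have "(\<lambda>m. ennreal (2 ^ m * (?P ns' \<phi> - ?P ns' (\<psi> m)))) \<longlonglongrightarrow>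
      (\<integral>\<^sup>+\<omega>. (?D ns' \<omega> * ?e \<phi> \<omega>) * (\<Sum>i. ennreal (J i \<omega>) ^ n) \<partial>M)"
    unfolding F using nnP by simp
  moreover have "(\<lambda>m. ennreal (2 ^ m * (?P ns' \<phi> - ?P ns' (\<psi> m)))) \<longlonglongrightarrow> ennreal ?lim"
    by (rule tendsto_ennrealI[OF limP])
  ultimately have "ennreal ?lim = (\<integral>\<^sup>+\<omega>. (?D ns' \<omega> * ?e \<phi> \<omega>) * (\<Sum>i. ennreal (J i \<omega>) ^ n) \<partial>M)"
    by (rule LIMSEQ_unique[rotated])
  also have "\<dots> = (\<integral>\<^sup>+\<omega>. ?D (n # ns') \<omega> * ?e \<phi> \<omega> + (\<Sum>j<k. ?D (upd j) \<omega> * ?e \<phi> \<omega>) \<partial>M)"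
  proof (rule nn_integral_cong)
    fix \<omega>
    have "(?D ns' \<omega> * ?e \<phi> \<omega>) * (\<Sum>i. ennreal (J i \<omega>) ^ n) = ((\<Sum>i. ennreal (J i \<omega>) ^ n) * ?D ns' \<omega>) * ?e \<phi> \<omega>"
      by (simp add: mult_ac)
    also have "\<dots> = ?D (n # ns') \<omega> * ?e \<phi> \<omega> + (\<Sum>j<k. ?D (upd j) \<omega> * ?e \<phi> \<omega>)"
      unfolding distinct_sum_Cons[symmetric] upd_def ns(2) by (simp add: distrib_right sum_distrib_right)
    finally show "(?D ns' \<omega> * ?e \<phi> \<omega>) * (\<Sum>i. ennreal (J i \<omega>) ^ n) = \<dots>" .
  qed
  also have "\<dots> = (\<integral>\<^sup>+\<omega>. ?D (n # ns') \<omega> * ?e \<phi> \<omega> \<partial>M) + (\<Sum>j<k. \<integral>\<^sup>+\<omega>. ?D (upd j) \<omega> * ?e \<phi> \<omega> \<partial>M)"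
    by (subst nn_integral_add) (auto simp: nn_integral_sum)
  also have "(\<Sum>j<k. \<integral>\<^sup>+\<omega>. ?D (upd j) \<omega> * ?e \<phi> \<omega> \<partial>M) = (\<Sum>j<k. ennreal (?P (upd j) \<phi>))"
  proof (rule sum.cong)
    fix j assume "j \<in> {..<k}"
    then have "set (upd j) \<subseteq> insert (ns' ! j + n) (set ns')" unfolding upd_def by (intro set_update_subset_insert)
    then show "(\<integral>\<^sup>+\<omega>. ?D (upd j) \<omega> * ?e \<phi> \<omega> \<partial>M) = ennreal (?P (upd j) \<phi>)"
      using n ns' good by (intro IH) (auto simp: upd_def ns(2))
  qed simp
  also have "\<dots> = ennreal ((\<Sum>j<k. \<Prod>i<k. ?a (upd j ! i)) * exp (- ?b))"
    by (subst sum_ennreal) (auto intro!: mult_nonneg_nonneg prod_nonneg simp: sum_distrib_right upd_def ns(2))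
  \<comment> \<open>The same derivative has been computed on both sides of the formula. The
    contributions of coinciding indices agree and are finite, so they cancel and leave the claim for
    the longer list.\<close>
  finally have "ennreal ((\<Prod>j<k. ?a (ns' ! j)) * (exp (- ?b) * ?a n)) + ennreal ((\<Sum>j<k. \<Prod>i<k. ?a (upd j ! i)) * exp (- ?b)) =
     (\<integral>\<^sup>+\<omega>. ?D (n # ns') \<omega> * ?e \<phi> \<omega> \<partial>M) + ennreal ((\<Sum>j<k. \<Prod>i<k. ?a (upd j ! i)) * exp (- ?b))"
    by (subst (asm) ennreal_plus) (auto intro!: mult_nonneg_nonneg prod_nonneg sum_nonneg simp: add.commute)
  then have "(\<integral>\<^sup>+\<omega>. ?D (n # ns') \<omega> * ?e \<phi> \<omega> \<partial>M) = ennreal ((\<Prod>j<k. ?a (ns' ! j)) * (exp (- ?b) * ?a n))"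
    by (simp add: ennreal_add_left_cancel add.commute)
  then show ?case
    by (simp add: ns prod.lessThan_Suc_shift mult_ac del: prod.lessThan_Suc)
qed

text \<open>A linear weight tilts by exp(-yT). The exponents \<gamma> - n_j of y add up over the
  blocks, so that individual block sizes enter only through a constant factor. The Gibbs property
  has its origin here.\<close>

lemma moment_formula_exp:
  assumes y: "0 < y" and ns: "\<And>n. n \<in> set ns \<Longrightarrow> 1 \<le> n"
  shows "(\<integral>\<^sup>+\<omega>. distinct_sum (\<lambda>i. ennreal (J i \<omega>)) ns * ennreal (nexp (\<Sum>i. ennreal (y * J i \<omega>))) \<partial>M) =
    ennreal (\<gamma> ^ length ns * (\<Prod>j<length ns. pochhammer (1 - \<gamma>) (ns ! j - 1)) *
      y powr (real (length ns) * \<gamma> - real (sum_list ns)) * exp (- (y powr \<gamma>)))"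
proof -
  let ?\<phi> = "\<lambda>x. ennreal (y * x)"
  have e: "Laplace_exponent ?\<phi> = ennreal (y powr \<gamma>)"
    unfolding Laplace_exponent_def stable_intensity_one_minus_exp[OF \<gamma> y, symmetric]
  proof (rule nn_integral_cong_AE)
    show "AE x in \<nu>. ennreal (1 - nexp (?\<phi> x)) = ennreal (1 - exp (- (y * x)))"
      using AE_stable_intensity_pos[of \<gamma>] y by (auto elim!: eventually_mono)
  qed
  have m: "tilted_moment ?\<phi> n = ennreal (\<gamma> * pochhammer (1 - \<gamma>) (n - 1) * y powr (\<gamma> - n))" if "1 \<le> n" for n
    unfolding tilted_moment_def stable_intensity_power_exp[OF \<gamma> y that, symmetric]
  proof (rule nn_integral_cong_AE)
    show "AE x in \<nu>. ennreal x ^ n * ennreal (nexp (?\<phi> x)) = ennreal (x ^ n * exp (- (y * x)))"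
      using AE_stable_intensity_pos[of \<gamma>] y
      by (auto elim!: eventually_mono simp: ennreal_power ennreal_mult'[symmetric])
  qed
  have "admissible ?\<phi>" unfolding admissible_def Laplace_exponent_def[symmetric] e using y by auto
  note moment_formula[OF this ns]
  also have "(\<Prod>j<length ns. enn2real (tilted_moment ?\<phi> (ns ! j))) =
      (\<Prod>j<length ns. \<gamma> * pochhammer (1 - \<gamma>) (ns ! j - 1) * y powr (\<gamma> - ns ! j))"
    using ns \<gamma> by (intro prod.cong) (auto simp: m pochhammer_nonneg)
  also have "\<dots> = \<gamma> ^ length ns * (\<Prod>j<length ns. pochhammer (1 - \<gamma>) (ns ! j - 1)) *
      y powr (real (length ns) * \<gamma> - real (sum_list ns))"
    using y by (simp add: prod.distrib powr_sum[symmetric] sum_subtractf sum_list_sum_nth atLeast0LessThan)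
  finally show ?thesis by (simp add: e)
qed

end

section \<open>The inverse local time as a function of the normalized points\<close>

locale stable_pd = stable_ppp +
  assumes AE_P_inf: "AE \<omega> in M. pd_seq J \<omega> \<in> P_inf"
begin

abbreviation T :: "'a \<Rightarrow> real" where "T \<equiv> total_mass J"

lemma measurable_T[measurable]: "T \<in> borel_measurable M"
  unfolding total_mass_def[abs_def] by measurable

lemma measurable_pd_seq[measurable]: "pd_seq J \<in> measurable M seq_space"
  unfolding pd_seq_def[abs_def] by (rule measurable_PiM_single') auto

text \<open>Convergence of the raw points to \<open>T\<close> is read off from the normalized
  sequence, which lies in \<open>P_inf\<close> and hence sums to 1.\<close>

lemma AE_sums: "AE \<omega> in M. (\<forall>i. 0 < J i \<omega>) \<and> 0 < T \<omega> \<and> (\<lambda>i. J i \<omega>) sums T \<omega>"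
  using AE_P_inf AE_J_pos
proof eventually_elim
  case (elim \<omega>)
  then have s: "(\<lambda>i. J i \<omega> / T \<omega>) sums 1" by (simp add: P_inf_def pd_seq_def)
  \<comment> \<open>Division by 0 yields 0, so T = 0 would make the normalized sequence sum to 0
    instead of 1.\<close>
  then have T0: "T \<omega> \<noteq> 0" using sums_unique2[OF s, of 0] by auto
  then have J: "(\<lambda>i. J i \<omega>) sums T \<omega>" using sums_mult[OF s, of "T \<omega>"] by simp
  then have "0 \<le> T \<omega>" using elim(2) by (intro sums_le[OF _ sums_zero J]) (auto intro: less_imp_le)
  then show ?case using elim T0 J by auto
qed

lemma AE_suminf: "AE \<omega> in M. \<forall>y\<ge>0. (\<Sum>i. ennreal (y * J i \<omega>)) = ennreal (y * T \<omega>)"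
  using AE_sums
proof eventually_elim
  case (elim \<omega>)
  then show ?case by (auto intro!: suminf_ennreal_eq sums_mult mult_nonneg_nonneg simp: less_imp_le)
qed

text \<open>The weights make the Laplace transform of \<open>Z m\<close> at the ranked points exactly
  \<open>exp (- s powr rho m / Gamma (1 - \<gamma>))\<close>. As \<open>rho m\<close> tends to 1, \<open>Z m\<close> therefore tends to the constant
  \<open>1 / Gamma (1 - \<gamma>)\<close> in probability, while it is homogeneous of degree \<open>\<gamma> / rho m\<close>.\<close>

definition rho :: "nat \<Rightarrow> real" where "rho m = 1 - 1 / real (m + 2)"
definition wt :: "nat \<Rightarrow> real" where "wt m = Gamma (1 - rho m) powr (- 1 / rho m)"
definition Z :: "nat \<Rightarrow> (nat \<Rightarrow> real) \<Rightarrow> ennreal" where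
  "Z m p = (\<Sum>i. ennreal (wt m * p i powr (\<gamma> / rho m)))"

lemma rho: "0 < rho m" "rho m < 1"
  by (auto simp: rho_def)

lemma wt_pos: "0 < wt m"
proof -
  have "Gamma (1 - rho m) > 0" using rho[of m] by (auto intro: Gamma_real_pos)
  then show ?thesis by (simp add: wt_def)
qed

lemma rho_tendsto: "rho \<longlonglongrightarrow> 1"
proof -
  have "(\<lambda>m. 1 - inverse (real (Suc (Suc m)))) \<longlonglongrightarrow> 1 - 0"
    using LIMSEQ_Suc[OF LIMSEQ_inverse_real_of_nat] by (intro tendsto_intros)
  then show ?thesis by (simp add: rho_def[abs_def] inverse_eq_divide add.commute)
qed

lemma measurable_Z[measurable]: "Z m \<in> borel_measurable seq_space"
  unfolding Z_def[abs_def] by measurable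

lemma Z_Laplace:
  assumes s: "0 < s"
  shows "(\<integral>\<^sup>+\<omega>. ennreal (nexp (ennreal s * Z m (\<lambda>i. J i \<omega>))) \<partial>M) =
    ennreal (exp (- (s powr rho m / Gamma (1 - \<gamma>))))"
proof -
  have G: "Gamma (1 - \<gamma>) > 0" "Gamma (1 - rho m) > 0" using \<gamma> rho[of m] by (auto intro: Gamma_real_pos)
  let ?w = "s * wt m"
  have w: "0 < ?w" using s wt_pos by simp
  have "(\<integral>\<^sup>+\<omega>. ennreal (nexp (ennreal s * Z m (\<lambda>i. J i \<omega>))) \<partial>M) =
      (\<integral>\<^sup>+\<omega>. ennreal (nexp (\<Sum>i. ennreal (?w * J i \<omega> powr (\<gamma> / rho m)))) \<partial>M)"
    using s wt_pos[of m] by (simp add: Z_def ennreal_suminf_cmult[symmetric] mult.assoc flip: ennreal_mult')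
  also have "\<dots> = ennreal (nexp (\<integral>\<^sup>+x. ennreal (1 - nexp (ennreal (?w * x powr (\<gamma> / rho m)))) \<partial>\<nu>))"
    by (rule Laplace_functional) measurable
  also have "(\<integral>\<^sup>+x. ennreal (1 - nexp (ennreal (?w * x powr (\<gamma> / rho m)))) \<partial>\<nu>) =
      (\<integral>\<^sup>+x. ennreal (1 - exp (- (?w * x powr (\<gamma> / rho m)))) \<partial>\<nu>)"
    using w by (intro nn_integral_cong) simp
  also have "\<dots> = ennreal (Gamma (1 - rho m) / Gamma (1 - \<gamma>) * ?w powr rho m)"
    by (rule stable_intensity_one_minus_exp_powr[OF \<gamma> rho w])
  \<comment> \<open>The exponent - 1 / rho m in \<open>wt\<close> is made for this: the weight
    contributes 1 / Gamma(1 - rho m), which cancels the numerator.\<close>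
  also have "?w powr rho m = s powr rho m * inverse (Gamma (1 - rho m))"
  proof -
    have "wt m powr rho m = Gamma (1 - rho m) powr (- 1)"
      using rho[of m] by (simp add: wt_def powr_powr)
    then show ?thesis using s wt_pos[of m] G by (simp add: powr_mult powr_minus)
  qed
  also have "Gamma (1 - rho m) / Gamma (1 - \<gamma>) * (s powr rho m * inverse (Gamma (1 - rho m))) = s powr rho m / Gamma (1 - \<gamma>)"
    using G by (simp add: field_simps)
  finally show ?thesis using G by simp
qed

text \<open>\<open>Z m\<close> has infinite mean, so the bounded variable exp(-Z) is used. Its
  Laplace values at 1 and 2 give the mean square deviation from exp(-c) as exp(-(2 powr rho m) c) -
  exp(-2c), which vanishes as rho m tends to 1; a subsequence then converges almost surely.\<close>

lemma Z_AE_subseq: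
  "\<exists>r::nat \<Rightarrow> nat. strict_mono r \<and> (AE \<omega> in M. (\<lambda>m. enn2real (Z (r m) (\<lambda>i. J i \<omega>))) \<longlonglongrightarrow> 1 / Gamma (1 - \<gamma>))"
proof -
  define c where "c = 1 / Gamma (1 - \<gamma>)"
  have [measurable]: "(\<lambda>\<omega>. Z m (\<lambda>i. J i \<omega>)) \<in> borel_measurable M" for m
    unfolding Z_def by measurable
  let ?N = "\<lambda>m \<omega>. nexp (Z m (\<lambda>i. J i \<omega>))"
  have E1: "(\<integral>\<omega>. ?N m \<omega> \<partial>M) = exp (- c)" for m
    using Z_Laplace[of 1 m] by (subst integral_eq_nn_integral) (auto simp: c_def)
  have E2: "(\<integral>\<omega>. ?N m \<omega> * ?N m \<omega> \<partial>M) = exp (- (2 powr rho m * c))" for m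
  proof -
    have "ennreal 2 * x = x + x" for x :: ennreal by (simp add: mult_2)
    then show ?thesis
      using Z_Laplace[of 2 m] by (subst integral_eq_nn_integral) (auto simp: c_def nexp_add)
  qed
  have int: "integrable M (?N m)" "integrable M (\<lambda>\<omega>. ?N m \<omega> * ?N m \<omega>)" for m
    by (auto intro!: integrable_const_bound[of _ 1] AE_I2 mult_le_one)
  define u where "u m \<omega> = (?N m \<omega> - exp (- c)) * (?N m \<omega> - exp (- c))" for m \<omega>
  have u: "u m \<omega> = ?N m \<omega> * ?N m \<omega> - 2 * exp (- c) * ?N m \<omega> + exp (- c) * exp (- c)" for m \<omega>
    by (simp add: u_def algebra_simps)
  have intu: "integrable M (u m)" for m unfolding u using int by auto
  have "(\<integral>\<omega>. norm (u m \<omega>) \<partial>M) = exp (- (2 powr rho m * c)) - exp (- c) * exp (- c)" for m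
  proof -
    have "norm (u m \<omega>) = u m \<omega>" for \<omega> by (simp add: u_def)
    then show ?thesis unfolding u using int by (simp add: E1 E2 prob_space)
  qed
  moreover have "(\<lambda>m. exp (- (2 powr rho m * c)) - exp (- c) * exp (- c)) \<longlonglongrightarrow> exp (- (2 powr 1 * c)) - exp (- c) * exp (- c)"
    by (intro tendsto_intros rho_tendsto) auto
  moreover have "exp (- (2 powr 1 * c)) - exp (- c) * exp (- c) = 0" by (simp flip: exp_add)
  ultimately have "(\<lambda>m. \<integral>\<omega>. norm (u m \<omega>) \<partial>M) \<longlonglongrightarrow> 0" by simp
  from tendsto_L1_AE_subseq[OF intu this] obtain r where r: "strict_mono r"
    and ae: "AE \<omega> in M. (\<lambda>m. u (r m) \<omega>) \<longlonglongrightarrow> 0" by blast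
  from ae have "AE \<omega> in M. (\<lambda>m. enn2real (Z (r m) (\<lambda>i. J i \<omega>))) \<longlonglongrightarrow> c"
  proof eventually_elim
    case (elim \<omega>)
    then have "(\<lambda>m. sqrt (u (r m) \<omega>)) \<longlonglongrightarrow> sqrt 0" by (rule tendsto_real_sqrt)
    then have "(\<lambda>m. \<bar>?N (r m) \<omega> - exp (- c)\<bar>) \<longlonglongrightarrow> 0" by (simp add: u_def)
    then have lim: "(\<lambda>m. ?N (r m) \<omega>) \<longlonglongrightarrow> exp (- c)"
      by (rule LIM_zero_cancel[OF tendsto_rabs_zero_cancel])
    then have "(\<lambda>m. - ln (?N (r m) \<omega>)) \<longlonglongrightarrow> - ln (exp (- c))" by (intro tendsto_intros) auto
    \<comment> \<open>Eventual positivity of the exponential rules out infinite values of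
      \<open>Z\<close>, which \<open>enn2real\<close> would send to 0.\<close>
    moreover have "eventually (\<lambda>m. - ln (?N (r m) \<omega>) = enn2real (Z (r m) (\<lambda>i. J i \<omega>))) sequentially"
      using order_tendstoD(1)[OF lim, of 0] by (auto elim!: eventually_mono simp: nexp_def split: if_splits)
    ultimately show ?case by (auto intro: Lim_transform_eventually)
  qed
  then show ?thesis using r unfolding c_def by blast
qed

text \<open>This makes anything independent of \<open>pd_seq J\<close> independent of \<open>T\<close> as well.\<close>

theorem T_eq_function_of_pd_seq:
  obtains \<tau> where "\<tau> \<in> borel_measurable seq_space" "AE \<omega> in M. T \<omega> = \<tau> (pd_seq J \<omega>)"
proof -
  define c where "c = 1 / Gamma (1 - \<gamma>)"
  have c: "c > 0" using \<gamma> by (auto simp: c_def intro: Gamma_real_pos)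
  obtain r where r: "strict_mono r" "AE \<omega> in M. (\<lambda>m. enn2real (Z (r m) (\<lambda>i. J i \<omega>))) \<longlonglongrightarrow> c"
    using Z_AE_subseq unfolding c_def by blast
  \<comment> \<open>At J / T the sequence \<open>Z (r m)\<close> tends to c times T powr
    (-\<gamma>); this solves for T. The subsequence \<open>r\<close> does not depend on the sample
    point, so \<tau> is a function of the sequence alone.\<close>
  define \<tau> where "\<tau> p = (c / lim (\<lambda>m. enn2real (Z (r m) p))) powr (1 / \<gamma>)" for p
  have "\<tau> \<in> borel_measurable seq_space"
    unfolding \<tau>_def[abs_def] by measurable
  moreover have "AE \<omega> in M. T \<omega> = \<tau> (pd_seq J \<omega>)"
    using r(2) AE_sums
  proof eventually_elim
    case (elim \<omega>)
    let ?\<theta> = "\<lambda>m. \<gamma> / rho (r m)"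
    have Zs: "enn2real (Z (r m) (pd_seq J \<omega>)) = T \<omega> powr (- ?\<theta> m) * enn2real (Z (r m) (\<lambda>i. J i \<omega>))" for m
    proof -
      have "Z (r m) (pd_seq J \<omega>) = ennreal (T \<omega> powr (- ?\<theta> m)) * Z (r m) (\<lambda>i. J i \<omega>)"
        unfolding Z_def ennreal_suminf_cmult[symmetric]
      proof (rule suminf_cong)
        fix i
        have "0 < J i \<omega>" "0 < T \<omega>" using elim(2) by auto
        then have "pd_seq J \<omega> i powr ?\<theta> m = T \<omega> powr (- ?\<theta> m) * J i \<omega> powr ?\<theta> m"
          by (simp add: pd_seq_def powr_divide powr_minus_divide)
        then show "ennreal (wt (r m) * pd_seq J \<omega> i powr ?\<theta> m) =
            ennreal (T \<omega> powr (- ?\<theta> m)) * ennreal (wt (r m) * J i \<omega> powr ?\<theta> m)"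
          by (simp only: ennreal_mult'[symmetric] powr_ge_zero mult.left_commute)
      qed
      then show ?thesis by (simp add: enn2real_mult)
    qed
    have "(\<lambda>m. rho (r m)) \<longlonglongrightarrow> 1" using LIMSEQ_subseq_LIMSEQ[OF rho_tendsto r(1)] by (simp add: o_def)
    then have "(\<lambda>m. T \<omega> powr (- ?\<theta> m) * enn2real (Z (r m) (\<lambda>i. J i \<omega>))) \<longlonglongrightarrow> T \<omega> powr (- (\<gamma> / 1)) * c"
      using elim by (intro tendsto_intros elim(1)) auto
    then have "lim (\<lambda>m. enn2real (Z (r m) (pd_seq J \<omega>))) = T \<omega> powr (- \<gamma>) * c"
      unfolding Zs by (simp add: limI)
    then have "\<tau> (pd_seq J \<omega>) = (T \<omega> powr \<gamma>) powr (1 / \<gamma>)"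
      using c by (simp add: \<tau>_def powr_minus field_simps)
    then show ?case using elim \<gamma> by (simp add: powr_powr)
  qed
  ultimately show thesis by (rule that)
qed

end

section \<open>Partitions generated by a random element of \<open>P_inf\<close>\<close>

lemma sample_partition_eq:
  "sample_partition n I \<omega> = (\<lambda>m. {m' \<in> {1..n}. I m' \<omega> = I m \<omega>}) ` {1..n}"
proof -
  have "{(m, m'). m \<in> {1..n} \<and> m' \<in> {1..n} \<and> I m \<omega> = I m' \<omega>} `` {m} = {m' \<in> {1..n}. I m' \<omega> = I m \<omega>}"
    if "m \<in> {1..n}" for m
    using that by auto
  then show ?thesis
    unfolding sample_partition_def quotient_def UNION_singleton_eq_range by (intro image_cong refl)
qed

lemma sample_partition_subset: "sample_partition n I \<omega> \<subseteq> Pow {1..n}"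
  by (auto simp: sample_partition_eq)

lemma partition_on_sample_partition: "partition_on {1..n} (sample_partition n I \<omega>)"
  unfolding sample_partition_def
  by (rule partition_on_quotient) (auto simp: equiv_def refl_on_def sym_def trans_def)

lemma sets_Collect_image_eq:
  assumes fin: "finite S" "finite P"
    and c: "\<And>m A. m \<in> S \<Longrightarrow> {\<omega> \<in> space M. g \<omega> m = A} \<in> sets M"
  shows "{\<omega> \<in> space M. g \<omega> ` S = P} \<in> sets M"
proof -
  have "{\<omega> \<in> space M. \<forall>m\<in>S. \<exists>A\<in>P. g \<omega> m = A} \<in> sets M"
    by (rule sets.sets_Collect_finite_All[OF sets.sets_Collect_finite_Ex[OF c]]) (use fin in auto)
  moreover have "{\<omega> \<in> space M. \<forall>A\<in>P. \<exists>m\<in>S. g \<omega> m = A} \<in> sets M"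
    by (rule sets.sets_Collect_finite_All[OF sets.sets_Collect_finite_Ex[OF c]]) (use fin in auto)
  ultimately have "{\<omega> \<in> space M. \<forall>m\<in>S. \<exists>A\<in>P. g \<omega> m = A} \<inter> {\<omega> \<in> space M. \<forall>A\<in>P. \<exists>m\<in>S. g \<omega> m = A} \<in> sets M"
    by (rule sets.Int)
  also have "{\<omega> \<in> space M. \<forall>m\<in>S. \<exists>A\<in>P. g \<omega> m = A} \<inter> {\<omega> \<in> space M. \<forall>A\<in>P. \<exists>m\<in>S. g \<omega> m = A} =
      {\<omega> \<in> space M. g \<omega> ` S = P}"
  proof (rule set_eqI)
    fix \<omega>
    have "(\<forall>m\<in>S. \<exists>A\<in>P. g \<omega> m = A) \<and> (\<forall>A\<in>P. \<exists>m\<in>S. g \<omega> m = A) \<longleftrightarrow> g \<omega> ` S = P"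
      by (auto simp: image_iff)
    then show "\<omega> \<in> {\<omega> \<in> space M. \<forall>m\<in>S. \<exists>A\<in>P. g \<omega> m = A} \<inter> {\<omega> \<in> space M. \<forall>A\<in>P. \<exists>m\<in>S. g \<omega> m = A} \<longleftrightarrow>
        \<omega> \<in> {\<omega> \<in> space M. g \<omega> ` S = P}"
      by (simp only: Int_iff mem_Collect_eq) argo
  qed
  finally show ?thesis .
qed

locale iid_sampling =
  fixes M :: "'w measure" and V :: "'w \<Rightarrow> nat \<Rightarrow> real" and n :: nat and I :: "nat \<Rightarrow> 'w \<Rightarrow> nat"
  assumes sample: "iid_sample M V n I"
begin

sublocale prob_space M using sample by (simp add: iid_sample_def)

abbreviation partition_event :: "nat set set \<Rightarrow> 'w set" where
  "partition_event P \<equiv> {\<omega> \<in> space M. sample_partition n I \<omega> = P}"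

abbreviation blocks_event :: "nat \<Rightarrow> 'w set" where
  "blocks_event k \<equiv> {\<omega> \<in> space M. num_blocks n I \<omega> = k}"

lemma measurable_V[measurable]: "V \<in> measurable M seq_space"
  and AE_V: "AE \<omega> in M. V \<omega> \<in> P_inf"
  using sample by (auto simp: iid_sample_def)

lemma measurable_I: "m \<in> {1..n} \<Longrightarrow> I m \<in> measurable M (count_space UNIV)"
  using sample by (auto simp: iid_sample_def)

lemma measurable_V_component[measurable]: "(\<lambda>\<omega>. V \<omega> i) \<in> borel_measurable M"
  using measurable_compose[OF measurable_V measurable_component_singleton[of i UNIV]] by simp

lemma sets_event: "{\<omega> \<in> space M. \<forall>m\<in>{1..n}. I m \<omega> = i m} \<in> sets M"
proof (rule sets.sets_Collect_finite_All)
  show "{\<omega> \<in> space M. I m \<omega> = i m} \<in> sets M" if "m \<in> {1..n}" for m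
    using measurable_sets[OF measurable_I[OF that], of "{i m}"] by (simp add: vimage_def Int_def conj_commute)
qed auto

text \<open>The conditional mass function says that two weighted measures have the same image under
  \<open>V\<close>; integrating \<open>u\<close> against the common image extends the product
  formula from events of the sigma-algebra of \<open>V\<close> to all nonnegative functions of
  \<open>V\<close>.\<close>

lemma nn_integral_event:
  assumes u[measurable]: "u \<in> borel_measurable seq_space"
  shows "(\<integral>\<^sup>+\<omega>. u (V \<omega>) * indicator {\<omega> \<in> space M. \<forall>m\<in>{1..n}. I m \<omega> = i m} \<omega> \<partial>M) =
    (\<integral>\<^sup>+\<omega>. u (V \<omega>) * (\<Prod>m\<in>{1..n}. ennreal (V \<omega> (i m))) \<partial>M)"
proof -
  let ?E = "{\<omega> \<in> space M. \<forall>m\<in>{1..n}. I m \<omega> = i m}"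
  let ?F = "vimage_algebra (space M) V seq_space"
  note E[measurable] = sets_event[of i]
  have Fsub: "subalgebra M ?F"
    unfolding subalgebra_def using measurable_sets[OF measurable_V]
    by (auto simp: sets_vimage_algebra2[OF measurable_space[OF measurable_V, THEN funcsetI]])
  interpret F: finite_measure_subalgebra M ?F
    by unfold_locales (rule Fsub)
  let ?p = "\<lambda>\<omega>. \<Prod>m\<in>{1..n}. V \<omega> (i m)"
  have ce: "AE \<omega> in M. real_cond_exp M ?F (indicator ?E) \<omega> = ?p \<omega>"
    using sample by (simp add: iid_sample_def)
  have ppos: "AE \<omega> in M. 0 \<le> ?p \<omega>"
    using AE_V by eventually_elim (auto simp: P_inf_def intro: prod_nonneg)
  have p1: "AE \<omega> in M. ?p \<omega> \<le> 1"
    using AE_V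
  proof eventually_elim
    case (elim \<omega>)
    have "V \<omega> j \<le> 1" for j
    proof -
      have s: "V \<omega> sums 1" "\<And>j. 0 \<le> V \<omega> j" using elim by (auto simp: P_inf_def)
      have "sum (V \<omega>) {j} \<le> suminf (V \<omega>)" using s by (intro sum_le_suminf) (auto simp: sums_iff)
      then show ?thesis using s by (simp add: sums_iff)
    qed
    then show ?case using elim by (intro prod_le_1) (auto simp: P_inf_def)
  qed
  have [measurable]: "?p \<in> borel_measurable M" by measurable
  have intp: "integrable M ?p"
    using ppos p1 by (intro integrable_const_bound[of _ 1]) auto
  have eq: "distr (density M (indicator ?E)) seq_space V = distr (density M (\<lambda>\<omega>. ennreal (?p \<omega>))) seq_space V"
  proof (rule measure_eqI)
    fix B assume "B \<in> sets (distr (density M (indicator ?E)) seq_space V)"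
    then have B[measurable]: "B \<in> sets seq_space" by simp
    let ?B = "V -` B \<inter> space M"
    have BF: "?B \<in> sets ?F" by (rule in_vimage_algebra[OF B])
    have BM[measurable]: "?B \<in> sets M" by (rule measurable_sets[OF measurable_V B])
    have em: "emeasure (distr (density M f) seq_space V) B = (\<integral>\<^sup>+\<omega>. f \<omega> * indicator ?B \<omega> \<partial>M)"
      if [measurable]: "f \<in> borel_measurable M" for f
      by (simp add: emeasure_distr emeasure_density)
    have "(\<integral>\<omega>\<in>?B. indicator ?E \<omega> \<partial>M) = (\<integral>\<omega>\<in>?B. real_cond_exp M ?F (indicator ?E) \<omega> \<partial>M)"
      by (rule F.real_cond_exp_intA[OF _ BF]) (rule integrable_real_indicator[OF E], simp add: less_top[symmetric])
    also have "\<dots> = (\<integral>\<omega>\<in>?B. ?p \<omega> \<partial>M)"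
      unfolding set_lebesgue_integral_def using ce
      by (intro integral_cong_AE) (auto elim!: eventually_mono)
    finally have r: "(\<integral>\<omega>\<in>?B. indicator ?E \<omega> \<partial>M) = (\<integral>\<omega>\<in>?B. ?p \<omega> \<partial>M)" .
    have "(\<integral>\<^sup>+\<omega>. indicator ?E \<omega> * indicator ?B \<omega> \<partial>M) = ennreal (\<integral>\<omega>\<in>?B. indicator ?E \<omega> \<partial>M)"
    proof -
      have "(\<integral>\<^sup>+\<omega>. indicator ?E \<omega> * indicator ?B \<omega> \<partial>M) = emeasure M (?E \<inter> ?B)"
        by (subst nn_integral_indicator[OF sets.Int[OF E BM], symmetric])
           (intro nn_integral_cong, simp add: indicator_def)
      also have "\<dots> = ennreal (\<integral>\<omega>\<in>?B. indicator ?E \<omega> \<partial>M)"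
        using sets.Int[OF BM E]
        by (simp add: set_lebesgue_integral_def emeasure_eq_measure indicator_inter_arith[symmetric] Int_ac)
      finally show ?thesis .
    qed
    also have "\<dots> = (\<integral>\<^sup>+\<omega>. ennreal (?p \<omega>) * indicator ?B \<omega> \<partial>M)"
    proof -
      have "(\<integral>\<^sup>+\<omega>. ennreal (?p \<omega>) * indicator ?B \<omega> \<partial>M) = (\<integral>\<^sup>+\<omega>. ennreal (indicator ?B \<omega> * ?p \<omega>) \<partial>M)"
        by (intro nn_integral_cong) (auto simp: indicator_def)
      also have "\<dots> = ennreal (\<integral>\<omega>. indicator ?B \<omega> * ?p \<omega> \<partial>M)"
        using ppos intp by (intro nn_integral_eq_integral)
          (auto intro!: integrable_real_mult_indicator simp: mult.commute[of "indicator _ _"] elim!: eventually_mono)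
      finally show ?thesis using r by (simp add: set_lebesgue_integral_def)
    qed
    also have "(\<integral>\<^sup>+\<omega>. indicator ?E \<omega> * indicator ?B \<omega> \<partial>M) =
        emeasure (distr (density M (indicator ?E)) seq_space V) B"
      using E by (subst em) (rule borel_measurable_indicator, assumption, rule refl)
    also have "(\<integral>\<^sup>+\<omega>. ennreal (?p \<omega>) * indicator ?B \<omega> \<partial>M) =
        emeasure (distr (density M (\<lambda>\<omega>. ennreal (?p \<omega>))) seq_space V) B"
      by (rule em[symmetric]) measurable
    finally show "emeasure (distr (density M (indicator ?E)) seq_space V) B =
        emeasure (distr (density M (\<lambda>\<omega>. ennreal (?p \<omega>))) seq_space V) B" .
  qed simp
  have "(\<integral>\<^sup>+\<omega>. u (V \<omega>) * indicator ?E \<omega> \<partial>M) = integral\<^sup>N (distr (density M (indicator ?E)) seq_space V) u"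
    by (subst nn_integral_distr; (subst nn_integral_density)?; (simp add: mult.commute del: One_nat_def)?)
  also have "\<dots> = (\<integral>\<^sup>+\<omega>. u (V \<omega>) * ennreal (?p \<omega>) \<partial>M)"
    unfolding eq by (subst nn_integral_distr; (subst nn_integral_density)?; simp add: mult.commute)
  also have "\<dots> = (\<integral>\<^sup>+\<omega>. u (V \<omega>) * (\<Prod>m\<in>{1..n}. ennreal (V \<omega> (i m))) \<partial>M)"
    using ppos AE_V
  proof (intro nn_integral_cong_AE, eventually_elim)
    case (elim \<omega>)
    then show ?case by (simp add: prod_ennreal P_inf_def del: One_nat_def)
  qed
  finally show ?thesis .
qed

lemma sets_sample_partition_eq[measurable]: "partition_event P \<in> sets M"
proof -
  have c: "{\<omega> \<in> space M. {m' \<in> {1..n}. I m' \<omega> = I m \<omega>} = A} \<in> sets M" if m: "m \<in> {1..n}" for A m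
  proof (cases "A \<subseteq> {1..n}")
    case True
    have "{\<omega> \<in> space M. {m' \<in> {1..n}. I m' \<omega> = I m \<omega>} = A} =
        {\<omega> \<in> space M. \<forall>m'\<in>{1..n}. m' \<in> A \<longleftrightarrow> I m' \<omega> = I m \<omega>}"
      using True by auto
    also have "\<dots> \<in> sets M"
    proof (rule sets.sets_Collect_finite_All)
      fix m' assume m': "m' \<in> {1..n}"
      have [measurable]: "I m \<in> measurable M (count_space UNIV)" "I m' \<in> measurable M (count_space UNIV)"
        using measurable_I m m' by auto
      have "{\<omega> \<in> space M. real (I m' \<omega>) = real (I m \<omega>)} \<in> sets M" by measurable
      then have "{\<omega> \<in> space M. I m' \<omega> = I m \<omega>} \<in> sets M" by simp
      then show "{\<omega> \<in> space M. (m' \<in> A) = (I m' \<omega> = I m \<omega>)} \<in> sets M"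
        by (cases "m' \<in> A") (auto intro: sets.sets_Collect_neg)
    qed simp
    finally show ?thesis .
  next
    case False
    then have "{\<omega> \<in> space M. {m' \<in> {1..n}. I m' \<omega> = I m \<omega>} = A} = {}" by auto
    then show ?thesis by (simp only: sets.empty_sets)
  qed
  show ?thesis
  proof (cases "P \<subseteq> Pow {1..n}")
    case True
    then have fin: "finite P" by (rule finite_subset) auto
    show ?thesis
      unfolding sample_partition_eq by (rule sets_Collect_image_eq[OF finite_atLeastAtMost fin c])
  next
    case False
    then have "partition_event P = {}"
      using sample_partition_subset by (metis (mono_tags, lifting) Collect_empty_eq)
    then show ?thesis by (simp only: sets.empty_sets)
  qed
qed

lemma measurable_sample_partition[measurable]: "sample_partition n I \<in> measurable M (count_space UNIV)"
proof (rule measurableI)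
  fix A :: "nat set set set"
  define Q where "Q = Pow (Pow {1..n})"
  have fin: "finite (A \<inter> Q)" unfolding Q_def by (intro finite_Int disjI2) simp
  have Q: "sample_partition n I \<omega> \<in> Q" for \<omega>
    unfolding Q_def using sample_partition_subset by (rule PowI)
  have "sample_partition n I -` A \<inter> space M =
      (\<Union>P\<in>A \<inter> Q. partition_event P)"
    using Q by blast
  also have "\<dots> \<in> sets M" by (rule sets.finite_UN[OF fin sets_sample_partition_eq])
  finally show "sample_partition n I -` A \<inter> space M \<in> sets M" .
qed simp

lemma measurable_num_blocks[measurable]: "num_blocks n I \<in> measurable M (count_space UNIV)"
  unfolding num_blocks_def[abs_def] by (rule measurable_compose[OF measurable_sample_partition, of card]) simp

text \<open>The partition event is the disjoint union, over injective labellings of the blocks by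
  indices, of the events handled by \<open>nn_integral_event\<close>. Within a labelling the product
  over sample points collects into powers, one for each block.\<close>

lemma nn_integral_sample_partition:
  assumes As: "distinct As" "partition_on {1..n} (set As)"
    and u[measurable]: "u \<in> borel_measurable seq_space"
  shows "(\<integral>\<^sup>+\<omega>. u (V \<omega>) * indicator (partition_event (set As)) \<omega> \<partial>M) =
    (\<integral>\<^sup>+\<omega>. u (V \<omega>) * distinct_sum (\<lambda>i. ennreal (V \<omega> i)) (map card As) \<partial>M)"
proof -
  define k where "k = length As"
  define X where "X = {xs::nat list. length xs = k \<and> distinct xs}"
  \<comment> \<open>The position of the block that contains m; disjointness makes it unique.\<close>
  define b where "b m = (THE j. j < k \<and> m \<in> As ! j)" for m
  have disj: "i = j" if "i < k" "j < k" "m \<in> As ! i" "m \<in> As ! j" for i j m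
  proof -
    have "As ! i = As ! j"
      using partition_onD2[OF As(2)] that unfolding disjoint_def k_def by (metis IntI empty_iff nth_mem)
    then show ?thesis using As(1) that by (simp add: k_def nth_eq_iff_index_eq)
  qed
  have b: "b m = j" if "j < k" "m \<in> As ! j" for j m
    unfolding b_def using that disj by (intro the_equality) auto
  have ex: "\<exists>j<k. m \<in> As ! j" if "m \<in> {1..n}" for m
    using partition_onD1[OF As(2)] that unfolding k_def by (metis UnionE in_set_conv_nth)
  have sub: "As ! j \<subseteq> {1..n}" "As ! j \<noteq> {}" "finite (As ! j)" if "j < k" for j
  proof -
    have "As ! j \<in> set As" using that by (simp add: k_def)
    then show "As ! j \<subseteq> {1..n}" "As ! j \<noteq> {}"
      using partition_onD1[OF As(2)] partition_onD3[OF As(2)] by auto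
    then show "finite (As ! j)" by (auto intro: finite_subset)
  qed
  let ?E = "\<lambda>xs. {\<omega> \<in> space M. \<forall>m\<in>{1..n}. I m \<omega> = xs ! b m}"
  have blk: "(\<forall>m\<in>{1..n}. I m \<omega> = xs ! b m) \<longleftrightarrow> (\<forall>j<k. \<forall>m\<in>As ! j. I m \<omega> = xs ! j)" for xs \<omega>
  proof (intro iffI ballI allI impI)
    fix j m assume "\<forall>m\<in>{1..n}. I m \<omega> = xs ! b m" "j < k" "m \<in> As ! j"
    then show "I m \<omega> = xs ! j" using subsetD[OF sub(1)] b by simp
  next
    fix m assume *: "\<forall>j<k. \<forall>m\<in>As ! j. I m \<omega> = xs ! j" and m: "m \<in> {1..n}"
    obtain j where "j < k" "m \<in> As ! j" using ex[OF m] by blast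
    then show "I m \<omega> = xs ! b m" using * b by simp
  qed
  \<comment> \<open>When the sampled partition is the given one, exactly one injective labelling is
    compatible with the indices; otherwise none is, so the count of compatible labellings is the
    indicator.\<close>
  have ind: "indicator (partition_event (set As)) \<omega> =
      (\<integral>\<^sup>+xs. indicator (?E xs) \<omega> \<partial>count_space X)" (is "_ = ?rhs") if sp: "\<omega> \<in> space M" for \<omega>
  proof (cases "sample_partition n I \<omega> = set As")
    case True
    have "\<exists>v. \<forall>m\<in>{1..n}. I m \<omega> = v \<longleftrightarrow> m \<in> As ! j" if "j < k" for j
    proof -
      have "As ! j \<in> sample_partition n I \<omega>" using that True by (simp add: k_def)
      then show ?thesis unfolding sample_partition_eq by blast
    qed
    then obtain v where v: "\<And>j m. j < k \<Longrightarrow> m \<in> {1..n} \<Longrightarrow> I m \<omega> = v j \<longleftrightarrow> m \<in> As ! j" by metis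
    define xs where "xs = map v [0..<k]"
    have nth: "xs ! j = v j" if "j < k" for j using that by (simp add: xs_def)
    have "inj_on v {..<k}"
    proof (rule inj_onI)
      fix i j assume ij: "i \<in> {..<k}" "j \<in> {..<k}" "v i = v j"
      obtain m where m: "m \<in> As ! i" using sub(2)[of i] ij by blast
      then have "m \<in> As ! j" using v[of i m] v[of j m] sub(1)[of i] ij by auto
      then show "i = j" using disj m ij by auto
    qed
    then have xsX: "xs \<in> X" by (auto simp: X_def xs_def distinct_map lessThan_atLeast0)
    have E: "\<omega> \<in> ?E ys \<longleftrightarrow> ys = xs" if "ys \<in> X" for ys
    proof
      assume "\<omega> \<in> ?E ys"
      then have *: "\<And>j m. j < k \<Longrightarrow> m \<in> As ! j \<Longrightarrow> I m \<omega> = ys ! j" unfolding mem_Collect_eq blk by auto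
      have "ys ! j = xs ! j" if "j < k" for j
        using sub[OF that] *[OF that] v[OF that] nth[OF that] by (metis all_not_in_conv subsetD)
      then show "ys = xs" using that by (intro nth_equalityI) (auto simp: X_def xs_def)
    next
      assume "ys = xs"
      then show "\<omega> \<in> ?E ys" unfolding mem_Collect_eq blk using sp v sub(1) nth by (auto simp: subset_iff)
    qed
    have "?rhs = (\<Sum>ys\<in>{xs}. indicator (?E ys) \<omega>)"
      using xsX E by (intro nn_integral_count_space') (auto simp: indicator_def)
    then show ?thesis using E[OF xsX] True sp by (simp add: indicator_def)
  next
    case False
    have "\<omega> \<notin> ?E xs" if xs: "xs \<in> X" for xs
    proof
      assume "\<omega> \<in> ?E xs"
      then have *: "\<And>j m. j < k \<Longrightarrow> m \<in> As ! j \<Longrightarrow> I m \<omega> = xs ! j" unfolding mem_Collect_eq blk by auto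
      have cl: "{m' \<in> {1..n}. I m' \<omega> = I m \<omega>} = As ! j" if jm: "j < k" "m \<in> As ! j" for j m
      proof (intro equalityI subsetI)
        fix m' assume m': "m' \<in> {m' \<in> {1..n}. I m' \<omega> = I m \<omega>}"
        then obtain j' where j': "j' < k" "m' \<in> As ! j'" using ex[of m'] by auto
        then have "xs ! j' = xs ! j" using * m' jm by auto
        then have "j' = j" using xs j' jm by (auto simp: X_def nth_eq_iff_index_eq)
        then show "m' \<in> As ! j" using j' by simp
      next
        fix m' assume "m' \<in> As ! j"
        then show "m' \<in> {m' \<in> {1..n}. I m' \<omega> = I m \<omega>}"
          using *[OF jm] *[OF jm(1)] subsetD[OF sub(1)[OF jm(1)]] by auto
      qed
      have "sample_partition n I \<omega> = set As"
      proof (intro equalityI subsetI)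
        fix A assume "A \<in> sample_partition n I \<omega>"
        then obtain m where m: "m \<in> {1..n}" "A = {m' \<in> {1..n}. I m' \<omega> = I m \<omega>}"
          unfolding sample_partition_eq by blast
        then show "A \<in> set As" using ex[OF m(1)] cl by (auto simp: k_def)
      next
        fix A assume "A \<in> set As"
        then obtain j where j: "j < k" "A = As ! j" by (auto simp: k_def in_set_conv_nth)
        obtain m where m: "m \<in> As ! j" using sub(2)[OF j(1)] by blast
        show "A \<in> sample_partition n I \<omega>"
          unfolding sample_partition_eq using cl[OF j(1) m] j(2) m sub(1)[OF j(1)] by blast
      qed
      then show False using False by simp
    qed
    then show ?thesis using False by (auto simp: nn_integral_0_iff_AE AE_count_space indicator_def)
  qed
  have cX: "countable X" by (rule countable_subset[OF subset_UNIV]) simp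
  have prods: "(\<Prod>m\<in>{1..n}. p (xs ! b m)) = (\<Prod>j<length (map card As). p (xs ! j) ^ (map card As ! j))"
    for p :: "nat \<Rightarrow> ennreal" and xs
  proof -
    have "{1..n} = (\<Union>j\<in>{..<k}. As ! j)" using ex sub by blast
    then have "(\<Prod>m\<in>{1..n}. p (xs ! b m)) = (\<Prod>j<k. \<Prod>m\<in>As ! j. p (xs ! b m))"
      using sub disj by (simp only:) (subst prod.UNION_disjoint; blast)
    also have "\<dots> = (\<Prod>j<k. \<Prod>m\<in>As ! j. p (xs ! j))" using b by (intro prod.cong) auto
    finally show ?thesis by (simp add: k_def)
  qed
  have "(\<integral>\<^sup>+\<omega>. u (V \<omega>) * indicator (partition_event (set As)) \<omega> \<partial>M) =
      (\<integral>\<^sup>+\<omega>. \<integral>\<^sup>+xs. u (V \<omega>) * indicator (?E xs) \<omega> \<partial>count_space X \<partial>M)"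
    by (intro nn_integral_cong) (simp add: ind nn_integral_cmult)
  also have "\<dots> = (\<integral>\<^sup>+xs. \<integral>\<^sup>+\<omega>. u (V \<omega>) * indicator (?E xs) \<omega> \<partial>M \<partial>count_space X)"
    using cX sets_event by (intro nn_integral_count_space_nn_integral) auto
  also have "\<dots> = (\<integral>\<^sup>+xs. \<integral>\<^sup>+\<omega>. u (V \<omega>) * (\<Prod>m\<in>{1..n}. ennreal (V \<omega> (xs ! b m))) \<partial>M \<partial>count_space X)"
    by (simp only: nn_integral_event[OF u])
  also have "\<dots> = (\<integral>\<^sup>+\<omega>. \<integral>\<^sup>+xs. u (V \<omega>) * (\<Prod>m\<in>{1..n}. ennreal (V \<omega> (xs ! b m))) \<partial>count_space X \<partial>M)"
    using cX by (intro nn_integral_count_space_nn_integral[symmetric]) auto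
  also have "\<dots> = (\<integral>\<^sup>+\<omega>. u (V \<omega>) * distinct_sum (\<lambda>i. ennreal (V \<omega> i)) (map card As) \<partial>M)"
    unfolding distinct_sum_def X_def[symmetric] k_def[symmetric] length_map
    using prods[of "\<lambda>i. ennreal (V _ i)"]
    by (intro nn_integral_cong) (simp add: nn_integral_cmult k_def[symmetric])
  finally show ?thesis .
qed

end

section \<open>The Gibbs structure of the \<open>PD(\<gamma>,0)\<close> partition\<close>

text \<open>The power is absorbed into the weight and divided out of the test function, which is
  where strict positivity enters. This is the form in which the transforms of \<open>T\<close>
  become available.\<close>

lemma nn_integral_eqI_Laplace_power:
  fixes X :: "'a \<Rightarrow> real" and Y :: "'b \<Rightarrow> real" and w :: "'a \<Rightarrow> ennreal" and v :: "'b \<Rightarrow> ennreal"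
  assumes meas[measurable]: "X \<in> borel_measurable M" "w \<in> borel_measurable M"
      "Y \<in> borel_measurable N" "v \<in> borel_measurable N" "g \<in> borel_measurable borel"
    and pos: "AE \<omega> in M. 0 < X \<omega>" "AE \<omega> in N. 0 < Y \<omega>"
    and fin: "(\<integral>\<^sup>+\<omega>. w \<omega> * ennreal (X \<omega> ^ n * exp (- X \<omega>)) \<partial>M) < \<infinity>"
    and eq: "\<And>y. 0 < y \<Longrightarrow> (\<integral>\<^sup>+\<omega>. w \<omega> * ennreal (X \<omega> ^ n * exp (- (y * X \<omega>))) \<partial>M) =
        (\<integral>\<^sup>+\<omega>. v \<omega> * ennreal (Y \<omega> ^ n * exp (- (y * Y \<omega>))) \<partial>N)"
  shows "(\<integral>\<^sup>+\<omega>. w \<omega> * g (X \<omega>) \<partial>M) = (\<integral>\<^sup>+\<omega>. v \<omega> * g (Y \<omega>) \<partial>N)"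
proof -
  have split: "(w' * ennreal (x ^ n)) * ennreal (exp z) = w' * ennreal (x ^ n * exp z)" for w' and x z :: real
    by (simp add: ennreal_mult'' mult.assoc)
  have cancel: "(w' * ennreal (x ^ n)) * (ennreal (1 / x ^ n) * z) = w' * z" if "0 < x" for w' z and x :: real
  proof -
    have "ennreal (x ^ n) * ennreal (1 / x ^ n) = 1" using that by (simp flip: ennreal_mult)
    then show ?thesis by (metis mult.assoc mult_1)
  qed
  have "(\<integral>\<^sup>+\<omega>. w \<omega> * g (X \<omega>) \<partial>M) = (\<integral>\<^sup>+\<omega>. (w \<omega> * ennreal (X \<omega> ^ n)) * (ennreal (1 / X \<omega> ^ n) * g (X \<omega>)) \<partial>M)"
    using pos(1) by (intro nn_integral_cong_AE) (auto elim!: eventually_mono simp: cancel)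
  also have "\<dots> = (\<integral>\<^sup>+\<omega>. (v \<omega> * ennreal (Y \<omega> ^ n)) * (ennreal (1 / Y \<omega> ^ n) * g (Y \<omega>)) \<partial>N)"
  proof (rule nn_integral_eqI_Laplace[where g="\<lambda>t. ennreal (1 / t ^ n) * g t"])
    show "AE \<omega> in M. 0 \<le> X \<omega>" "AE \<omega> in N. 0 \<le> Y \<omega>"
      using pos by (auto elim!: eventually_mono)
    show "(\<integral>\<^sup>+\<omega>. (w \<omega> * ennreal (X \<omega> ^ n)) * ennreal (exp (- X \<omega>)) \<partial>M) < \<infinity>"
      unfolding split by (rule fin)
    show "(\<integral>\<^sup>+\<omega>. (w \<omega> * ennreal (X \<omega> ^ n)) * ennreal (exp (- (y * X \<omega>))) \<partial>M) =
        (\<integral>\<^sup>+\<omega>. (v \<omega> * ennreal (Y \<omega> ^ n)) * ennreal (exp (- (y * Y \<omega>))) \<partial>N)" if "0 < y" for y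
      unfolding split by (rule eq[OF that])
  qed measurable
  also have "\<dots> = (\<integral>\<^sup>+\<omega>. v \<omega> * g (Y \<omega>) \<partial>N)"
    using pos(2) by (intro nn_integral_cong_AE) (auto elim!: eventually_mono simp: cancel)
  finally show ?thesis .
qed

lemma Gamma_nat_pos: "1 \<le> k \<Longrightarrow> 0 < Gamma (real k)"
  by (intro Gamma_real_pos) simp

lemma partition_on_list:
  assumes As: "distinct As" "partition_on {1..n::nat} (set As)"
  shows "sum_list (map card As) = n" and "\<And>m. m \<in> set (map card As) \<Longrightarrow> 1 \<le> m"
    and "length As \<le> n" and "1 \<le> n \<Longrightarrow> 1 \<le> length As"
proof -
  have fin: "finite A" "A \<noteq> {}" if "A \<in> set As" for A
  proof -
    have "A \<subseteq> {1..n}" using partition_onD1[OF As(2)] that by blast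
    then show "finite A" by (rule finite_subset) simp
    show "A \<noteq> {}" using partition_onD3[OF As(2)] that by auto
  qed
  have "sum_list (map card As) = sum card (set As)"
    using As(1) by (simp add: sum_list_distinct_conv_sum_set)
  also have "\<dots> = card (\<Union>(set As))"
    using partition_onD2[OF As(2)] fin by (intro card_Union_disjoint[symmetric]) (auto simp: disjoint_def pairwise_def disjnt_def)
  also have "\<Union>(set As) = {1..n}" using partition_onD1[OF As(2)] by (rule sym)
  finally have "sum_list (map card As) = card {1..n}" .
  then have "sum_list (map card As) = n" by simp
  then show sum: "sum_list (map card As) = n" .
  show 1: "1 \<le> m" if m: "m \<in> set (map card As)" for m
  proof -
    obtain A where A: "A \<in> set As" "m = card A" using m by auto
    then show ?thesis using fin[OF A(1)] by (simp add: Suc_le_eq card_gt_0_iff)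
  qed
  have "sum_list (map (\<lambda>_. 1) As) \<le> sum_list (map card As)"
    using 1 by (intro sum_list_mono) auto
  then show "length As \<le> n" unfolding sum by (simp add: sum_list_triv)
  show "1 \<le> length As" if "1 \<le> n"
    using sum that by (cases As) auto
qed

text \<open>A witness, k - 1 singletons and one remaining block, that lets conditioning on k blocks
  be done on an event of positive probability.\<close>

lemma exists_partition_list:
  assumes "1 \<le> k" "k \<le> (n::nat)"
  shows "\<exists>As. distinct As \<and> partition_on {1..n} (set As) \<and> length As = k"
proof -
  define As where "As = map (\<lambda>i. {i}) [1..<k] @ [{k..n}]"
  have set: "set As = (\<lambda>i. {i}) ` {1..<k} \<union> {{k..n}}" by (simp add: As_def)
  have "distinct As" unfolding As_def using assms
    by (auto simp: distinct_map inj_on_def set_eq_iff) (metis assms(2) atLeastAtMost_iff order_refl not_less singletonD)+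
  moreover have "partition_on {1..n} (set As)"
    unfolding partition_on_def disjoint_def set using assms by auto
  moreover have "length As = k" using assms by (simp add: As_def)
  ultimately show ?thesis by blast
qed

locale pd = stable_pd \<gamma> M J + iid_sampling M "pd_seq J" n I
  for \<gamma> :: real and M :: "'w measure" and J :: "nat \<Rightarrow> 'w \<Rightarrow> real" and n :: nat and I :: "nat \<Rightarrow> 'w \<Rightarrow> nat" +
  assumes n: "1 \<le> n"
begin

lemma sets_num_blocks[measurable]: "blocks_event k \<in> sets M"
  by measurable

lemma AE_T_pos: "AE \<omega> in M. 0 < T \<omega>"
  using AE_sums by eventually_elim auto

text \<open>Writing \<open>T\<close> as a function of the normalized sequence makes it an admissible
  \<open>u\<close> in \<open>nn_integral_sample_partition\<close>.\<close>

lemma nn_integral_T_sample_partition: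
  assumes As: "distinct As" "partition_on {1..n} (set As)" and g[measurable]: "g \<in> borel_measurable borel"
  shows "(\<integral>\<^sup>+\<omega>. g (T \<omega>) * indicator (partition_event (set As)) \<omega> \<partial>M) =
    (\<integral>\<^sup>+\<omega>. g (T \<omega>) * distinct_sum (\<lambda>i. ennreal (pd_seq J \<omega> i)) (map card As) \<partial>M)"
proof -
  obtain \<tau> where [measurable]: "\<tau> \<in> borel_measurable seq_space" and \<tau>: "AE \<omega> in M. T \<omega> = \<tau> (pd_seq J \<omega>)"
    by (rule T_eq_function_of_pd_seq)
  have "(\<integral>\<^sup>+\<omega>. g (T \<omega>) * indicator (partition_event (set As)) \<omega> \<partial>M) =
    (\<integral>\<^sup>+\<omega>. g (\<tau> (pd_seq J \<omega>)) * indicator (partition_event (set As)) \<omega> \<partial>M)"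
    using \<tau> by (intro nn_integral_cong_AE) (auto elim!: eventually_mono)
  also have "\<dots> = (\<integral>\<^sup>+\<omega>. g (\<tau> (pd_seq J \<omega>)) * distinct_sum (\<lambda>i. ennreal (pd_seq J \<omega> i)) (map card As) \<partial>M)"
    by (rule nn_integral_sample_partition[OF As, where u="\<lambda>p. g (\<tau> p)"]) measurable
  also have "\<dots> = (\<integral>\<^sup>+\<omega>. g (T \<omega>) * distinct_sum (\<lambda>i. ennreal (pd_seq J \<omega> i)) (map card As) \<partial>M)"
    using \<tau> by (intro nn_integral_cong_AE) (auto elim!: eventually_mono)
  finally show ?thesis .
qed

definition weight :: "nat list \<Rightarrow> real" where
  "weight ns = \<gamma> ^ length ns * (\<Prod>j<length ns. pochhammer (1 - \<gamma>) (ns ! j - 1))"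

lemma weight_pos: "0 < weight ns"
  unfolding weight_def using \<gamma> by (intro mult_pos_pos prod_pos pochhammer_pos) auto

text \<open>By \<open>distinct_sum_cmult\<close> the factor \<open>T ^ n\<close> exactly undoes the
  normalization, since the block sizes add up to n. What remains is the moment formula for the raw
  points.\<close>

lemma Laplace_sample_partition:
  assumes As: "distinct As" "partition_on {1..n} (set As)" and y: "0 < y"
  shows "(\<integral>\<^sup>+\<omega>. ennreal (T \<omega> ^ n * exp (- (y * T \<omega>))) * indicator (partition_event (set As)) \<omega> \<partial>M) =
    ennreal (weight (map card As) * (y powr (real (length As) * \<gamma> - real n) * exp (- (y powr \<gamma>))))"
proof -
  let ?ns = "map card As"
  have "(\<integral>\<^sup>+\<omega>. ennreal (T \<omega> ^ n * exp (- (y * T \<omega>))) * indicator (partition_event (set As)) \<omega> \<partial>M) =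
     (\<integral>\<^sup>+\<omega>. ennreal (T \<omega> ^ n * exp (- (y * T \<omega>))) * distinct_sum (\<lambda>i. ennreal (pd_seq J \<omega> i)) ?ns \<partial>M)"
    by (rule nn_integral_T_sample_partition[OF As]) measurable
  also have "\<dots> = (\<integral>\<^sup>+\<omega>. distinct_sum (\<lambda>i. ennreal (J i \<omega>)) ?ns * ennreal (nexp (\<Sum>i. ennreal (y * J i \<omega>))) \<partial>M)"
  proof (rule nn_integral_cong_AE)
    show "AE \<omega> in M. ennreal (T \<omega> ^ n * exp (- (y * T \<omega>))) * distinct_sum (\<lambda>i. ennreal (pd_seq J \<omega> i)) ?ns =
        distinct_sum (\<lambda>i. ennreal (J i \<omega>)) ?ns * ennreal (nexp (\<Sum>i. ennreal (y * J i \<omega>)))"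
      using AE_sums AE_suminf
    proof eventually_elim
      case (elim \<omega>)
      have J: "ennreal (J i \<omega>) = ennreal (T \<omega>) * ennreal (pd_seq J \<omega> i)" for i
        using elim(1) by (simp add: pd_seq_def less_imp_le flip: ennreal_mult')
      have "distinct_sum (\<lambda>i. ennreal (J i \<omega>)) ?ns = ennreal (T \<omega> ^ n) * distinct_sum (\<lambda>i. ennreal (pd_seq J \<omega> i)) ?ns"
        unfolding J distinct_sum_cmult partition_on_list(1)[OF As] using elim(1) by (simp add: ennreal_power)
      moreover have "nexp (\<Sum>i. ennreal (y * J i \<omega>)) = exp (- (y * T \<omega>))"
        using elim y by simp
      ultimately show ?case by (simp add: ennreal_mult'' mult_ac)
    qed
  qed
  also have "\<dots> = ennreal (weight ?ns * (y powr (real (length As) * \<gamma> - real n) * exp (- (y powr \<gamma>))))"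
    using partition_on_list[OF As] by (subst moment_formula_exp[OF y]) (auto simp: weight_def mult.assoc)
  finally show ?thesis .
qed

text \<open>As Gamma(n) is T^n times the integral of y^(n-1) exp(-yT), integrating the Laplace
  formula against y^(n-1) removes \<open>T\<close> altogether.\<close>

lemma emeasure_sample_partition:
  assumes As: "distinct As" "partition_on {1..n} (set As)"
  shows "emeasure M (partition_event (set As)) =
    ennreal (weight (map card As) * Gamma (real (length As)) / (\<gamma> * Gamma (real n)))"
proof -
  let ?E = "partition_event (set As)" and ?k = "length As" and ?q = "weight (map card As)"
  have k: "1 \<le> ?k" using partition_on_list(4)[OF As n] .
  have G: "Gamma (real n) > 0" "Gamma (real ?k) > 0" using Gamma_nat_pos[OF n] Gamma_nat_pos[OF k] by auto
  interpret P: pair_sigma_finite M lborel ..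
  let ?f = "\<lambda>\<omega> y. ennreal (y powr (real n - 1)) * indicator {0<..} y *
      (ennreal (T \<omega> ^ n * exp (- (y * T \<omega>))) * indicator ?E \<omega>)"
  have "ennreal (Gamma (real n)) * emeasure M ?E = (\<integral>\<^sup>+\<omega>. ennreal (Gamma (real n)) * indicator ?E \<omega> \<partial>M)"
    by (simp add: nn_integral_cmult)
  also have "\<dots> = (\<integral>\<^sup>+\<omega>. (\<integral>\<^sup>+y. ?f \<omega> y \<partial>lborel) \<partial>M)"
  proof (rule nn_integral_cong_AE)
    show "AE \<omega> in M. ennreal (Gamma (real n)) * indicator ?E \<omega> = (\<integral>\<^sup>+y. ?f \<omega> y \<partial>lborel)"
      using AE_T_pos
    proof eventually_elim
      case (elim \<omega>)
      have "(\<integral>\<^sup>+y. ?f \<omega> y \<partial>lborel) = (\<integral>\<^sup>+y. (ennreal (T \<omega> ^ n) * indicator ?E \<omega>) *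
          (ennreal (y powr (real n - 1) * exp (- (T \<omega> * y))) * indicator {0<..} y) \<partial>lborel)"
        using elim by (intro nn_integral_cong) (simp add: ennreal_mult'' mult_ac)
      also have "\<dots> = (ennreal (T \<omega> ^ n) * indicator ?E \<omega>) * ennreal (Gamma (real n) * T \<omega> powr (- real n))"
        using n elim by (subst nn_integral_cmult; (subst nn_integral_Gamma_scaled)?; simp)
      also have "\<dots> = ennreal (T \<omega> ^ n * (Gamma (real n) * T \<omega> powr (- real n))) * indicator ?E \<omega>"
      proof -
        have nn: "0 \<le> T \<omega> ^ n" using elim by simp
        show ?thesis by (simp only: ennreal_mult'[OF nn]) (simp only: mult_ac)
      qed
      also have "T \<omega> ^ n * (Gamma (real n) * T \<omega> powr (- real n)) = Gamma (real n)"
        using elim by (simp add: powr_minus powr_realpow field_simps)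
      finally show ?case ..
    qed
  qed
  also have "\<dots> = (\<integral>\<^sup>+y. (\<integral>\<^sup>+\<omega>. ?f \<omega> y \<partial>M) \<partial>lborel)"
    by (rule P.Fubini'[symmetric]) measurable
  also have "\<dots> = (\<integral>\<^sup>+y. ennreal ?q * (ennreal (y powr (real ?k * \<gamma> - 1) * exp (- (y powr \<gamma>))) * indicator {0<..} y) \<partial>lborel)"
  proof (rule nn_integral_cong)
    fix y :: real
    show "(\<integral>\<^sup>+\<omega>. ?f \<omega> y \<partial>M) = ennreal ?q * (ennreal (y powr (real ?k * \<gamma> - 1) * exp (- (y powr \<gamma>))) * indicator {0<..} y)"
    proof (cases "y > 0")
      case True
      have "(\<integral>\<^sup>+\<omega>. ?f \<omega> y \<partial>M) = ennreal (y powr (real n - 1)) *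
          (\<integral>\<^sup>+\<omega>. ennreal (T \<omega> ^ n * exp (- (y * T \<omega>))) * indicator ?E \<omega> \<partial>M)"
        using True by (simp add: nn_integral_cmult)
      also have "\<dots> = ennreal (y powr (real n - 1) * (?q * (y powr (real ?k * \<gamma> - real n) * exp (- (y powr \<gamma>)))))"
        by (subst Laplace_sample_partition[OF As True]) (simp add: ennreal_mult')
      also have "y powr (real n - 1) * (?q * (y powr (real ?k * \<gamma> - real n) * exp (- (y powr \<gamma>)))) =
          ?q * ((y powr (real n - 1) * y powr (real ?k * \<gamma> - real n)) * exp (- (y powr \<gamma>)))"
        by (simp only: mult_ac)
      also have "y powr (real n - 1) * y powr (real ?k * \<gamma> - real n) = y powr (real ?k * \<gamma> - 1)"
        by (simp flip: powr_add)
      finally show ?thesis using True weight_pos[of "map card As"] by (simp add: ennreal_mult')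
    qed simp
  qed
  also have "\<dots> = ennreal ?q * ennreal (Gamma (real ?k) / \<gamma>)"
    using nn_integral_stable_Gamma[OF \<gamma>(1) k] by (subst nn_integral_cmult) auto
  also have "\<dots> = ennreal (Gamma (real n)) * ennreal (?q * Gamma (real ?k) / (\<gamma> * Gamma (real n)))"
    using G \<gamma> weight_pos[of "map card As"] by (simp add: ennreal_mult'[symmetric])
  finally show ?thesis using G by (simp add: ennreal_mult_cancel_left)
qed

lemma emeasure_sample_partition_pd_eppf:
  assumes As: "distinct As" "partition_on {1..n} (set As)"
  shows "emeasure M (partition_event (set As)) = ennreal (pd_eppf \<gamma> (map card As))"
proof -
  have k: "1 \<le> length As" using partition_on_list(4)[OF As n] .
  have "\<gamma> ^ length As = \<gamma> * \<gamma> ^ (length As - 1)" using k by (cases "length As") auto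
  then show ?thesis
    unfolding emeasure_sample_partition[OF As] weight_def pd_eppf_def partition_on_list(1)[OF As]
    using \<gamma> by (simp add: mult_ac)
qed

text \<open>Expressed through the probability of the partition, the constant \<open>weight\<close>
  disappears, and the remaining factor depends on the partition only through its number of blocks.
  Summation over partitions with k blocks therefore keeps it.\<close>

lemma Laplace_sample_partition':
  assumes As: "distinct As" "partition_on {1..n} (set As)" and y: "0 < y"
  shows "(\<integral>\<^sup>+\<omega>. ennreal (T \<omega> ^ n * exp (- (y * T \<omega>))) * indicator (partition_event (set As)) \<omega> \<partial>M) =
    emeasure M (partition_event (set As)) *
    ennreal (\<gamma> * Gamma (real n) / Gamma (real (length As)) * (y powr (real (length As) * \<gamma> - real n) * exp (- (y powr \<gamma>))))"
proof -
  have k: "1 \<le> length As" using partition_on_list(4)[OF As n] .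
  have G: "Gamma (real n) > 0" "Gamma (real (length As)) > 0" using Gamma_nat_pos[OF n] Gamma_nat_pos[OF k] by auto
  show ?thesis
    unfolding Laplace_sample_partition[OF assms] emeasure_sample_partition[OF As]
    using G \<gamma> weight_pos[of "map card As"] by (subst ennreal_mult'[symmetric]) auto
qed

lemma num_blocks_decomp:
  assumes [measurable]: "f \<in> borel_measurable M"
  shows "(\<integral>\<^sup>+\<omega>. f \<omega> * indicator (blocks_event k) \<omega> \<partial>M) =
    (\<Sum>P | partition_on {1..n} P \<and> card P = k.
      \<integral>\<^sup>+\<omega>. f \<omega> * indicator (partition_event P) \<omega> \<partial>M)"
proof -
  let ?Q = "{P. partition_on {1..n} P \<and> card P = k}"
  have fin: "finite ?Q"
    by (rule finite_subset[of _ "Pow (Pow {1..n})"]) (auto simp: partition_on_def)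
  have "indicator (blocks_event k) \<omega> =
      (\<Sum>P\<in>?Q. indicator (partition_event P) \<omega> :: ennreal)" if "\<omega> \<in> space M" for \<omega>
  proof (cases "num_blocks n I \<omega> = k")
    case True
    then have "sample_partition n I \<omega> \<in> ?Q"
      using partition_on_sample_partition[of n I \<omega>] by (simp add: num_blocks_def)
    then have "(\<Sum>P\<in>?Q. indicator (partition_event P) \<omega> :: ennreal) =
       (\<Sum>P\<in>{sample_partition n I \<omega>}. indicator (partition_event P) \<omega>)"
      using fin by (intro sum.mono_neutral_right) (auto simp: indicator_def)
    then show ?thesis using True that by simp
  next
    case False
    then have "(\<Sum>P\<in>?Q. indicator (partition_event P) \<omega> :: ennreal) = 0"
      by (intro sum.neutral) (auto simp: num_blocks_def indicator_eq_0_iff)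
    then show ?thesis using False by simp
  qed
  then have "(\<integral>\<^sup>+\<omega>. f \<omega> * indicator (blocks_event k) \<omega> \<partial>M) =
     (\<integral>\<^sup>+\<omega>. (\<Sum>P\<in>?Q. f \<omega> * indicator (partition_event P) \<omega>) \<partial>M)"
    by (intro nn_integral_cong) (simp add: sum_distrib_left)
  also have "\<dots> = (\<Sum>P\<in>?Q. \<integral>\<^sup>+\<omega>. f \<omega> * indicator (partition_event P) \<omega> \<partial>M)"
    by (rule nn_integral_sum) measurable
  finally show ?thesis .
qed

lemma Laplace_num_blocks:
  assumes y: "0 < y"
  shows "(\<integral>\<^sup>+\<omega>. ennreal (T \<omega> ^ n * exp (- (y * T \<omega>))) * indicator (blocks_event k) \<omega> \<partial>M) =
    emeasure M (blocks_event k) *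
    ennreal (\<gamma> * Gamma (real n) / Gamma (real k) * (y powr (real k * \<gamma> - real n) * exp (- (y powr \<gamma>))))"
proof -
  let ?Q = "{P. partition_on {1..n} P \<and> card P = k}"
  let ?c = "ennreal (\<gamma> * Gamma (real n) / Gamma (real k) * (y powr (real k * \<gamma> - real n) * exp (- (y powr \<gamma>))))"
  have "(\<integral>\<^sup>+\<omega>. ennreal (T \<omega> ^ n * exp (- (y * T \<omega>))) * indicator (blocks_event k) \<omega> \<partial>M) =
      (\<Sum>P\<in>?Q. \<integral>\<^sup>+\<omega>. ennreal (T \<omega> ^ n * exp (- (y * T \<omega>))) * indicator (partition_event P) \<omega> \<partial>M)"
    by (rule num_blocks_decomp) measurable
  also have "\<dots> = (\<Sum>P\<in>?Q. emeasure M (partition_event P) * ?c)"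
  proof (rule sum.cong)
    fix P assume P: "P \<in> ?Q"
    then have "finite P" by (auto intro: finite_elements)
    then obtain As where As: "set As = P" "distinct As" using finite_distinct_list by blast
    then have "length As = k" using P distinct_card by fastforce
    then show "(\<integral>\<^sup>+\<omega>. ennreal (T \<omega> ^ n * exp (- (y * T \<omega>))) * indicator (partition_event P) \<omega> \<partial>M) =
        emeasure M (partition_event P) * ?c"
      using Laplace_sample_partition'[OF As(2) _ y] P As(1) by simp
  qed simp
  also have "\<dots> = (\<Sum>P\<in>?Q. emeasure M (partition_event P)) * ?c"
    by (simp add: sum_distrib_right)
  also have "(\<Sum>P\<in>?Q. emeasure M (partition_event P)) = emeasure M (blocks_event k)"
    using num_blocks_decomp[of "\<lambda>_. 1" k] by simp
  finally show ?thesis .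
qed

lemma emeasure_sample_partition_pos:
  assumes "distinct As" "partition_on {1..n} (set As)"
  shows "emeasure M (partition_event (set As)) \<noteq> 0"
proof -
  have "Gamma (real n) > 0" "Gamma (real (length As)) > 0"
    using Gamma_nat_pos[OF n] Gamma_nat_pos[OF partition_on_list(4)[OF assms n]] by auto
  then show ?thesis using \<gamma> weight_pos[of "map card As"]
    by (simp add: emeasure_sample_partition[OF assms] ennreal_eq_0_iff not_le divide_pos_pos)
qed

lemma emeasure_num_blocks_pos:
  assumes "1 \<le> k" "k \<le> n"
  shows "emeasure M (blocks_event k) \<noteq> 0"
proof -
  obtain As where As: "distinct As" "partition_on {1..n} (set As)" "length As = k"
    using exists_partition_list[OF assms] by blast
  have "partition_event (set As) \<subseteq> blocks_event k"
    using As(1,3) by (auto simp: num_blocks_def distinct_card)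
  then have "emeasure M (partition_event (set As)) \<le> emeasure M (blocks_event k)"
    by (rule emeasure_mono) measurable
  then show ?thesis using emeasure_sample_partition_pos[OF As(1,2)] by auto
qed

lemma cond_expect_num_blocks:
  assumes [measurable]: "X \<in> borel_measurable M"
  shows "cond_expect M X (\<lambda>\<omega>. num_blocks n I \<omega> = k) =
    (\<integral>\<^sup>+\<omega>. X \<omega> * indicator (blocks_event k) \<omega> \<partial>M) / emeasure M (blocks_event k)"
  unfolding cond_expect_def by (rule nn_integral_uniform_measure) measurable

text \<open>Given the partition, the law of \<open>T\<close> is its law given the number of blocks.
  The indicators are weighted crosswise with the two probabilities, so that the transforms agree
  without a division.\<close>

lemma nn_integral_sample_partition_eq_cond_expect:
  assumes As: "distinct As" "partition_on {1..n} (set As)" and g[measurable]: "g \<in> borel_measurable borel"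
  shows "(\<integral>\<^sup>+\<omega>. g (T \<omega>) * indicator (partition_event (set As)) \<omega> \<partial>M) =
    cond_expect M (\<lambda>\<omega>. g (T \<omega>)) (\<lambda>\<omega>. num_blocks n I \<omega> = length As) *
    emeasure M (partition_event (set As))"
proof -
  let ?E = "partition_event (set As)" and ?k = "length As"
  let ?K = "blocks_event ?k"
  have k: "1 \<le> ?k" "?k \<le> n" using partition_on_list[OF As] n by auto
  have K: "emeasure M ?K \<noteq> 0" "emeasure M ?K \<noteq> \<infinity>" using emeasure_num_blocks_pos[OF k] by auto
  have "(\<integral>\<^sup>+\<omega>. (emeasure M ?K * indicator ?E \<omega>) * g (T \<omega>) \<partial>M) = (\<integral>\<^sup>+\<omega>. (emeasure M ?E * indicator ?K \<omega>) * g (T \<omega>) \<partial>M)"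
  proof (rule nn_integral_eqI_Laplace_power[where n=n and X=T and Y=T and g=g])
    have eq: "(\<integral>\<^sup>+\<omega>. (emeasure M ?K * indicator ?E \<omega>) * ennreal (T \<omega> ^ n * exp (- (y * T \<omega>))) \<partial>M) =
        emeasure M ?K * emeasure M ?E * ennreal (\<gamma> * Gamma (real n) / Gamma (real ?k) * (y powr (real ?k * \<gamma> - real n) * exp (- (y powr \<gamma>))))"
      "(\<integral>\<^sup>+\<omega>. (emeasure M ?E * indicator ?K \<omega>) * ennreal (T \<omega> ^ n * exp (- (y * T \<omega>))) \<partial>M) =
        emeasure M ?K * emeasure M ?E * ennreal (\<gamma> * Gamma (real n) / Gamma (real ?k) * (y powr (real ?k * \<gamma> - real n) * exp (- (y powr \<gamma>))))"
      if "0 < y" for y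
    proof -
      have 1: "(a * b) * c = a * (c * b)" for a b c :: ennreal by (simp only: mult_ac)
      show "(\<integral>\<^sup>+\<omega>. (emeasure M ?K * indicator ?E \<omega>) * ennreal (T \<omega> ^ n * exp (- (y * T \<omega>))) \<partial>M) =
        emeasure M ?K * emeasure M ?E * ennreal (\<gamma> * Gamma (real n) / Gamma (real ?k) * (y powr (real ?k * \<gamma> - real n) * exp (- (y powr \<gamma>))))"
        unfolding 1 by (subst nn_integral_cmult, measurable) (simp only: Laplace_sample_partition'[OF As that] mult_ac)
      show "(\<integral>\<^sup>+\<omega>. (emeasure M ?E * indicator ?K \<omega>) * ennreal (T \<omega> ^ n * exp (- (y * T \<omega>))) \<partial>M) =
        emeasure M ?K * emeasure M ?E * ennreal (\<gamma> * Gamma (real n) / Gamma (real ?k) * (y powr (real ?k * \<gamma> - real n) * exp (- (y powr \<gamma>))))"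
        unfolding 1 by (subst nn_integral_cmult, measurable) (simp only: Laplace_num_blocks[OF that] mult_ac)
    qed
    show "(\<integral>\<^sup>+\<omega>. (emeasure M ?K * indicator ?E \<omega>) * ennreal (T \<omega> ^ n * exp (- (y * T \<omega>))) \<partial>M) =
        (\<integral>\<^sup>+\<omega>. (emeasure M ?E * indicator ?K \<omega>) * ennreal (T \<omega> ^ n * exp (- (y * T \<omega>))) \<partial>M)" if "0 < y" for y
      unfolding eq[OF that] ..
    show "(\<integral>\<^sup>+\<omega>. (emeasure M ?K * indicator ?E \<omega>) * ennreal (T \<omega> ^ n * exp (- T \<omega>)) \<partial>M) < \<infinity>"
      using eq(1)[of 1] by (simp add: ennreal_mult_eq_top_iff less_top[symmetric])
  qed (use AE_T_pos in auto)
  then have "emeasure M ?K * (\<integral>\<^sup>+\<omega>. g (T \<omega>) * indicator ?E \<omega> \<partial>M) = emeasure M ?E * (\<integral>\<^sup>+\<omega>. g (T \<omega>) * indicator ?K \<omega> \<partial>M)"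
    by (subst (1 2) nn_integral_cmult[symmetric]) (auto simp: mult_ac)
  then have "(\<integral>\<^sup>+\<omega>. g (T \<omega>) * indicator ?E \<omega> \<partial>M) * emeasure M ?K / emeasure M ?K =
      (\<integral>\<^sup>+\<omega>. g (T \<omega>) * indicator ?K \<omega> \<partial>M) * emeasure M ?E / emeasure M ?K"
    by (simp only: mult.commute)
  then show ?thesis using K
    by (simp add: cond_expect_num_blocks mult_divide_eq_ennreal) (simp add: divide_ennreal_def mult_ac)
qed

end

lemma pd_modelD:
  assumes "0 < \<gamma>" "\<gamma> < 1" "1 \<le> n" "pd_model \<gamma> M J n I"
  shows "pd \<gamma> M J n I"
  using assms unfolding pd_model_def
  by (auto intro!: pd.intro stable_pd.intro stable_ppp.intro iid_sampling.intro pd_axioms.intro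
      stable_pd_axioms.intro simp: iid_sample_def)

section \<open>Poisson--Kingman laws and independent copies\<close>

text \<open>The Poisson-Kingman law is the law of the normalized points after reweighting by h(T).
  This form holds for \<open>h\<close> with infinite values, without first knowing that the weight
  has mass 1.\<close>

lemma PK_eq_distr:
  fixes h :: "real \<Rightarrow> ennreal"
  assumes M: "prob_space M"
    and pd[measurable]: "pd_seq J \<in> measurable M seq_space" and T[measurable]: "total_mass J \<in> borel_measurable M"
    and pos: "AE \<omega> in M. 0 < total_mass J \<omega>"
    and h[measurable]: "h \<in> borel_measurable borel"
    and f: "distributed M lborel (total_mass J) f"
    and \<kappa>: "regular_cond_law M J \<kappa>"
  shows "PK \<kappa> h f = distr (density M (\<lambda>\<omega>. h (total_mass J \<omega>))) seq_space (pd_seq J)"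
proof -
  let ?T = "total_mass J" and ?P = "density lborel (\<lambda>t. h t * f t * indicator {0<..} t)"
  have [measurable]: "f \<in> borel_measurable borel" using distributed_borel_measurable[OF f] by simp
  have law: "distr M borel ?T = density lborel f"
    using distributed_distr_eq_density[OF f] by (simp cong: distr_cong)
  have \<kappa>m: "\<kappa> \<in> measurable borel (prob_algebra seq_space)" using \<kappa> by (simp add: regular_cond_law_def)
  then have \<kappa>s: "\<kappa> \<in> measurable ?P (subprob_algebra seq_space)"
    using measurable_prob_algebraD by (simp cong: measurable_cong_sets)
  have \<kappa>B[measurable]: "(\<lambda>t. emeasure (\<kappa> t) B) \<in> borel_measurable borel" if "B \<in> sets seq_space" for B
    using measurable_compose[OF measurable_prob_algebraD[OF \<kappa>m] measurable_emeasure_subprob_algebra[OF that]] .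
  show ?thesis
  proof (rule measure_eqI)
    show "sets (PK \<kappa> h f) = sets (distr (density M (\<lambda>\<omega>. h (?T \<omega>))) seq_space (pd_seq J))"
      unfolding PK_def by (subst sets_bind[OF sets_kernel[OF \<kappa>s]]) auto
    fix B assume "B \<in> sets (PK \<kappa> h f)"
    then have B[measurable]: "B \<in> sets seq_space"
      unfolding PK_def by (subst (asm) sets_bind[OF sets_kernel[OF \<kappa>s]]) auto
    \<comment> \<open>For fixed B the defining identity of the kernel, read as a function of C, is
      an equality of measures in t; integrating \<open>h\<close> against both extends it from
      indicators to \<open>h\<close>.\<close>
    have eqB: "distr (density M (\<lambda>\<omega>. indicator (pd_seq J -` B \<inter> space M) \<omega>)) borel ?T =
        density (distr M borel ?T) (\<lambda>t. emeasure (\<kappa> t) B)"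
    proof (rule measure_eqI)
      fix C assume "C \<in> sets (distr (density M (\<lambda>\<omega>. indicator (pd_seq J -` B \<inter> space M) \<omega>)) borel ?T)"
      then have C[measurable]: "C \<in> sets borel" by simp
      have "emeasure (distr (density M (\<lambda>\<omega>. indicator (pd_seq J -` B \<inter> space M) \<omega>)) borel ?T) C =
          (\<integral>\<^sup>+\<omega>. indicator (pd_seq J -` B \<inter> space M) \<omega> * indicator (?T -` C \<inter> space M) \<omega> \<partial>M)"
        by (simp add: emeasure_distr emeasure_density)
      also have "\<dots> = (\<integral>\<^sup>+\<omega>. indicator {\<omega> \<in> space M. pd_seq J \<omega> \<in> B \<and> ?T \<omega> \<in> C} \<omega> \<partial>M)"
        by (intro nn_integral_cong) (auto simp: indicator_def)
      also have "\<dots> = emeasure M {\<omega> \<in> space M. pd_seq J \<omega> \<in> B \<and> ?T \<omega> \<in> C}"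
        by (rule nn_integral_indicator) measurable
      also have "\<dots> = (\<integral>\<^sup>+t. emeasure (\<kappa> t) B * indicator C t \<partial>distr M borel ?T)"
        using \<kappa> B C by (simp add: regular_cond_law_def)
      also have "\<dots> = emeasure (density (distr M borel ?T) (\<lambda>t. emeasure (\<kappa> t) B)) C"
        by (simp add: emeasure_density)
      finally show "emeasure (distr (density M (\<lambda>\<omega>. indicator (pd_seq J -` B \<inter> space M) \<omega>)) borel ?T) C =
          emeasure (density (distr M borel ?T) (\<lambda>t. emeasure (\<kappa> t) B)) C" .
    qed simp
    have "emeasure (PK \<kappa> h f) B = (\<integral>\<^sup>+t. emeasure (\<kappa> t) B \<partial>?P)"
      unfolding PK_def by (rule emeasure_bind[OF _ \<kappa>s B]) simp
    also have "\<dots> = (\<integral>\<^sup>+t. f t * (emeasure (\<kappa> t) B * (h t * indicator {0<..} t)) \<partial>lborel)"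
      by (subst nn_integral_density) (auto intro!: nn_integral_cong simp: mult_ac)
    also have "\<dots> = (\<integral>\<^sup>+t. emeasure (\<kappa> t) B * (h t * indicator {0<..} t) \<partial>distr M borel ?T)"
      unfolding law by (subst nn_integral_density) auto
    also have "\<dots> = (\<integral>\<^sup>+t. h t * indicator {0<..} t \<partial>density (distr M borel ?T) (\<lambda>t. emeasure (\<kappa> t) B))"
      by (subst nn_integral_density) auto
    also have "\<dots> = (\<integral>\<^sup>+\<omega>. indicator (pd_seq J -` B \<inter> space M) \<omega> * (h (?T \<omega>) * indicator {0<..} (?T \<omega>)) \<partial>M)"
      unfolding eqB[symmetric] by (subst nn_integral_distr; (subst nn_integral_density)?; simp)
    also have "\<dots> = (\<integral>\<^sup>+\<omega>. h (?T \<omega>) * indicator (pd_seq J -` B \<inter> space M) \<omega> \<partial>M)"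
      using pos by (intro nn_integral_cong_AE) (auto elim!: eventually_mono simp: mult.commute)
    also have "\<dots> = emeasure (distr (density M (\<lambda>\<omega>. h (?T \<omega>))) seq_space (pd_seq J)) B"
      by (simp add: emeasure_distr emeasure_density)
    finally show "emeasure (PK \<kappa> h f) B = emeasure (distr (density M (\<lambda>\<omega>. h (?T \<omega>))) seq_space (pd_seq J)) B" .
  qed
qed

context pd
begin

text \<open>Through \<tau> both \<open>T\<close> and the block event belong to the sigma-algebra of
  which \<open>S\<close> is independent. Restricted to the block event, the joint law of
  \<open>T\<close> and \<open>S\<close> is thus a product measure.\<close>

lemma nn_integral_indep_copy:
  assumes S[measurable]: "S \<in> borel_measurable M"
    and indep: "indep_set
        (sets (vimage_algebra (space M) (\<lambda>\<omega>. (pd_seq J \<omega>, sample_partition n I \<omega>)) (seq_space \<Otimes>\<^sub>M count_space UNIV)))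
        (sets (vimage_algebra (space M) S borel))"
    and F[measurable]: "case_prod F \<in> borel_measurable (borel \<Otimes>\<^sub>M borel)"
  shows "(\<integral>\<^sup>+\<omega>. F (T \<omega>) (S \<omega>) * indicator (blocks_event k) \<omega> \<partial>M) =
    (\<integral>\<^sup>+\<omega>. (\<integral>\<^sup>+s. F (T \<omega>) s \<partial>distr M borel S) * indicator (blocks_event k) \<omega> \<partial>M)"
proof -
  obtain \<tau> where \<tau>m[measurable]: "\<tau> \<in> borel_measurable seq_space" and \<tau>: "AE \<omega> in M. T \<omega> = \<tau> (pd_seq J \<omega>)"
    by (rule T_eq_function_of_pd_seq)
  let ?K = "blocks_event k" and ?X = "\<lambda>\<omega>. \<tau> (pd_seq J \<omega>)"
  let ?\<mu> = "distr (density M (indicator ?K)) borel ?X" and ?\<nu> = "distr M borel S"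
  interpret S: prob_space ?\<nu> by (rule prob_space_distr) (rule S)
  have "finite_measure (density M (indicator ?K))"
    by (rule finite_measureI) (simp add: emeasure_density nn_integral_0_iff_AE)
  then interpret \<mu>: finite_measure ?\<mu> by (rule finite_measure.finite_measure_distr) simp
  have prod: "?\<mu> \<Otimes>\<^sub>M ?\<nu> = distr (density M (indicator ?K)) (borel \<Otimes>\<^sub>M borel) (\<lambda>\<omega>. (?X \<omega>, S \<omega>))"
  proof (rule pair_measure_eqI)
    show "sigma_finite_measure ?\<mu>" "sigma_finite_measure ?\<nu>" by unfold_locales
    show "sets (?\<mu> \<Otimes>\<^sub>M ?\<nu>) = sets (distr (density M (indicator ?K)) (borel \<Otimes>\<^sub>M borel) (\<lambda>\<omega>. (?X \<omega>, S \<omega>)))"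
      by (simp cong: sets_pair_measure_cong)
    fix A B assume "A \<in> sets ?\<mu>" "B \<in> sets ?\<nu>"
    then have A[measurable]: "A \<in> sets borel" and B[measurable]: "B \<in> sets borel" by auto
    let ?a = "{\<omega> \<in> space M. ?X \<omega> \<in> A \<and> num_blocks n I \<omega> = k}" and ?b = "{\<omega> \<in> space M. S \<omega> \<in> B}"
    have "{z \<in> space (seq_space \<Otimes>\<^sub>M count_space UNIV). \<tau> (fst z) \<in> A \<and> card (snd z :: nat set set) = k} \<in> sets (seq_space \<Otimes>\<^sub>M count_space UNIV)"
      by measurable
    from in_vimage_algebra[OF this, of "\<lambda>\<omega>. (pd_seq J \<omega>, sample_partition n I \<omega>)" "space M"]
    have a: "?a \<in> sets (vimage_algebra (space M) (\<lambda>\<omega>. (pd_seq J \<omega>, sample_partition n I \<omega>)) (seq_space \<Otimes>\<^sub>M count_space UNIV))"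
      by (rule back_subst[of "\<lambda>x. x \<in> _"]) (use measurable_space[OF measurable_pd_seq] in \<open>auto simp: num_blocks_def space_pair_measure\<close>)
    have b: "?b \<in> sets (vimage_algebra (space M) S borel)"
      using in_vimage_algebra[OF B, of S "space M"] by (simp add: vimage_def Int_def conj_commute)
    have "prob (?a \<inter> ?b) = prob ?a * prob ?b" by (rule indep_setD[OF indep a b])
    then have "emeasure M (?a \<inter> ?b) = emeasure M ?a * emeasure M ?b"
      by (simp add: emeasure_eq_measure ennreal_mult)
    moreover have "emeasure ?\<mu> A = emeasure M ?a"
    proof -
      have "emeasure ?\<mu> A = (\<integral>\<^sup>+\<omega>. indicator ?K \<omega> * indicator (?X -` A \<inter> space M) \<omega> \<partial>M)"
        by (simp add: emeasure_distr emeasure_density)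
      also have "\<dots> = (\<integral>\<^sup>+\<omega>. indicator ?a \<omega> \<partial>M)"
        by (intro nn_integral_cong) (auto simp: indicator_def)
      finally show ?thesis by simp
    qed
    moreover have "emeasure ?\<nu> B = emeasure M ?b"
      by (simp add: emeasure_distr vimage_def Int_def conj_commute)
    moreover have "emeasure (distr (density M (indicator ?K)) (borel \<Otimes>\<^sub>M borel) (\<lambda>\<omega>. (?X \<omega>, S \<omega>))) (A \<times> B) = emeasure M (?a \<inter> ?b)"
    proof -
      have "emeasure (distr (density M (indicator ?K)) (borel \<Otimes>\<^sub>M borel) (\<lambda>\<omega>. (?X \<omega>, S \<omega>))) (A \<times> B) =
          (\<integral>\<^sup>+\<omega>. indicator ?K \<omega> * indicator ((\<lambda>\<omega>. (?X \<omega>, S \<omega>)) -` (A \<times> B) \<inter> space M) \<omega> \<partial>M)"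
        by (simp add: emeasure_distr emeasure_density)
      also have "\<dots> = (\<integral>\<^sup>+\<omega>. indicator (?a \<inter> ?b) \<omega> \<partial>M)"
        by (intro nn_integral_cong) (auto simp: indicator_def)
      also have "\<dots> = emeasure M (?a \<inter> ?b)" by (rule nn_integral_indicator) measurable
      finally show ?thesis .
    qed
    ultimately show "emeasure ?\<mu> A * emeasure ?\<nu> B =
        emeasure (distr (density M (indicator ?K)) (borel \<Otimes>\<^sub>M borel) (\<lambda>\<omega>. (?X \<omega>, S \<omega>))) (A \<times> B)"
      by simp
  qed
  have Fpr: "case_prod F \<in> borel_measurable (?\<mu> \<Otimes>\<^sub>M ?\<nu>)"
    using F by (simp cong: measurable_cong_sets sets_pair_measure_cong)
  have Fin[measurable]: "(\<lambda>t. \<integral>\<^sup>+s. F t s \<partial>?\<nu>) \<in> borel_measurable borel"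
    using S.borel_measurable_nn_integral[of F borel] F by (simp cong: measurable_cong_sets sets_pair_measure_cong)
  have "(\<integral>\<^sup>+\<omega>. F (T \<omega>) (S \<omega>) * indicator ?K \<omega> \<partial>M) = (\<integral>\<^sup>+\<omega>. indicator ?K \<omega> * F (?X \<omega>) (S \<omega>) \<partial>M)"
    using \<tau> by (intro nn_integral_cong_AE) (auto elim!: eventually_mono simp: mult.commute)
  also have "\<dots> = (\<integral>\<^sup>+z. case_prod F z \<partial>distr (density M (indicator ?K)) (borel \<Otimes>\<^sub>M borel) (\<lambda>\<omega>. (?X \<omega>, S \<omega>)))"
    by (subst nn_integral_distr; (subst nn_integral_density)?; simp)
  also have "\<dots> = (\<integral>\<^sup>+t. \<integral>\<^sup>+s. F t s \<partial>?\<nu> \<partial>?\<mu>)"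
    unfolding prod[symmetric] using S.nn_integral_fst[OF Fpr] by simp
  also have "\<dots> = (\<integral>\<^sup>+\<omega>. indicator ?K \<omega> * (\<integral>\<^sup>+s. F (?X \<omega>) s \<partial>?\<nu>) \<partial>M)"
    by (subst nn_integral_distr; (subst nn_integral_density)?; simp)
  also have "\<dots> = (\<integral>\<^sup>+\<omega>. (\<integral>\<^sup>+s. F (T \<omega>) s \<partial>?\<nu>) * indicator ?K \<omega> \<partial>M)"
    using \<tau> by (intro nn_integral_cong_AE) (auto elim!: eventually_mono simp: mult.commute)
  finally show ?thesis .
qed

text \<open>Up to sign, the left side is the n-th derivative of exp(-(y powr \<gamma>)); summing
  over the possible numbers of blocks gives its Faa di Bruno expansion, with block-count
  probabilities in place of combinatorial numbers.\<close>

lemma Laplace_T_power: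
  assumes y: "0 < y"
  shows "(\<integral>\<^sup>+\<omega>. ennreal (T \<omega> ^ n * exp (- (y * T \<omega>))) \<partial>M) =
    (\<Sum>j=1..n. emeasure M (blocks_event j) *
      ennreal (\<gamma> * Gamma (real n) / Gamma (real j) * (y powr (real j * \<gamma> - real n) * exp (- (y powr \<gamma>)))))"
proof -
  let ?K = "\<lambda>j. blocks_event j"
  have "(\<Sum>j=1..n. indicator (?K j) \<omega>) = (1 :: ennreal)" if "\<omega> \<in> space M" for \<omega>
  proof -
    have P: "partition_on {1..n} (sample_partition n I \<omega>)" by (rule partition_on_sample_partition)
    then have "finite (sample_partition n I \<omega>)" by (rule finite_elements[rotated]) simp
    then obtain As where As: "set As = sample_partition n I \<omega>" "distinct As"
      using finite_distinct_list by blast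
    then have "length As = num_blocks n I \<omega>" by (metis num_blocks_def distinct_card)
    then have "num_blocks n I \<omega> \<in> {1..n}"
      using partition_on_list(3,4)[of As n] As P n by auto
    then have "(\<Sum>j=1..n. indicator (?K j) \<omega>) = (\<Sum>j\<in>{num_blocks n I \<omega>}. indicator (?K j) \<omega> :: ennreal)"
      by (intro sum.mono_neutral_right) (auto simp: indicator_eq_0_iff)
    then show ?thesis using that by simp
  qed
  then have "(\<integral>\<^sup>+\<omega>. ennreal (T \<omega> ^ n * exp (- (y * T \<omega>))) \<partial>M) =
     (\<integral>\<^sup>+\<omega>. (\<Sum>j=1..n. ennreal (T \<omega> ^ n * exp (- (y * T \<omega>))) * indicator (?K j) \<omega>) \<partial>M)"
    by (intro nn_integral_cong) (simp add: sum_distrib_left[symmetric])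
  also have "\<dots> = (\<Sum>j=1..n. \<integral>\<^sup>+\<omega>. ennreal (T \<omega> ^ n * exp (- (y * T \<omega>))) * indicator (?K j) \<omega> \<partial>M)"
    by (rule nn_integral_sum) measurable
  finally show ?thesis by (simp only: Laplace_num_blocks[OF y])
qed

end

section \<open>The \<open>\<beta>\<close> model inside the \<open>\<alpha>\<close> model\<close>

theorem proposition4p1:
  fixes \<alpha> \<beta> :: real
    and h :: "real \<Rightarrow> real"
    and ns :: "nat list" and n k :: nat
    and M\<alpha> :: "'a measure" and J\<alpha> :: "nat \<Rightarrow> 'a \<Rightarrow> real" and I\<alpha> :: "nat \<Rightarrow> 'a \<Rightarrow> nat"
    and M\<beta> :: "'b measure" and J\<beta> :: "nat \<Rightarrow> 'b \<Rightarrow> real" and I\<beta> :: "nat \<Rightarrow> 'b \<Rightarrow> nat"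
    and M\<delta> :: "'c measure" and J\<delta> :: "nat \<Rightarrow> 'c \<Rightarrow> real" and I\<delta> :: "nat \<Rightarrow> 'c \<Rightarrow> nat"
    and S :: "'a \<Rightarrow> real"
    and f :: "real \<Rightarrow> ennreal"
    and \<kappa> :: "real \<Rightarrow> (nat \<Rightarrow> real) measure"
    and N :: "'d measure" and V :: "'d \<Rightarrow> nat \<Rightarrow> real" and I :: "nat \<Rightarrow> 'd \<Rightarrow> nat"
  assumes index: "0 < \<beta>" "\<beta> < \<alpha>" "\<alpha> < 1"
    and ns: "ns \<noteq> []" "\<And>m. m \<in> set ns \<Longrightarrow> 0 < m" "length ns = k" "sum_list ns = n"
    \<comment> \<open>the \<open>PD(\<alpha>,0)\<close>, \<open>PD(\<beta>,0)\<close> and \<open>PD(\<beta>/\<alpha>,0)\<close> models and their partitions\<close>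
    and model_\<alpha>: "pd_model \<alpha> M\<alpha> J\<alpha> n I\<alpha>"
    and model_\<beta>: "pd_model \<beta> M\<beta> J\<beta> n I\<beta>"
    and model_\<delta>: "pd_model (\<beta> / \<alpha>) M\<delta> J\<delta> k I\<delta>"
    \<comment> \<open>\<open>S\<close> is a copy of the stable variable of index \<open>\<beta>/\<alpha>\<close>, independent of the
        \<open>PD(\<alpha>,0)\<close> sequence and its partition\<close>
    and S_meas: "S \<in> borel_measurable M\<alpha>"
    and S_law: "distr M\<alpha> borel S = distr M\<delta> borel (total_mass J\<delta>)"
    and S_indep: "prob_space.indep_set M\<alpha>
        (sets (vimage_algebra (space M\<alpha>) (\<lambda>\<omega>. (pd_seq J\<alpha> \<omega>, sample_partition n I\<alpha> \<omega>))
                 (seq_space \<Otimes>\<^sub>M count_space UNIV)))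
        (sets (vimage_algebra (space M\<alpha>) S borel))"
    and h: "h \<in> borel_measurable borel" "\<And>t. 0 \<le> h t"
      "(\<integral>\<^sup>+\<omega>. ennreal (h (total_mass J\<beta> \<omega>)) \<partial>M\<beta>) = 1"
    \<comment> \<open>the density of \<open>T\<^sub>\<alpha>\<close>, the kernel \<open>PD(\<alpha>|t)\<close>, and the Poisson--Kingman sequence \<open>V\<close>\<close>
    and f: "distributed M\<alpha> lborel (total_mass J\<alpha>) f"
    and \<kappa>: "regular_cond_law M\<alpha> J\<alpha> \<kappa>"
    and V_law: "distr N seq_space V = PK \<kappa> (h_tilde \<alpha> h M\<delta> J\<delta>) f"
    and V_sample: "iid_sample N V n I"
  shows "(\<forall>As. distinct As \<and> partition_on {1..n} (set As) \<and> map card As = ns \<longrightarrow>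
            emeasure N {\<omega> \<in> space N. sample_partition n I \<omega> = set As} =
            (\<Sum>j=1..k. block_prob M\<delta> k I\<delta> j * Psi h M\<beta> J\<beta> n I\<beta> j) * ennreal (pd_eppf \<alpha> ns)) \<and>
         cond_expect M\<alpha> (\<lambda>\<omega>. h_tilde \<alpha> h M\<delta> J\<delta> (total_mass J\<alpha> \<omega>)) (\<lambda>\<omega>. num_blocks n I\<alpha> \<omega> = k) =
         cond_expect M\<alpha> (\<lambda>\<omega>. ennreal (h (total_mass J\<alpha> \<omega> * S \<omega> powr (1 / \<alpha>))))
           (\<lambda>\<omega>. num_blocks n I\<alpha> \<omega> = k) \<and>
         cond_expect M\<alpha> (\<lambda>\<omega>. ennreal (h (total_mass J\<alpha> \<omega> * S \<omega> powr (1 / \<alpha>))))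
           (\<lambda>\<omega>. num_blocks n I\<alpha> \<omega> = k) =
         (\<Sum>j=1..k. block_prob M\<delta> k I\<delta> j * Psi h M\<beta> J\<beta> n I\<beta> j)"
proof -
  define \<delta> where "\<delta> = \<beta> / \<alpha>"
  have \<alpha>0: "0 < \<alpha>" and \<delta>: "0 < \<delta>" "\<delta> < 1" "\<delta> * \<alpha> = \<beta>" using index by (auto simp: \<delta>_def)
  have k: "1 \<le> k" using ns(1,3) by (cases ns) auto
  have "length ns \<le> sum_list ns" using ns(2) by (induction ns) (auto simp: Suc_le_eq add_strict_increasing)
  then have kn: "k \<le> n" using ns by simp
  have n: "1 \<le> n" using k kn by simp
  interpret A: pd \<alpha> M\<alpha> J\<alpha> n I\<alpha> using pd_modelD[OF \<alpha>0 index(3) n model_\<alpha>] .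
  interpret B: pd \<beta> M\<beta> J\<beta> n I\<beta> using index by (intro pd_modelD[OF _ _ n model_\<beta>]) auto
  interpret D: pd \<delta> M\<delta> J\<delta> k I\<delta> using pd_modelD[OF \<delta>(1,2) k] model_\<delta> by (simp add: \<delta>_def)
  interpret N: iid_sampling N V n I by unfold_locales (rule V_sample)
  interpret AD: pair_sigma_finite M\<alpha> M\<delta> ..
  note [measurable] = S_meas h(1)
  let ?ht = "h_tilde \<alpha> h M\<delta> J\<delta>"
  have [measurable]: "?ht \<in> borel_measurable borel"
    unfolding h_tilde_def[abs_def] by (rule D.borel_measurable_nn_integral) measurable
  have S_pos: "AE \<omega> in M\<alpha>. 0 < S \<omega>"
  proof -
    have "AE s in distr M\<alpha> borel S. 0 < s"
      unfolding S_law by (subst AE_distr_iff) (use D.AE_T_pos in auto)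
    then show ?thesis by (subst (asm) AE_distr_iff) auto
  qed
  have indep: "(\<integral>\<^sup>+\<omega>. F (A.T \<omega>) (S \<omega>) * indicator (A.blocks_event k) \<omega> \<partial>M\<alpha>) =
      (\<integral>\<^sup>+\<omega>. (\<integral>\<^sup>+\<omega>'. F (A.T \<omega>) (D.T \<omega>') \<partial>M\<delta>) * indicator (A.blocks_event k) \<omega> \<partial>M\<alpha>)"
    if [measurable]: "case_prod F \<in> borel_measurable (borel \<Otimes>\<^sub>M borel)" for F
  proof -
    have "(\<integral>\<^sup>+s. F t s \<partial>distr M\<alpha> borel S) = (\<integral>\<^sup>+\<omega>'. F t (D.T \<omega>') \<partial>M\<delta>)" for t
      unfolding S_law by (rule nn_integral_distr) (use measurable_compose_Pair1[OF _ that, of t] in auto)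
    then show ?thesis using A.nn_integral_indep_copy[OF S_meas S_indep that, of k] by simp
  qed
  let ?R = "\<lambda>\<omega>. A.T \<omega> * S \<omega> powr (1 / \<alpha>)"
  let ?K = "(A.blocks_event k)"
  let ?PA = "emeasure M\<alpha> ?K"
  let ?PB = "\<lambda>j. emeasure M\<beta> (B.blocks_event j)"
  let ?PD = "\<lambda>j. emeasure M\<delta> (D.blocks_event j)"
  let ?e = "\<lambda>y j. ennreal (\<beta> * Gamma (real n) / Gamma (real j) * (y powr (real j * \<beta> - real n) * exp (- (y powr \<beta>))))"
  have PA: "?PA \<noteq> 0" "?PA \<noteq> \<infinity>" using A.emeasure_num_blocks_pos[OF k kn] by auto
  have PB: "?PB j \<noteq> 0" "?PB j \<noteq> \<infinity>" if "j \<in> {1..k}" for j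
    using B.emeasure_num_blocks_pos[of j] that kn by auto
  have R_pos: "AE \<omega> in M\<alpha>. 0 < ?R \<omega>"
    using A.AE_T_pos S_pos by eventually_elim auto
  have LR: "(\<integral>\<^sup>+\<omega>. indicator ?K \<omega> * ennreal (?R \<omega> ^ n * exp (- (y * ?R \<omega>))) \<partial>M\<alpha>) = (\<Sum>j=1..k. ?PA * ?PD j * ?e y j)"
    if y: "0 < y" for y
  proof -
    let ?F = "\<lambda>t s. ennreal ((t * s powr (1 / \<alpha>)) ^ n * exp (- (y * (t * s powr (1 / \<alpha>)))))"
    let ?c = "\<alpha> * Gamma (real n) / Gamma (real k) * y powr (real k * \<alpha> - real n)"
    have G: "Gamma (real n) > 0" "Gamma (real k) > 0" using Gamma_nat_pos[OF n] Gamma_nat_pos[OF k] .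
    have c: "0 \<le> ?c" using G \<alpha>0 by simp
    \<comment> \<open>With S frozen at s, R is u times the \<alpha> variable, so the \<alpha>
      formula is used at y u. The powers of u combine to u powr (k \<alpha>) = s^k: the number of
      blocks k becomes an exponent, which is why the \<delta> model samples k points and not
      n.\<close>
    have inner: "(\<integral>\<^sup>+\<omega>. ?F (A.T \<omega>) s * indicator ?K \<omega> \<partial>M\<alpha>) =
        ?PA * ennreal ?c * ennreal (s ^ k * exp (- (y powr \<alpha> * s)))" if s: "0 < s" for s
    proof -
      define u where "u = s powr (1 / \<alpha>)"
      have u: "0 < u" using s by (simp add: u_def)
      have u\<alpha>: "u powr \<alpha> = s" using s \<alpha>0 by (simp add: u_def powr_powr)
      have yu: "(y * u) powr \<alpha> = y powr \<alpha> * s" using y u by (simp add: powr_mult u\<alpha>)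
      have "u ^ n * (y * u) powr (real k * \<alpha> - real n) = y powr (real k * \<alpha> - real n) * (u powr real n * u powr (real k * \<alpha> - real n))"
        using y u by (simp add: powr_mult powr_realpow)
      also have "u powr real n * u powr (real k * \<alpha> - real n) = u powr (real k * \<alpha>)" by (simp flip: powr_add)
      also have "\<dots> = (u powr \<alpha>) powr real k" by (simp only: powr_powr mult.commute)
      also have "\<dots> = s ^ k" unfolding u\<alpha> using s by (rule powr_realpow)
      finally have pw: "u ^ n * (y * u) powr (real k * \<alpha> - real n) = y powr (real k * \<alpha> - real n) * s ^ k" .
      have "(\<integral>\<^sup>+\<omega>. ?F (A.T \<omega>) s * indicator ?K \<omega> \<partial>M\<alpha>) =
          (\<integral>\<^sup>+\<omega>. ennreal (u ^ n) * (ennreal (A.T \<omega> ^ n * exp (- ((y * u) * A.T \<omega>))) * indicator ?K \<omega>) \<partial>M\<alpha>)"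
        unfolding u_def[symmetric]
      proof (rule nn_integral_cong)
        fix \<omega>
        have "(A.T \<omega> * u) ^ n * exp (- (y * (A.T \<omega> * u))) = u ^ n * (A.T \<omega> ^ n * exp (- ((y * u) * A.T \<omega>)))"
          by (simp add: power_mult_distrib mult_ac)
        then show "ennreal ((A.T \<omega> * u) ^ n * exp (- (y * (A.T \<omega> * u)))) * indicator ?K \<omega> =
            ennreal (u ^ n) * (ennreal (A.T \<omega> ^ n * exp (- ((y * u) * A.T \<omega>))) * indicator ?K \<omega>)"
          using u by (simp only: ennreal_mult'[OF zero_le_power[OF less_imp_le[OF u]]] mult.assoc)
      qed
      also have "\<dots> = ennreal (u ^ n) * (\<integral>\<^sup>+\<omega>. ennreal (A.T \<omega> ^ n * exp (- ((y * u) * A.T \<omega>))) * indicator ?K \<omega> \<partial>M\<alpha>)"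
        by (rule nn_integral_cmult) measurable
      also have "\<dots> = ennreal (u ^ n) * (?PA * ennreal (\<alpha> * Gamma (real n) / Gamma (real k) *
          ((y * u) powr (real k * \<alpha> - real n) * exp (- ((y * u) powr \<alpha>)))))"
        using y u by (subst A.Laplace_num_blocks) auto
      also have "\<dots> = ?PA * ennreal (u ^ n * (\<alpha> * Gamma (real n) / Gamma (real k) *
          ((y * u) powr (real k * \<alpha> - real n) * exp (- ((y * u) powr \<alpha>)))))"
        using u by (subst ennreal_mult') (auto simp: mult.left_commute)
      also have "u ^ n * (\<alpha> * Gamma (real n) / Gamma (real k) * ((y * u) powr (real k * \<alpha> - real n) * exp (- ((y * u) powr \<alpha>)))) =
          \<alpha> * Gamma (real n) / Gamma (real k) * ((u ^ n * (y * u) powr (real k * \<alpha> - real n)) * exp (- ((y * u) powr \<alpha>)))"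
        by (simp only: mult_ac)
      also have "\<dots> = ?c * (s ^ k * exp (- (y powr \<alpha> * s)))" unfolding pw yu by (simp only: mult_ac)
      finally show ?thesis unfolding ennreal_mult'[OF c] by (simp only: mult.assoc[of ?PA])
    qed
    \<comment> \<open>The exponents telescope, k\<alpha> - n + \<alpha>(j\<delta> - k) = j\<beta> -
      n, and so do the constants, since \<alpha>\<delta> = \<beta> and Gamma(k) cancels. What
      remains is the factor of the \<beta> model with j blocks in a sample of size n.\<close>
    have summand: "ennreal ?c * (?PD j * ennreal (\<delta> * Gamma (real k) / Gamma (real j) *
        ((y powr \<alpha>) powr (real j * \<delta> - real k) * exp (- ((y powr \<alpha>) powr \<delta>))))) = ?PD j * ?e y j" for j
    proof -
      have e1: "(y powr \<alpha>) powr \<delta> = y powr \<beta>" using \<delta>(3) by (simp add: powr_powr mult.commute)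
      have "(real k * \<alpha> - real n) + \<alpha> * (real j * \<delta> - real k) = real j * \<beta> - real n"
        unfolding \<delta>(3)[symmetric] by (simp add: algebra_simps)
      then have e2: "y powr (real k * \<alpha> - real n) * (y powr \<alpha>) powr (real j * \<delta> - real k) = y powr (real j * \<beta> - real n)"
        by (simp only: powr_powr powr_add[symmetric])
      have e3: "\<alpha> * Gamma (real n) / Gamma (real k) * (\<delta> * Gamma (real k) / Gamma (real j)) = \<beta> * Gamma (real n) / Gamma (real j)"
        unfolding \<delta>(3)[symmetric] using G by simp
      have "?c * (\<delta> * Gamma (real k) / Gamma (real j) * ((y powr \<alpha>) powr (real j * \<delta> - real k) * exp (- ((y powr \<alpha>) powr \<delta>)))) =
          (\<alpha> * Gamma (real n) / Gamma (real k) * (\<delta> * Gamma (real k) / Gamma (real j))) *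
          ((y powr (real k * \<alpha> - real n) * (y powr \<alpha>) powr (real j * \<delta> - real k)) * exp (- ((y powr \<alpha>) powr \<delta>)))"
        by (simp only: mult_ac)
      also have "\<dots> = \<beta> * Gamma (real n) / Gamma (real j) * (y powr (real j * \<beta> - real n) * exp (- (y powr \<beta>)))"
        unfolding e1 e2 e3 ..
      finally show ?thesis
        unfolding mult.left_commute[of "ennreal ?c"] ennreal_mult'[OF c, symmetric] by (rule arg_cong)
    qed
    have "(\<integral>\<^sup>+\<omega>. indicator ?K \<omega> * ennreal (?R \<omega> ^ n * exp (- (y * ?R \<omega>))) \<partial>M\<alpha>) = (\<integral>\<^sup>+\<omega>. ?F (A.T \<omega>) (S \<omega>) * indicator ?K \<omega> \<partial>M\<alpha>)"
      by (simp only: mult.commute)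
    also have "\<dots> = (\<integral>\<^sup>+\<omega>. (\<integral>\<^sup>+\<omega>'. ?F (A.T \<omega>) (D.T \<omega>') \<partial>M\<delta>) * indicator ?K \<omega> \<partial>M\<alpha>)"
      by (rule indep) measurable
    also have "\<dots> = (\<integral>\<^sup>+\<omega>. (\<integral>\<^sup>+\<omega>'. ?F (A.T \<omega>) (D.T \<omega>') * indicator ?K \<omega> \<partial>M\<delta>) \<partial>M\<alpha>)"
      by (intro nn_integral_cong nn_integral_multc[symmetric]) measurable
    also have "\<dots> = (\<integral>\<^sup>+\<omega>'. (\<integral>\<^sup>+\<omega>. ?F (A.T \<omega>) (D.T \<omega>') * indicator ?K \<omega> \<partial>M\<alpha>) \<partial>M\<delta>)"
      by (rule AD.Fubini'[symmetric]) measurable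
    also have "\<dots> = (\<integral>\<^sup>+\<omega>'. ?PA * ennreal ?c * ennreal (D.T \<omega>' ^ k * exp (- (y powr \<alpha> * D.T \<omega>'))) \<partial>M\<delta>)"
      using D.AE_T_pos by (intro nn_integral_cong_AE) (auto elim!: eventually_mono simp only: inner)
    also have "\<dots> = ?PA * ennreal ?c * (\<integral>\<^sup>+\<omega>'. ennreal (D.T \<omega>' ^ k * exp (- (y powr \<alpha> * D.T \<omega>'))) \<partial>M\<delta>)"
      by (rule nn_integral_cmult) measurable
    also have "(\<integral>\<^sup>+\<omega>'. ennreal (D.T \<omega>' ^ k * exp (- (y powr \<alpha> * D.T \<omega>'))) \<partial>M\<delta>) =
        (\<Sum>j=1..k. ?PD j * ennreal (\<delta> * Gamma (real k) / Gamma (real j) *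
          ((y powr \<alpha>) powr (real j * \<delta> - real k) * exp (- ((y powr \<alpha>) powr \<delta>)))))"
      using y by (intro D.Laplace_T_power) simp
    finally show ?thesis by (simp only: mult.assoc sum_distrib_left summand)
  qed
  \<comment> \<open>A weight on the \<beta> model under which the event of j blocks has mass
    \<open>?PA * ?PD j\<close>, as \<open>LR\<close> demands. The denominators are positive because
    j is at most k and hence at most n.\<close>
  let ?v = "\<lambda>\<omega>. \<Sum>j=1..k. ?PA * (?PD j / ?PB j) * indicator (B.blocks_event j) \<omega>"
  have v_int: "(\<integral>\<^sup>+\<omega>. ?v \<omega> * X \<omega> \<partial>M\<beta>) = (\<Sum>j=1..k. ?PA * (?PD j / ?PB j) *
      (\<integral>\<^sup>+\<omega>. X \<omega> * indicator (B.blocks_event j) \<omega> \<partial>M\<beta>))"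
    if [measurable]: "X \<in> borel_measurable M\<beta>" for X
  proof -
    have "(\<integral>\<^sup>+\<omega>. ?v \<omega> * X \<omega> \<partial>M\<beta>) = (\<integral>\<^sup>+\<omega>. (\<Sum>j=1..k. ?PA * (?PD j / ?PB j) *
        (X \<omega> * indicator (B.blocks_event j) \<omega>)) \<partial>M\<beta>)"
      unfolding sum_distrib_right by (intro nn_integral_cong sum.cong refl) (simp only: mult_ac)
    also have "\<dots> = (\<Sum>j=1..k. \<integral>\<^sup>+\<omega>. ?PA * (?PD j / ?PB j) *
        (X \<omega> * indicator (B.blocks_event j) \<omega>) \<partial>M\<beta>)"
      by (rule nn_integral_sum) measurable
    also have "\<dots> = (\<Sum>j=1..k. ?PA * (?PD j / ?PB j) *
      (\<integral>\<^sup>+\<omega>. X \<omega> * indicator (B.blocks_event j) \<omega> \<partial>M\<beta>))"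
      by (intro sum.cong refl nn_integral_cmult) measurable
    finally show ?thesis .
  qed
  have Lv: "(\<integral>\<^sup>+\<omega>. ?v \<omega> * ennreal (B.T \<omega> ^ n * exp (- (y * B.T \<omega>))) \<partial>M\<beta>) = (\<Sum>j=1..k. ?PA * ?PD j * ?e y j)"
    if y: "0 < y" for y
  proof (subst v_int, measurable, rule sum.cong)
    fix j assume j: "j \<in> {1..k}"
    have "?PD j / ?PB j * ?PB j = ?PD j * ?PB j / ?PB j"
      unfolding divide_ennreal_def by (simp only: mult_ac)
    also have "\<dots> = ?PD j" using PB[OF j] by (simp add: mult_divide_eq_ennreal)
    finally have d: "?PD j / ?PB j * ?PB j = ?PD j" .
    have "?PA * (?PD j / ?PB j) * (?PB j * ?e y j) = ?PA * (?PD j / ?PB j * ?PB j) * ?e y j"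
      by (simp only: mult.assoc)
    also have "\<dots> = ?PA * ?PD j * ?e y j" unfolding d ..
    finally show "?PA * (?PD j / ?PB j) * (\<integral>\<^sup>+\<omega>. ennreal (B.T \<omega> ^ n * exp (- (y * B.T \<omega>))) *
        indicator (B.blocks_event j) \<omega> \<partial>M\<beta>) = ?PA * ?PD j * ?e y j"
      by (simp only: B.Laplace_num_blocks[OF y])
  qed simp
  \<comment> \<open>By \<open>LR\<close> and \<open>Lv\<close> the weighted variables R and
    T_\<beta> have the same transform, so \<open>h\<close> may replace the exponential.\<close>
  have "(\<integral>\<^sup>+\<omega>. indicator ?K \<omega> * ennreal (h (?R \<omega>)) \<partial>M\<alpha>) = (\<integral>\<^sup>+\<omega>. ?v \<omega> * ennreal (h (B.T \<omega>)) \<partial>M\<beta>)"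
  proof (rule nn_integral_eqI_Laplace_power[where n=n and X="?R" and Y="B.T" and g="\<lambda>t. ennreal (h t)"])
    show "(\<integral>\<^sup>+\<omega>. indicator ?K \<omega> * ennreal (?R \<omega> ^ n * exp (- (y * ?R \<omega>))) \<partial>M\<alpha>) =
        (\<integral>\<^sup>+\<omega>. ?v \<omega> * ennreal (B.T \<omega> ^ n * exp (- (y * B.T \<omega>))) \<partial>M\<beta>)" if "0 < y" for y
      unfolding LR[OF that] Lv[OF that] ..
    have "(\<Sum>j=1..k. ?PA * ?PD j * ?e 1 j) < \<infinity>"
      by (simp add: less_top[symmetric] ennreal_mult_eq_top_iff)
    then show "(\<integral>\<^sup>+\<omega>. indicator ?K \<omega> * ennreal (?R \<omega> ^ n * exp (- ?R \<omega>)) \<partial>M\<alpha>) < \<infinity>"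
      using LR[of 1] by simp
  qed (use R_pos B.AE_T_pos in \<open>auto intro!: borel_measurable_sum\<close>)
  also have "\<dots> = (\<Sum>j=1..k. ?PA * (?PD j / ?PB j) *
      (\<integral>\<^sup>+\<omega>. ennreal (h (B.T \<omega>)) * indicator (B.blocks_event j) \<omega> \<partial>M\<beta>))"
    by (rule v_int) measurable
  also have "\<dots> = (\<Sum>j=1..k. block_prob M\<delta> k I\<delta> j * Psi h M\<beta> J\<beta> n I\<beta> j) * ?PA"
    unfolding sum_distrib_right Psi_def block_prob_def
    by (subst B.cond_expect_num_blocks, measurable) (simp add: divide_ennreal_def mult_ac)
  finally have key: "(\<integral>\<^sup>+\<omega>. ennreal (h (?R \<omega>)) * indicator ?K \<omega> \<partial>M\<alpha>) =
      (\<Sum>j=1..k. block_prob M\<delta> k I\<delta> j * Psi h M\<beta> J\<beta> n I\<beta> j) * ?PA"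
    by (simp only: mult.commute)
  have ht: "(\<integral>\<^sup>+\<omega>. ennreal (h (?R \<omega>)) * indicator ?K \<omega> \<partial>M\<alpha>) = (\<integral>\<^sup>+\<omega>. ?ht (A.T \<omega>) * indicator ?K \<omega> \<partial>M\<alpha>)"
    unfolding h_tilde_def by (rule indep) measurable
  have c1: "cond_expect M\<alpha> (\<lambda>\<omega>. ?ht (A.T \<omega>)) (\<lambda>\<omega>. num_blocks n I\<alpha> \<omega> = k) =
      cond_expect M\<alpha> (\<lambda>\<omega>. ennreal (h (?R \<omega>))) (\<lambda>\<omega>. num_blocks n I\<alpha> \<omega> = k)"
    by (subst (1 2) A.cond_expect_num_blocks) (auto simp: ht)
  have c2: "cond_expect M\<alpha> (\<lambda>\<omega>. ennreal (h (?R \<omega>))) (\<lambda>\<omega>. num_blocks n I\<alpha> \<omega> = k) =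
      (\<Sum>j=1..k. block_prob M\<delta> k I\<delta> j * Psi h M\<beta> J\<beta> n I\<beta> j)"
    using PA by (subst A.cond_expect_num_blocks) (auto simp: key mult_divide_eq_ennreal)
  have PK: "distr N seq_space V = distr (density M\<alpha> (\<lambda>\<omega>. ?ht (A.T \<omega>))) seq_space (pd_seq J\<alpha>)"
    unfolding V_law
    by (rule PK_eq_distr[OF A.prob_space_axioms A.measurable_pd_seq A.measurable_T A.AE_T_pos _ f \<kappa>]) measurable
  have eppf: "emeasure N {\<omega> \<in> space N. sample_partition n I \<omega> = set As} =
      (\<Sum>j=1..k. block_prob M\<delta> k I\<delta> j * Psi h M\<beta> J\<beta> n I\<beta> j) * ennreal (pd_eppf \<alpha> ns)"
    \<comment> \<open>The probability of a fixed partition is the mean of a function of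
      \<open>V\<close>, so only the law of \<open>V\<close> matters. \<open>PK\<close> moves it to
      the \<alpha> model reweighted by \<open>?ht\<close>, where the Gibbs property separates the
      conditional mean of \<open>?ht\<close> from the probability of the partition.\<close>
    if As: "distinct As" "partition_on {1..n} (set As)" "map card As = ns" for As
  proof -
    have len: "length As = k" using As(3) ns(3) by auto
    let ?D = "\<lambda>p. distinct_sum (\<lambda>i. ennreal (p i)) (map card As)"
    have [measurable]: "?D \<in> borel_measurable seq_space" by measurable
    have "emeasure N (N.partition_event (set As)) = (\<integral>\<^sup>+\<omega>. ?D (V \<omega>) \<partial>N)"
      using N.nn_integral_sample_partition[OF As(1,2), of "\<lambda>_. 1"] by simp
    also have "\<dots> = (\<integral>\<^sup>+p. ?D p \<partial>distr N seq_space V)" by (subst nn_integral_distr) auto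
    also have "\<dots> = (\<integral>\<^sup>+\<omega>. ?ht (A.T \<omega>) * ?D (pd_seq J\<alpha> \<omega>) \<partial>M\<alpha>)"
      unfolding PK by (subst nn_integral_distr; (subst nn_integral_density)?; simp)
    also have "\<dots> = (\<integral>\<^sup>+\<omega>. ?ht (A.T \<omega>) * indicator (A.partition_event (set As)) \<omega> \<partial>M\<alpha>)"
      by (rule A.nn_integral_T_sample_partition[OF As(1,2), symmetric]) measurable
    also have "\<dots> = cond_expect M\<alpha> (\<lambda>\<omega>. ?ht (A.T \<omega>)) (\<lambda>\<omega>. num_blocks n I\<alpha> \<omega> = length As) *
        emeasure M\<alpha> (A.partition_event (set As))"
      by (rule A.nn_integral_sample_partition_eq_cond_expect[OF As(1,2)]) measurable
    finally show ?thesis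
      unfolding len c1 c2 A.emeasure_sample_partition_pd_eppf[OF As(1,2)] As(3) .
  qed
  show ?thesis using eppf c1 c2 by blast
qed

end
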